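(* Let $Y_{n,k}$ be the number of nodes at level $k$ in a random plane-oriented recursive tree (PORT) of $n$ nodes. Let $W_n=\max_kY_{n,k}$ and let $k^*$ be one of the levels with $Y_{n,k^*}=W_n$. Then, as $n\to\infty$, with $\sigma^2=1/2$, $$\mathbb{E}\{W_n\}=\frac{n}{\sqrt{2\pi\sigma^2L_n}}\bigl(1+O(L_n^{-1})\bigr),$$ $$\mathbb{E}\{|W_n-\mathbb{E}\{W_n\}|^s\}=O\bigl(n^sL_n^{-3s/2}\bigr)\qquad(s\ge0),$$ and, for every $B>0$, there is $T_0>1$ such that for $T>T_0$ $$\mathbb{P}\Bigl(\Bigl|k^*-\frac12 L_n\Bigr|\ge T\Bigr)=O(T^{-B}),$$ with implied constant independent of $n$ and $T$. Moreover, $W_n/\mathbb{E}\{W_n\}\to1$ almost surely.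
   Context: $L_n:=\max\{\log n,1\}$ (natural logarithm). A PORT of $n$ nodes is a rooted ordered (plane) tree with nodes labeled $1,\dots,n$, labels increasing along every path down from the root, and no restriction on the degrees of nodes; a random PORT is uniformly distributed among all PORTs of $n$ nodes. Equivalently, it is grown sequentially: node $1$ is the root, and each new node is attached to an existing node $v$ with probability proportional to (number of children of $v$)$+1$ (each insertion position among the children being equally likely); the almost sure statement refers to this growth process. The root is at level $0$. *)

theory Defs
  imports "HOL-Probability.Probability" "HOL-Library.Landau_Symbols"
begin

definition L :: "nat \<Rightarrow> real" where
  "L n = max (ln (real n)) 1"

datatype ptree = PTree (root_label: nat) (subtrees: "ptree list")

fun nodes :: "ptree \<Rightarrow> nat list" where
  "nodes (PTree a ts) = a # concat (map nodes ts)"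

fun increasing_labels :: "ptree \<Rightarrow> bool" where
  "increasing_labels (PTree a ts) \<longleftrightarrow> (\<forall>t\<in>set ts. a < root_label t \<and> increasing_labels t)"

definition port :: "nat \<Rightarrow> ptree \<Rightarrow> bool" where
  "port n t \<longleftrightarrow> distinct (nodes t) \<and> set (nodes t) = {1..n} \<and> increasing_labels t"

lemma finite_port: "finite {t. port n t}"
proof -
  have fin: "finite {t. set (nodes t) \<subseteq> {1..n} \<and> length (nodes t) \<le> k}" for k
  proof (induction k)
    case 0
    have "length (nodes t) > 0" for t by (cases t) auto
    then have "{t. set (nodes t) \<subseteq> {1..n} \<and> length (nodes t) \<le> 0} = {}" by auto
    then show ?case by (metis finite.emptyI)
  next
    case (Suc k)
    let ?S = "{t. set (nodes t) \<subseteq> {1..n} \<and> length (nodes t) \<le> k}"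
    have pos: "1 \<le> length (nodes t)" for t by (cases t) auto
    have "PTree a ts \<in> case_prod PTree ` ({1..n} \<times> {xs. set xs \<subseteq> ?S \<and> length xs \<le> k})"
      if "set (nodes (PTree a ts)) \<subseteq> {1..n}" "length (nodes (PTree a ts)) \<le> Suc k" for a ts
    proof -
      have sum: "(\<Sum>t\<leftarrow>ts. length (nodes t)) \<le> k"
        using that by (simp add: length_concat comp_def)
      have "length ts \<le> (\<Sum>t\<leftarrow>ts. length (nodes t))"
        using sum_list_mono[of ts "\<lambda>_. 1" "\<lambda>t. length (nodes t)"] pos by (simp add: sum_list_triv)
      moreover have "length (nodes t) \<le> k" if "t \<in> set ts" for t
        using sum member_le_sum_list[of "length (nodes t)" "map (\<lambda>t. length (nodes t)) ts"] that
        by simp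
      ultimately show ?thesis using that sum by (fastforce intro!: image_eqI[of _ _ "(a, ts)"])
    qed
    then have "{t. set (nodes t) \<subseteq> {1..n} \<and> length (nodes t) \<le> Suc k}
        \<subseteq> case_prod PTree ` ({1..n} \<times> {xs. set xs \<subseteq> ?S \<and> length xs \<le> k})"
      by (metis (no_types, lifting) mem_Collect_eq ptree.exhaust subsetI)
    then show ?case
      by (rule finite_subset) (intro finite_imageI finite_cartesian_product finite_lists_length_le Suc finite_atLeastAtMost)
  qed
  have "length (nodes t) = n" if "port n t" for t
    using that distinct_card[of "nodes t"] by (simp add: port_def)
  then have "{t. port n t} \<subseteq> {t. set (nodes t) \<subseteq> {1..n} \<and> length (nodes t) \<le> n}"
    by (auto simp: port_def)
  then show ?thesis using fin finite_subset by blast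
qed

lemma port_exists:
  assumes "n \<ge> 1" shows "\<exists>t. port n t"
proof -
  have eq: "concat (map (nodes \<circ> (\<lambda>i. PTree i [])) xs) = xs" for xs by (induction xs) auto
  have "port n (PTree 1 (map (\<lambda>i. PTree i []) [2..<Suc n]))"
    using assms unfolding port_def by (auto simp: eq simp del: upt_Suc)
  then show ?thesis ..
qed

definition random_port :: "nat \<Rightarrow> ptree pmf" where
  "random_port n = pmf_of_set {t. port n t}"

fun profile :: "ptree \<Rightarrow> nat \<Rightarrow> nat" where
  "profile (PTree a ts) 0 = 1"
| "profile (PTree a ts) (Suc k) = (\<Sum>t\<leftarrow>ts. profile t k)"

definition width :: "ptree \<Rightarrow> nat" where
  "width t = Max (range (profile t))"

definition mean_width :: "nat \<Rightarrow> real" where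
  "mean_width n = measure_pmf.expectation (random_port n) (\<lambda>t. real (width t))"

text \<open>The number of children of the node labelled \<open>v\<close>, and the insertion of a new leaf labelled
  \<open>m\<close> among these children, in front of the one with index \<open>i\<close> (or after the last one). Both are
  meant for trees with distinct labels.\<close>

fun outdeg :: "ptree \<Rightarrow> nat \<Rightarrow> nat" where
  "outdeg (PTree a ts) v = (if a = v then length ts else \<Sum>t\<leftarrow>ts. outdeg t v)"

fun attach :: "nat \<Rightarrow> nat \<Rightarrow> nat \<Rightarrow> ptree \<Rightarrow> ptree" where
  "attach m v i (PTree a ts) =
     (if a = v then PTree a (take i ts @ PTree m [] # drop i ts)
      else PTree a (map (attach m v i) ts))"

text \<open>One growth step: a pair \<open>(v, i)\<close> of a node and an insertion position among its children is
  drawn uniformly, so that \<open>v\<close> is drawn with probability proportional to \<open>outdeg t v + 1\<close> and,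
  given \<open>v\<close>, all \<open>outdeg t v + 1\<close> positions are equally likely.\<close>

definition grow :: "ptree \<Rightarrow> ptree pmf" where
  "grow t = map_pmf (\<lambda>(v, i). attach (Suc (length (nodes t))) v i t)
     (pmf_of_set (SIGMA v:set (nodes t). {0..outdeg t v}))"

text \<open>\<open>T n\<close> is the tree with \<open>n\<close> nodes for \<open>n \<ge> 1\<close>; \<open>T 0\<close> plays no role.\<close>

definition port_process :: "'a measure \<Rightarrow> (nat \<Rightarrow> 'a \<Rightarrow> ptree) \<Rightarrow> bool" where
  "port_process M T \<longleftrightarrow>
     prob_space M \<and>
     (\<forall>n\<ge>1. T n \<in> measurable M (count_space UNIV)) \<and>
     (AE x in M. T 1 x = PTree 1 []) \<and>
     (\<forall>n\<ge>1. \<forall>h :: nat \<Rightarrow> ptree.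
        measure M {x \<in> space M. \<forall>i\<in>{1..Suc n}. T i x = h i} =
        measure M {x \<in> space M. \<forall>i\<in>{1..n}. T i x = h i} * pmf (grow (h n)) (h (Suc n)))"

text \<open>Such a process exists: the product space supplies, independently for all \<open>n\<close> and \<open>t\<close>, a random
  successor of \<open>t\<close> with law \<open>grow t\<close>.\<close>

instance ptree :: countable by countable_datatype

lemma port_process_exists:
  "\<exists>(M :: (nat \<times> ptree \<Rightarrow> ptree) measure) T. port_process M T"
proof -
  define M :: "(nat \<times> ptree \<Rightarrow> ptree) measure"
    where "M = PiM UNIV (\<lambda>(n, t). measure_pmf (grow t))"
  interpret P: product_prob_space "\<lambda>p::nat \<times> ptree. case p of (n, t) \<Rightarrow> measure_pmf (grow t)" UNIV
    by (rule product_prob_spaceI) (auto split: prod.splits intro: measure_pmf.prob_space_axioms)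
  define T :: "nat \<Rightarrow> (nat \<times> ptree \<Rightarrow> ptree) \<Rightarrow> ptree"
    where "T n w = rec_nat (PTree 1 []) (\<lambda>m t. w (Suc m, t)) (n - 1)" for n w
  have T1: "T 1 w = PTree 1 []" for w by (simp add: T_def)
  have TS: "T (Suc n) w = w (n, T n w)" if "n \<ge> 1" for n w
    using that by (cases n) (auto simp: T_def)
  have sp: "space M = UNIV" by (auto simp: M_def space_PiM PiE_def split: prod.splits)
  have comp: "(\<lambda>w. w p) \<in> measurable M (count_space UNIV)" for p
  proof -
    obtain n t where p: "p = (n, t)" by (cases p)
    have "(\<lambda>w. w p) \<in> measurable M (measure_pmf (grow t))"
      using measurable_component_singleton[of p UNIV "\<lambda>(n, t). measure_pmf (grow t)"]
      unfolding M_def p by (simp only: prod.case UNIV_I simp_thms)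
    then show ?thesis by (simp add: measurable_def)
  qed
  have meas: "T n \<in> measurable M (count_space UNIV)" if "n \<ge> 1" for n
    using that
  proof (induction n rule: dec_induct)
    case base
    have "T 1 = (\<lambda>_. PTree 1 [])" by (rule ext) (rule T1)
    then show ?case by simp
  next
    case (step n)
    have "(\<lambda>w. w (n, T n w)) \<in> measurable M (count_space UNIV)"
      by (rule measurable_compose_countable[OF comp step.IH])
    moreover have "T (Suc n) = (\<lambda>w. w (n, T n w))" by (rule ext) (rule TS[OF step.hyps(1)])
    ultimately show ?case by simp
  qed
  have cyl: "(\<forall>i\<in>{1..Suc n}. T i w = h i) \<longleftrightarrow>
      h 1 = PTree 1 [] \<and> (\<forall>p\<in>(\<lambda>i. (i, h i)) ` {1..n}. w p \<in> {h (Suc (fst p))})" for n h w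
  proof (induction n)
    case 0
    then show ?case using T1 by auto
  next
    case (Suc n)
    have "(\<forall>i\<in>{1..Suc (Suc n)}. T i w = h i) \<longleftrightarrow>
       (\<forall>i\<in>{1..Suc n}. T i w = h i) \<and> w (Suc n, h (Suc n)) = h (Suc (Suc n))"
      using TS[of "Suc n" w] by (auto simp: atLeastAtMostSuc_conv)
    then show ?case unfolding Suc by (auto simp: atLeastAtMostSuc_conv)
  qed
  have law: "measure M {w \<in> space M. \<forall>i\<in>{1..Suc n}. T i w = h i} =
      (if h 1 = PTree 1 [] then \<Prod>i\<in>{1..n}. pmf (grow (h i)) (h (Suc i)) else 0)" for n h
  proof (cases "h 1 = PTree 1 []")
    case True
    let ?J = "(\<lambda>i. (i, h i)) ` {1..n}"
    have "emeasure M {w \<in> space M. \<forall>i\<in>{1..Suc n}. T i w = h i} =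
      emeasure M {w \<in> space M. \<forall>p\<in>?J. w p \<in> {h (Suc (fst p))}}"
      using True unfolding cyl by simp
    also have "\<dots> = (\<Prod>p\<in>?J. emeasure (case p of (n, t) \<Rightarrow> measure_pmf (grow t)) {h (Suc (fst p))})"
      unfolding M_def by (rule P.emeasure_PiM_Collect) (auto split: prod.splits)
    also have "\<dots> = (\<Prod>i\<in>{1..n}. ennreal (pmf (grow (h i)) (h (Suc i))))"
      by (subst prod.reindex) (auto simp: inj_on_def emeasure_pmf_single)
    also have "\<dots> = ennreal (\<Prod>i\<in>{1..n}. pmf (grow (h i)) (h (Suc i)))"
      by (rule prod_ennreal) simp
    finally show ?thesis using True by (simp add: measure_def prod_nonneg)
  next
    case False
    then show ?thesis unfolding cyl by simp
  qed
  have "port_process M T"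
    unfolding port_process_def
  proof (intro conjI allI impI)
    show "prob_space M" unfolding M_def by (rule P.prob_space_axioms)
    show "AE x in M. T 1 x = PTree 1 []" by (rule AE_I2) (rule T1)
    show "T n \<in> measurable M (count_space UNIV)" if "1 \<le> n" for n using meas that .
    show "measure M {w \<in> space M. \<forall>i\<in>{1..Suc n}. T i w = h i} =
        measure M {w \<in> space M. \<forall>i\<in>{1..n}. T i w = h i} * pmf (grow (h n)) (h (Suc n))"
      if n: "1 \<le> n" for n h
    proof -
      obtain m where "n = Suc m" using n by (cases n) auto
      then show ?thesis unfolding law using law[of m h] by (simp add: atLeastAtMostSuc_conv)
    qed
  qed
  then show ?thesis by blast
qed

end

theory Submission
  imports Defs "HOL-Complex_Analysis.Complex_Analysis" "HOL-Real_Asymp.Real_Asymp"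
begin

text \<open>Let \<open>P(z)\<close> be the sum of \<open>z ^ level\<close> over the nodes of the tree with \<open>n\<close> nodes, and
  \<open>X(z) = (1 + z) P(z) - 1\<close> the same sum over the positions at which the next node can be inserted.
  Then \<open>X(z) / E X(z)\<close> is a martingale, and \<open>E X(z)\<close> is an explicit product of order
  \<open>n powr ((1 + z) / 2)\<close>. A one-step Burkholder inequality bounds all even moments of this martingale in
  a small disc around 1 and shows that \<open>P\<close> is negligible on the rest of the unit circle. Hence, with
  \<open>l = ln n / 2\<close>, \<open>P(z) = n exp (l (z - 1)) (1 + \<xi> (z - 1) + O(Q |z - 1|\<^sup>2))\<close> near 1, where the random
  variables \<open>\<xi>\<close> and \<open>Q\<close> have bounded moments, and Cauchy's formula shows that the number of nodes at
  level \<open>k\<close> is \<open>n (p k (1 + \<xi> (k - l) / l) + O(Q l powr (-3/2)))\<close> uniformly in \<open>k\<close>, where \<open>p\<close> is the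
  Poisson distribution with mean \<open>l\<close>. The factor with \<open>\<xi>\<close> shifts the mode by \<open>O(\<xi>)\<close> and changes the
  maximum by a relative error of order \<open>(1 + Q\<^sup>2) / l\<close>; this gives the mean and the moments of the width
  and the tail of the mode. Almost sure convergence follows by the Borel-Cantelli lemma along a sparse
  sequence of \<open>n\<close>, as the width is nondecreasing in \<open>n\<close>.\<close>

section \<open>Insertion of leaves\<close>

text \<open>The relative error O(1/L_n) of the mean is what forces the linear term xi (z - 1). If P
  were compared with n exp (l (z - 1)) alone, an error of order |z - 1| would leave a profile error
  of order n / l, which is l^(-1/2) relative to the peak n / sqrt (2 pi l); with the random linear
  term kept explicit the error drops to n l^(-3/2).

  Since s and B are arbitrary, moments of every order are needed, and the disc around 1 has to
  depend on the order: the increments in the 2p-th moment are governed by the mean of the polynomial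
  at the real point |z|^(2p), which must stay at most 2.

  Uniform model and growth rule are linked by one fact: the number 2n - 1 of insertion positions
  does not depend on the tree. Conditional expectations given the current tree are therefore finite
  averages over positions.\<close>

fun gf :: "ptree \<Rightarrow> 'a::comm_ring_1 \<Rightarrow> 'a" where
  "gf (PTree a ts) z = 1 + z * (\<Sum>t\<leftarrow>ts. gf t z)"

text \<open>A junk value if \<open>v\<close> is not a label of the tree.\<close>

fun level :: "ptree \<Rightarrow> nat \<Rightarrow> nat" where
  "level (PTree a ts) v =
     (if a = v then 0 else Suc (\<Sum>t\<leftarrow>ts. if v \<in> set (nodes t) then level t v else 0))"

text \<open>A left inverse of \<open>attach m\<close> on trees without the label \<open>m\<close>.
  It recovers the old tree but not the position, which \<open>attach_inject\<close> recovers
  separately.\<close>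

fun prune :: "nat \<Rightarrow> ptree \<Rightarrow> ptree" where
  "prune m (PTree a ts) = PTree a (map (prune m) (filter (\<lambda>t. root_label t \<noteq> m) ts))"

text \<open>The sample space of one step of \<open>grow\<close>.\<close>

definition slots :: "ptree \<Rightarrow> (nat \<times> nat) set" where
  "slots t = (SIGMA v:set (nodes t). {0..outdeg t v})"

lemma finite_slots [simp]: "finite (slots t)"
  by (simp add: slots_def)

lemma root_label_in_nodes: "root_label t \<in> set (nodes t)"
  by (cases t) auto

lemma slots_nonempty [simp]: "slots t \<noteq> {}"
proof -
  have "(root_label t, 0) \<in> slots t" using root_label_in_nodes[of t] by (simp add: slots_def)
  then show ?thesis by blast
qed

section \<open>Insertion, degree and level inside a single subtree\<close>

lemma attach_notin: "v \<notin> set (nodes t) \<Longrightarrow> attach m v i t = t"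
  by (induction t) (auto intro!: map_idI)

lemma outdeg_notin: "v \<notin> set (nodes t) \<Longrightarrow> outdeg t v = 0"
  by (induction t) auto

lemma prune_notin: "m \<notin> set (nodes t) \<Longrightarrow> prune m t = t"
proof (induction t)
  case (PTree a ts)
  have "filter (\<lambda>t. root_label t \<noteq> m) ts = ts"
    using PTree.prems root_label_in_nodes by (fastforce simp: filter_id_conv)
  then show ?case using PTree by (auto intro!: map_idI)
qed

lemma root_label_attach [simp]: "root_label (attach m v i t) = root_label t"
  by (cases t) auto

text \<open>With distinct labels exactly one child contains \<open>v\<close>. The list of children
  is split there, so that inductions over trees need to follow this child only.\<close>

context
  fixes a c v and xs ys :: "ptree list"
  assumes distinct_nodes: "distinct (nodes (PTree a (xs @ c # ys)))" and v: "v \<in> set (nodes c)"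
begin

lemma child_notin: "a \<noteq> v" "x \<in> set xs \<union> set ys \<Longrightarrow> v \<notin> set (nodes x)"
proof -
  show "a \<noteq> v" using distinct_nodes v by auto
  have "v \<notin> set (concat (map nodes xs)) \<union> set (concat (map nodes ys))"
    using distinct_nodes v by (simp del: set_concat) blast
  then show "x \<in> set xs \<union> set ys \<Longrightarrow> v \<notin> set (nodes x)" by auto
qed

lemma attach_child: "attach m v i (PTree a (xs @ c # ys)) = PTree a (xs @ attach m v i c # ys)"
  using child_notin by (auto intro!: map_idI attach_notin)

lemma outdeg_child: "outdeg (PTree a (xs @ c # ys)) v = outdeg c v"
proof -
  have "map (\<lambda>t. outdeg t v) xs = map (\<lambda>_. 0) xs" "map (\<lambda>t. outdeg t v) ys = map (\<lambda>_. 0) ys"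
    using child_notin(2) by (auto simp: outdeg_notin)
  then show ?thesis using child_notin(1) by (simp add: sum_list_triv)
qed

lemma level_child: "level (PTree a (xs @ c # ys)) v = Suc (level c v)"
proof -
  have "map (\<lambda>t. if v \<in> set (nodes t) then level t v else 0) xs = map (\<lambda>_. 0) xs"
    "map (\<lambda>t. if v \<in> set (nodes t) then level t v else 0) ys = map (\<lambda>_. 0) ys"
    using child_notin(2) by auto
  then show ?thesis using child_notin(1) v by (simp add: sum_list_triv)
qed

end

lemma distinct_nodes_child:
  "distinct (nodes (PTree a ts)) \<Longrightarrow> c \<in> set ts \<Longrightarrow> distinct (nodes c)"
  by (auto simp: distinct_concat_iff)

lemma child_cases:
  assumes "v \<in> set (nodes (PTree a ts))" "a \<noteq> v"
  obtains xs c ys where "ts = xs @ c # ys" "v \<in> set (nodes c)"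
  using assms by (auto dest: split_list)

lemma mset_nodes_attach:
  assumes "distinct (nodes t)" "v \<in> set (nodes t)"
  shows "mset (nodes (attach m v i t)) = add_mset m (mset (nodes t))"
  using assms
proof (induction t)
  case (PTree a ts)
  show ?case
  proof (cases "a = v")
    case True
    have "mset (concat (map nodes (take i ts))) + mset (concat (map nodes (drop i ts))) =
        mset (concat (map nodes ts))"
      by (metis append_take_drop_id concat_append map_append mset_append)
    then show ?thesis using True by (simp add: ac_simps)
  next
    case False
    then obtain xs c ys where ts: "ts = xs @ c # ys" "v \<in> set (nodes c)"
      using child_cases PTree.prems by metis
    have "mset (nodes (attach m v i c)) = add_mset m (mset (nodes c))"
      using PTree ts distinct_nodes_child by (intro PTree.IH) auto
    then show ?thesis using attach_child PTree.prems ts by auto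
  qed
qed

lemma gf_attach:
  assumes "distinct (nodes t)" "v \<in> set (nodes t)"
  shows "gf (attach m v i t) z = gf t z + z ^ Suc (level t v)"
  using assms
proof (induction t)
  case (PTree a ts)
  show ?case
  proof (cases "a = v")
    case True
    have "(\<Sum>t\<leftarrow>ts. gf t z) = (\<Sum>t\<leftarrow>take i ts. gf t z) + (\<Sum>t\<leftarrow>drop i ts. gf t z)"
      by (metis append_take_drop_id map_append sum_list_append)
    then show ?thesis using True by (simp add: algebra_simps)
  next
    case False
    then obtain xs c ys where ts: "ts = xs @ c # ys" "v \<in> set (nodes c)"
      using child_cases PTree.prems by metis
    have "gf (attach m v i c) z = gf c z + z ^ Suc (level c v)"
      using PTree ts distinct_nodes_child by (intro PTree.IH) auto
    then show ?thesis
      using attach_child[of a xs c ys v m i] level_child[of a xs c ys v] PTree.prems ts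
      by (simp add: algebra_simps del: attach.simps level.simps)
  qed
qed

text \<open>Each of the \<open>outdeg + 1\<close> positions at a node leads one level further down.
  One position per child accounts for all nodes except the root, that is \<open>gf t z - 1\<close>;
  the one extra position of every node gives \<open>z * gf t z\<close>.\<close>

lemma sum_list_slots:
  fixes z :: "'a::comm_ring_1"
  assumes "distinct (nodes t)"
  shows "(\<Sum>v\<leftarrow>nodes t. of_nat (Suc (outdeg t v)) * z ^ Suc (level t v)) = (1 + z) * gf t z - 1"
  using assms
proof (induction t)
  case (PTree a ts)
  let ?g = "\<lambda>t v. of_nat (Suc (outdeg t v)) * z ^ Suc (level t v)"
  have *: "?g (PTree a ts) v = z * ?g c v" if c: "c \<in> set ts" and v: "v \<in> set (nodes c)" for c v
  proof -
    obtain xs ys where "ts = xs @ c # ys" using split_list[OF c] by blast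
    then show ?thesis
      using outdeg_child[of a xs c ys v] level_child[of a xs c ys v] PTree.prems v
      by (simp add: algebra_simps del: outdeg.simps level.simps)
  qed
  have "sum_list (map f (concat (map nodes ts))) = (\<Sum>c\<leftarrow>ts. sum_list (map f (nodes c)))"
    for f :: "nat \<Rightarrow> 'a"
    by (induction ts) auto
  then have "(\<Sum>v\<leftarrow>concat (map nodes ts). ?g (PTree a ts) v) =
      (\<Sum>c\<leftarrow>ts. \<Sum>v\<leftarrow>nodes c. ?g (PTree a ts) v)" .
  also have "\<dots> = (\<Sum>c\<leftarrow>ts. \<Sum>v\<leftarrow>nodes c. z * ?g c v)"
    by (intro arg_cong[where f = sum_list] map_cong refl *)
  also have "\<dots> = (\<Sum>c\<leftarrow>ts. z * ((1 + z) * gf c z - 1))"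
    using PTree.IH distinct_nodes_child[OF PTree.prems]
    by (intro arg_cong[where f = sum_list] map_cong refl)
       (simp add: sum_list_const_mult del: power_Suc of_nat_Suc)
  also have "\<dots> = z * (1 + z) * (\<Sum>c\<leftarrow>ts. gf c z) - of_nat (length ts) * z"
    by (induction ts) (auto simp: algebra_simps)
  finally have "(\<Sum>v\<leftarrow>concat (map nodes ts). ?g (PTree a ts) v) =
      z * (1 + z) * (\<Sum>c\<leftarrow>ts. gf c z) - of_nat (length ts) * z" .
  moreover have "(\<Sum>v\<leftarrow>nodes (PTree a ts). ?g (PTree a ts) v) =
      ?g (PTree a ts) a + (\<Sum>v\<leftarrow>concat (map nodes ts). ?g (PTree a ts) v)"
    by (simp only: nodes.simps list.map sum_list.Cons)
  ultimately show ?case by (simp add: algebra_simps)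
qed

lemma sum_slots:
  fixes z :: "'a::comm_ring_1"
  assumes "distinct (nodes t)"
  shows "(\<Sum>(v, i)\<in>slots t. z ^ Suc (level t v)) = (1 + z) * gf t z - 1"
proof -
  have "(\<Sum>(v, i)\<in>slots t. z ^ Suc (level t v)) =
      (\<Sum>v\<in>set (nodes t). of_nat (Suc (outdeg t v)) * z ^ Suc (level t v))"
    unfolding slots_def by (subst sum.Sigma[symmetric]) auto
  also have "\<dots> = (1 + z) * gf t z - 1"
    using sum_list_slots[OF assms] assms by (simp add: sum_list_distinct_conv_sum_set)
  finally show ?thesis .
qed

lemma gf_1: "gf t 1 = of_nat (length (nodes t))"
proof (induction t)
  case (PTree a ts)
  have "(\<Sum>t\<leftarrow>ts. gf t (1::'a)) = (\<Sum>t\<leftarrow>ts. of_nat (length (nodes t)))"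
    by (intro arg_cong[where f = sum_list] map_cong refl PTree)
  also have "\<dots> = of_nat (length (concat (map nodes ts)))"
    by (induction ts) auto
  finally show ?case by simp
qed

section \<open>Every PORT arises by exactly one insertion\<close>

lemma port_nodes:
  assumes "port n t"
  shows "distinct (nodes t)" "set (nodes t) = {1..n}" "length (nodes t) = n" "n \<ge> 1"
proof -
  show *: "distinct (nodes t)" "set (nodes t) = {1..n}" using assms by (auto simp: port_def)
  then show "length (nodes t) = n" using distinct_card[of "nodes t"] by simp
  show "n \<ge> 1" using root_label_in_nodes[of t] * by auto
qed

text \<open>The preceding sum at \<open>z = 1\<close>. Since the count depends on \<open>n\<close>
  alone, growth keeps the law uniform.\<close>

lemma card_slots:
  assumes "port n t"
  shows "card (slots t) = 2 * n - 1"
proof -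
  have "int (card (slots t)) = (\<Sum>(v, i)\<in>slots t. 1 ^ Suc (level t v))"
    by (simp add: case_prod_beta)
  also have "\<dots> = 2 * int n - 1"
    using sum_slots[of t "1::int"] port_nodes[OF assms] by (simp add: gf_1)
  finally show ?thesis using port_nodes(4)[OF assms] by linarith
qed

lemma increasing_attach:
  assumes "increasing_labels t" "\<forall>u\<in>set (nodes t). u < m"
  shows "increasing_labels (attach m v i t)"
  using assms
proof (induction t)
  case (PTree a ts)
  then show ?case by (auto dest!: in_set_takeD in_set_dropD)
qed

lemma port_attach:
  assumes "port n t" "(v, i) \<in> slots t"
  shows "port (Suc n) (attach (Suc n) v i t)"
proof -
  note t = port_nodes[OF assms(1)]
  have m: "mset (nodes (attach (Suc n) v i t)) = mset (Suc n # nodes t)"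
    using mset_nodes_attach[OF t(1)] assms(2) by (simp add: slots_def)
  have "distinct (Suc n # nodes t)" using t by simp
  then have "distinct (nodes (attach (Suc n) v i t))" using m mset_eq_imp_distinct_iff by blast
  moreover have "set (nodes (attach (Suc n) v i t)) = insert (Suc n) {1..n}"
    using mset_eq_setD[OF m] t by simp
  moreover have "increasing_labels (attach (Suc n) v i t)"
  proof (rule increasing_attach)
    show "increasing_labels t" using assms(1) by (simp add: port_def)
    show "\<forall>u\<in>set (nodes t). u < Suc n" unfolding t(2) by auto
  qed
  ultimately show ?thesis unfolding port_def by (simp add: atLeastAtMostSuc_conv)
qed

lemma prune_attach:
  assumes "m \<notin> set (nodes t)"
  shows "prune m (attach m v i t) = t"
  using assms
proof (induction t)
  case (PTree a ts)
  have f: "filter (\<lambda>t. root_label t \<noteq> m) ts' = ts'" "map (prune m) ts' = ts'"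
    if "set ts' \<subseteq> set ts" for ts'
    using that PTree.prems root_label_in_nodes
    by (fastforce simp: filter_id_conv intro!: map_idI prune_notin)+
  have "filter (\<lambda>t. root_label t \<noteq> m) (map (attach m v i) ts) = map (attach m v i) ts"
    using PTree.prems root_label_in_nodes by (fastforce simp: filter_id_conv)
  moreover have "map (prune m) (map (attach m v i) ts) = ts"
    using PTree by (auto intro!: map_idI)
  ultimately show ?case
    using f[OF subset_refl] f[OF set_take_subset] f[OF set_drop_subset] by simp
qed

lemma insert_at_inject:
  assumes "xs @ x # ys = xs' @ x # ys'" "x \<notin> set xs" "x \<notin> set xs'"
  shows "xs = xs'"
  using assms
proof (induction xs arbitrary: xs')
  case Nil
  then show ?case by (cases xs') auto
next
  case (Cons b xs)
  then show ?case by (cases xs') auto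
qed

text \<open>The position can be read off from the result: only the path to \<open>v\<close> is
  affected, and in the list of children of \<open>v\<close> the leaf \<open>PTree m []\<close>
  occurs once because \<open>m\<close> is a fresh label.\<close>

lemma attach_inject:
  assumes "distinct (nodes t)" "m \<notin> set (nodes t)" "(v, i) \<in> slots t" "(v', i') \<in> slots t"
    "attach m v i t = attach m v' i' t"
  shows "v = v' \<and> i = i'"
  using assms
proof (induction t)
  case (PTree a ts)
  have v: "v \<in> set (nodes (PTree a ts))" "i \<le> outdeg (PTree a ts) v"
    and v': "v' \<in> set (nodes (PTree a ts))" "i' \<le> outdeg (PTree a ts) v'"
    using PTree.prems by (auto simp: slots_def)
  have eq: "attach m v i (PTree a ts) = attach m v' i' (PTree a ts)" by fact
  show ?case
  proof (cases "a = v \<or> a = v'")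
    case True
    \<comment> \<open>Insertion at the root lengthens the list of children, insertion further down
      does not; so either both nodes are the root or neither is.\<close>
    have len: "length (take j ts @ PTree m [] # drop j ts) \<noteq> length (map f ts)" for j f
      by (simp add: min_def)
    have "v = v'"
      using True eq len[of i] len[of i'] by (auto split: if_splits dest: arg_cong[where f = length] simp del: length_append length_take)
    then have "v = a" "v' = a" using True by auto
    have leaf: "PTree m [] \<notin> set ts"
    proof
      assume "PTree m [] \<in> set ts"
      then have "m \<in> set (nodes (PTree a ts))" by (auto intro!: bexI[of _ "PTree m []"])
      then show False using PTree.prems(2) by blast
    qed
    have "take i ts @ PTree m [] # drop i ts = take i' ts @ PTree m [] # drop i' ts"
      using eq \<open>v = a\<close> \<open>v' = a\<close> by simp
    then have "take i ts = take i' ts"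
      by (rule insert_at_inject) (use leaf in_set_takeD in metis)+
    then have "length (take i ts) = length (take i' ts)" by simp
    then show ?thesis using v v' \<open>v = a\<close> \<open>v' = a\<close> by auto
  next
    case False
    then obtain xs c ys where ts: "ts = xs @ c # ys" "v \<in> set (nodes c)"
      using child_cases v by metis
    have d: "distinct (nodes c)" and m: "m \<notin> set (nodes c)"
      using PTree.prems distinct_nodes_child ts by auto
    have "map (attach m v i) ts = map (attach m v' i') ts" using eq False by auto
    then have eqc: "attach m v i c = attach m v' i' c" using ts by auto
    \<comment> \<open>The fresh label appears in the child that was changed, so both insertions took
      place in the same child.\<close>
    have "m \<in> set (nodes (attach m v i c))"
      using mset_nodes_attach[OF d ts(2), of m i] by (metis set_mset_mset union_single_eq_member)
    then have v'c: "v' \<in> set (nodes c)" using attach_notin[of v' c m i'] m eqc by metis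
    have "(v, i) \<in> slots c" "(v', i') \<in> slots c"
      using v v' ts v'c outdeg_child[of a xs c ys] PTree.prems(1) by (auto simp: slots_def)
    then show ?thesis using PTree.IH[of c] d m eqc ts by auto
  qed
qed

lemma nodes_ge_root:
  "increasing_labels t \<Longrightarrow> u \<in> set (nodes t) \<Longrightarrow> root_label t \<le> u"
  by (induction t) force+

text \<open>Labels increase downwards, so the node with the largest label has no children and can be
  removed. The clause on \<open>root_label\<close> carries the order condition at the parent through
  the induction.\<close>

lemma detach_max:
  assumes "distinct (nodes t)" "increasing_labels t" "m \<in> set (nodes t)" "root_label t \<noteq> m"
    "\<forall>u\<in>set (nodes t). u \<le> m"
  shows "\<exists>s v i. (v, i) \<in> slots s \<and> t = attach m v i s \<and> distinct (nodes s) \<and>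
    set (nodes s) = set (nodes t) - {m} \<and> increasing_labels s \<and> root_label s = root_label t"
  using assms
proof (induction t)
  case (PTree a ts)
  have d: "distinct (nodes (PTree a ts))" by fact
  obtain xs c ys where ts: "ts = xs @ c # ys" "m \<in> set (nodes c)"
    using child_cases PTree.prems by (metis ptree.sel(1))
  have inc: "increasing_labels c" "a < root_label c"
    using PTree.prems(2) ts by auto
  show ?case
  proof (cases "root_label c = m")
    case True
    obtain cs where c: "c = PTree m cs" using True by (cases c) auto
    have "cs = []"
    proof (cases cs)
      case (Cons b bs)
      then have "root_label b > m" "root_label b \<in> set (nodes (PTree a ts))"
        using inc c ts root_label_in_nodes[of b] by auto
      then show ?thesis using PTree.prems(5) by force
    qed simp
    then have c: "c = PTree m []" using c by simp
    let ?s = "PTree a (xs @ ys)"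
    have "(a, length xs) \<in> slots ?s" by (simp add: slots_def)
    moreover have "PTree a ts = attach m a (length xs) ?s" using ts c by simp
    moreover have "distinct (nodes ?s)" "set (nodes ?s) = set (nodes (PTree a ts)) - {m}"
      using d ts c by auto
    moreover have "increasing_labels ?s" using PTree.prems(2) ts by auto
    ultimately show ?thesis
      by (intro exI[of _ ?s] exI[of _ a] exI[of _ "length xs"] conjI) (assumption | simp)+
  next
    case False
    have "\<exists>s v i. (v, i) \<in> slots s \<and> c = attach m v i s \<and> distinct (nodes s) \<and>
      set (nodes s) = set (nodes c) - {m} \<and> increasing_labels s \<and> root_label s = root_label c"
      using PTree.prems ts inc False distinct_nodes_child[OF d] by (intro PTree.IH) auto
    then obtain s v i where s: "(v, i) \<in> slots s" "c = attach m v i s" "distinct (nodes s)"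
      "set (nodes s) = set (nodes c) - {m}" "increasing_labels s" "root_label s = root_label c"
      by blast
    let ?s = "PTree a (xs @ s # ys)"
    have v: "v \<in> set (nodes s)" using s by (auto simp: slots_def)
    have ds: "distinct (nodes ?s)" using d ts s(3,4) by auto
    have "(v, i) \<in> slots ?s"
      using outdeg_child[OF ds v] v s(1) by (auto simp: slots_def)
    moreover have "PTree a ts = attach m v i ?s"
      using attach_child[OF ds v] ts s(2) by simp
    moreover have "set (nodes ?s) = set (nodes (PTree a ts)) - {m}"
    proof -
      have "a \<noteq> m" "\<forall>x\<in>set xs \<union> set ys. m \<notin> set (nodes x)"
        using child_notin[of a xs c ys m] d ts by simp_all
      then show ?thesis unfolding ts(1) by (auto simp: s(4))
    qed
    moreover have "increasing_labels ?s" using PTree.prems(2) s(5,6) inc by (simp add: ts(1))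
    ultimately show ?thesis using ds
      by (intro exI[of _ ?s] exI[of _ v] exI[of _ i] conjI) (assumption | simp)+
  qed
qed

text \<open>Deleting the largest label gives the only possible predecessor, and the place of the
  deleted leaf is unique. With \<open>card_slots\<close>, each tree of \<open>n\<close> nodes thus
  has equally many successors, and no successor is reached twice.\<close>

lemma bij_betw_attach:
  assumes "n \<ge> 1"
  shows "bij_betw (\<lambda>(t, v, i). attach (Suc n) v i t) (SIGMA t:{t. port n t}. slots t) {t. port (Suc n) t}"
proof (rule bij_betw_imageI)
  show "inj_on (\<lambda>(t, v, i). attach (Suc n) v i t) (SIGMA t:{t. port n t}. slots t)"
  proof (rule inj_onI)
    fix x x'
    assume x: "x \<in> (SIGMA t:{t. port n t}. slots t)" "x' \<in> (SIGMA t:{t. port n t}. slots t)"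
      "(case x of (t, v, i) \<Rightarrow> attach (Suc n) v i t) = (case x' of (t, v, i) \<Rightarrow> attach (Suc n) v i t)"
    obtain t v i t' v' i' where xs: "x = (t, v, i)" "x' = (t', v', i')" by (metis prod_cases3)
    then have *: "port n t" "(v, i) \<in> slots t" "port n t'" "(v', i') \<in> slots t'"
      "attach (Suc n) v i t = attach (Suc n) v' i' t'"
      using x by simp_all
    have n: "Suc n \<notin> set (nodes t)" "Suc n \<notin> set (nodes t')"
      using * port_nodes by auto
    then have "t = t'" using prune_attach[of "Suc n" t v i] prune_attach[of "Suc n" t' v' i'] *(5) by simp
    then show "x = x'"
      using attach_inject[of t "Suc n" v i v' i'] * n port_nodes(1) xs by simp
  qed
next
  have "u \<in> (\<lambda>(t, v, i). attach (Suc n) v i t) ` (SIGMA t:{t. port n t}. slots t)"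
    if u: "port (Suc n) u" for u
  proof -
  note un = port_nodes[OF u]
  have inc: "increasing_labels u" using u by (simp add: port_def)
  have "1 \<in> set (nodes u)" using un by auto
  then have "root_label u \<noteq> Suc n" using nodes_ge_root[OF inc, of 1] assms by auto
  then have "\<exists>s v i. (v, i) \<in> slots s \<and> u = attach (Suc n) v i s \<and> distinct (nodes s) \<and>
      set (nodes s) = set (nodes u) - {Suc n} \<and> increasing_labels s \<and> root_label s = root_label u"
    by (intro detach_max[OF un(1) inc]) (simp_all add: un(2))
  then obtain s v i where s: "(v, i) \<in> slots s \<and> u = attach (Suc n) v i s \<and> distinct (nodes s) \<and>
      set (nodes s) = set (nodes u) - {Suc n} \<and> increasing_labels s \<and> root_label s = root_label u"
    by (elim exE)
  have "{1..Suc n} - {Suc n} = {1..n}" by auto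
  then have "port n s" using s un(2) by (simp add: port_def)
  then have "(s, v, i) \<in> (SIGMA t:{t. port n t}. slots t)" using s by simp
  then show "u \<in> (\<lambda>(t, v, i). attach (Suc n) v i t) ` (SIGMA t:{t. port n t}. slots t)"
    by (rule image_eqI[rotated]) (use s in simp)
  qed
  then show "(\<lambda>(t, v, i). attach (Suc n) v i t) ` (SIGMA t:{t. port n t}. slots t) = {t. port (Suc n) t}"
    using port_attach by (intro equalityI subsetI) (auto simp del: attach.simps)
qed

section \<open>The law of the growth process\<close>

lemma set_pmf_random_port: "n \<ge> 1 \<Longrightarrow> set_pmf (random_port n) = {t. port n t}"
  unfolding random_port_def using finite_port port_exists by (intro set_pmf_of_set) auto

lemma finite_set_pmf_random_port [simp]: "n \<ge> 1 \<Longrightarrow> finite (set_pmf (random_port n))"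
  using finite_port by (simp add: set_pmf_random_port)

lemma integrable_random_port [simp]:
  fixes f :: "ptree \<Rightarrow> real"
  shows "n \<ge> 1 \<Longrightarrow> integrable (measure_pmf (random_port n)) f"
  by (rule integrable_measure_pmf_finite) simp

lemma expectation_random_port_mono:
  fixes f g :: "ptree \<Rightarrow> real"
  assumes "n \<ge> 1" "\<And>t. port n t \<Longrightarrow> f t \<le> g t"
  shows "measure_pmf.expectation (random_port n) f \<le> measure_pmf.expectation (random_port n) g"
  using assms by (intro integral_mono_AE) (auto simp: AE_measure_pmf_iff set_pmf_random_port)

lemma expectation_random_port_cong:
  fixes f g :: "ptree \<Rightarrow> real"
  assumes "n \<ge> 1" "\<And>t. port n t \<Longrightarrow> f t = g t"
  shows "measure_pmf.expectation (random_port n) f = measure_pmf.expectation (random_port n) g"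
  using assms by (intro integral_cong_AE) (auto simp: AE_measure_pmf_iff set_pmf_random_port)

lemma port_1_iff: "port 1 t \<longleftrightarrow> t = PTree 1 []"
proof
  assume t: "port 1 t"
  obtain a ts where t': "t = PTree a ts" by (cases t)
  have "length (nodes t) = 1" using port_nodes[OF t] by simp
  then have "concat (map nodes ts) = []" by (simp add: t')
  moreover have "nodes s \<noteq> []" for s by (cases s) auto
  ultimately have "ts = []" by (cases ts) auto
  moreover have "a = 1" using port_nodes(2)[OF t] by (simp add: t' \<open>ts = []\<close>)
  ultimately show "t = PTree 1 []" using t' by simp
qed (simp add: port_def)

lemma random_port_1: "random_port 1 = return_pmf (PTree 1 [])"
  unfolding random_port_def port_1_iff by (simp add: pmf_of_set_singleton)

text \<open>The form in which conditioning on the current tree enters all moment estimates: an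
  average over positions inside an average over trees.\<close>

lemma expectation_random_port_Suc:
  fixes f :: "ptree \<Rightarrow> real"
  assumes n: "n \<ge> 1"
  shows "measure_pmf.expectation (random_port (Suc n)) f =
    measure_pmf.expectation (random_port n)
      (\<lambda>t. (\<Sum>(v, i)\<in>slots t. f (attach (Suc n) v i t)) / (2 * real n - 1))"
proof -
  let ?P = "\<lambda>n. {t. port n t}"
  have card: "real (card (slots t)) = 2 * real n - 1" if "t \<in> ?P n" for t
    using card_slots[of n t] that n by (simp add: of_nat_diff)
  have ne: "?P n \<noteq> {}" "?P (Suc n) \<noteq> {}" using port_exists n by auto
  have "card (?P (Suc n)) = card (SIGMA t:?P n. slots t)"
    using bij_betw_same_card[OF bij_betw_attach[OF n]] by simp
  also have "\<dots> = (\<Sum>t\<in>?P n. card (slots t))"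
    by (rule card_SigmaI) (auto simp: finite_port)
  finally have "real (card (?P (Suc n))) = (\<Sum>t\<in>?P n. real (card (slots t)))" by simp
  then have c: "real (card (?P (Suc n))) = real (card (?P n)) * (2 * real n - 1)"
    using card by simp
  have "(\<Sum>u\<in>?P (Suc n). f u) = (\<Sum>(t, v, i)\<in>(SIGMA t:?P n. slots t). f (attach (Suc n) v i t))"
    using sum.reindex_bij_betw[OF bij_betw_attach[OF n], of f] by (simp add: case_prod_beta)
  also have "\<dots> = (\<Sum>t\<in>?P n. \<Sum>(v, i)\<in>slots t. f (attach (Suc n) v i t))"
    by (subst sum.Sigma) (auto simp: finite_port case_prod_beta)
  finally have s: "(\<Sum>u\<in>?P (Suc n). f u) = (\<Sum>t\<in>?P n. \<Sum>(v, i)\<in>slots t. f (attach (Suc n) v i t))" .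
  show ?thesis
    unfolding random_port_def integral_pmf_of_set[OF ne(1) finite_port] integral_pmf_of_set[OF ne(2) finite_port] c s
    by (simp add: sum_divide_distrib[symmetric])
qed

text \<open>Links the uniform model to the growth rule; through it the bounds for uniform PORTs
  apply to the process.\<close>

lemma random_port_Suc:
  assumes n: "n \<ge> 1"
  shows "random_port (Suc n) = bind_pmf (random_port n) grow"
proof (rule pmf_eqI)
  fix u
  have g: "pmf (grow t) u = (\<Sum>(v, i)\<in>slots t. indicat_real {u} (attach (Suc n) v i t)) / (2 * real n - 1)"
    if "port n t" for t
  proof -
    have "pmf (grow t) u = measure_pmf.expectation (grow t) (indicat_real {u})"
      by (simp add: pmf.rep_eq)
    also have "\<dots> = (\<Sum>(v, i)\<in>slots t. indicat_real {u} (attach (Suc n) v i t)) / real (card (slots t))"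
      unfolding grow_def slots_def[symmetric] integral_map_pmf
      using port_nodes(3)[OF that] by (subst integral_pmf_of_set) (simp_all add: case_prod_beta)
    finally show ?thesis using card_slots[OF that] n by (simp add: of_nat_diff)
  qed
  have "pmf (random_port (Suc n)) u = measure_pmf.expectation (random_port (Suc n)) (indicat_real {u})"
    by (simp add: pmf.rep_eq)
  also have "\<dots> = measure_pmf.expectation (random_port n) (\<lambda>t. pmf (grow t) u)"
    unfolding expectation_random_port_Suc[OF n] by (rule expectation_random_port_cong[OF n]) (simp add: g)
  also have "\<dots> = pmf (bind_pmf (random_port n) grow) u" by (rule pmf_bind[symmetric])
  finally show "pmf (random_port (Suc n)) u = pmf (bind_pmf (random_port n) grow) u" .
qed

section \<open>Profile and width under insertion\<close>

lemma profile_le_nodes: "profile t k \<le> length (nodes t)"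
proof (induction t arbitrary: k)
  case (PTree a ts)
  show ?case
  proof (cases k)
    case (Suc j)
    have "(\<Sum>t\<leftarrow>ts. profile t j) \<le> (\<Sum>t\<leftarrow>ts. length (nodes t))"
      by (rule sum_list_mono) (rule PTree)
    also have "\<dots> = length (concat (map nodes ts))" by (simp add: length_concat comp_def)
    finally show ?thesis using Suc by simp
  qed simp
qed

lemma finite_range_profile: "finite (range (profile t))"
  by (rule finite_subset[of _ "{..length (nodes t)}"]) (auto simp: profile_le_nodes)

lemma profile_le_width: "profile t k \<le> width t"
  unfolding width_def by (rule Max_ge) (auto simp: finite_range_profile)

lemma width_attained: "\<exists>k. profile t k = width t"
proof -
  have "width t \<in> range (profile t)"
    unfolding width_def by (rule Max_in) (auto simp: finite_range_profile)
  then show ?thesis by auto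
qed

lemma width_pos: "width t \<ge> 1"
  using profile_le_width[of t 0] by (cases t) simp

lemma profile_le_attach: "profile t k \<le> profile (attach m v i t) k"
proof (induction t arbitrary: k)
  case (PTree a ts)
  show ?case
  proof (cases k)
    case (Suc j)
    show ?thesis
    proof (cases "a = v")
      case True
      have "(\<Sum>t\<leftarrow>ts. profile t j) = (\<Sum>t\<leftarrow>take i ts. profile t j) + (\<Sum>t\<leftarrow>drop i ts. profile t j)"
        by (metis append_take_drop_id map_append sum_list_append)
      then show ?thesis using Suc True by simp
    next
      case False
      have "(\<Sum>t\<leftarrow>ts. profile t j) \<le> (\<Sum>t\<leftarrow>ts. profile (attach m v i t) j)"
        by (rule sum_list_mono) (rule PTree)
      then show ?thesis using Suc False by (simp add: comp_def)
    qed
  qed simp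
qed

lemma width_attach: "width t \<le> width (attach m v i t)"
  using width_attained[of t] profile_le_attach profile_le_width le_trans by metis

lemma width_grow: "u \<in> set_pmf (grow t) \<Longrightarrow> width t \<le> width u"
  unfolding grow_def using width_attach by auto

section \<open>Marginal laws of an abstract growth process\<close>

context
  fixes M :: "'a measure" and T :: "nat \<Rightarrow> 'a \<Rightarrow> ptree"
  assumes process: "port_process M T"
begin

interpretation prob_space M using process by (simp add: port_process_def)

lemma process_measurable: "n \<ge> 1 \<Longrightarrow> T n \<in> measurable M (count_space UNIV)"
  using process by (simp add: port_process_def)

text \<open>The definition of the process prescribes probabilities of whole histories. The joint law
  of two consecutive trees follows by summing over the histories that end in \<open>t\<close>, of
  which there are countably many because there are countably many trees.\<close>

lemma process_step:
  assumes n: "n \<ge> 1"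
  shows "emeasure M {x \<in> space M. T n x = t \<and> T (Suc n) x = u} =
    emeasure M {x \<in> space M. T n x = t} * ennreal (pmf (grow t) u)"
proof -
  \<comment> \<open>Extensional functions on \<open>{1..n}\<close>, so that different members
    describe disjoint events.\<close>
  define H where "H = {h \<in> {1..n} \<rightarrow>\<^sub>E (UNIV :: ptree set). h n = t}"
  have H: "countable H"
    unfolding H_def by (rule countable_subset[of _ "{1..n} \<rightarrow>\<^sub>E UNIV"]) (auto intro!: countable_PiE)
  have [measurable]: "T i \<in> measurable M (count_space UNIV)" if "i \<in> {1..Suc n}" for i
    using process_measurable that by simp
  let ?A = "\<lambda>h. {x \<in> space M. \<forall>i\<in>{1..n}. T i x = h i}"
  let ?B = "\<lambda>h. {x \<in> space M. \<forall>i\<in>{1..Suc n}. T i x = (h(Suc n := u)) i}"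
  have sets: "?A h \<in> sets M" "?B h \<in> sets M" for h
    by (intro sets.sets_Collect_finite_All; measurable)+
  have ext: "h = h'" if "h \<in> H" "h' \<in> H" "x \<in> ?A h" "x \<in> ?A h'" for h h' x
    using that unfolding H_def by (intro PiE_ext[of h "{1..n}" _ h']) auto
  have BA: "?B h \<subseteq> ?A h" for h by auto
  have disj: "disjoint_family_on ?A H" "disjoint_family_on ?B H"
    unfolding disjoint_family_on_def using ext BA by blast+
  have UA: "{x \<in> space M. T n x = t} = (\<Union>h\<in>H. ?A h)"
  proof (intro equalityI subsetI)
    fix x assume x: "x \<in> {x \<in> space M. T n x = t}"
    have "(\<lambda>i\<in>{1..n}. T i x) \<in> H" using x n unfolding H_def by auto
    moreover have "x \<in> ?A (\<lambda>i\<in>{1..n}. T i x)" using x by simp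
    ultimately show "x \<in> (\<Union>h\<in>H. ?A h)" by blast
  next
    fix x assume "x \<in> (\<Union>h\<in>H. ?A h)"
    then show "x \<in> {x \<in> space M. T n x = t}" using n unfolding H_def by auto
  qed
  have "?B h = ?A h \<inter> {x \<in> space M. T (Suc n) x = u}" for h
  proof -
    have "(\<forall>i\<in>{1..Suc n}. T i x = (h(Suc n := u)) i) \<longleftrightarrow> (\<forall>i\<in>{1..n}. T i x = h i) \<and> T (Suc n) x = u" for x
    proof -
      have "{1..Suc n} = insert (Suc n) {1..n}" by auto
      then show ?thesis by auto
    qed
    then show ?thesis by blast
  qed
  then have "(\<Union>h\<in>H. ?B h) = (\<Union>h\<in>H. ?A h) \<inter> {x \<in> space M. T (Suc n) x = u}"
    by (simp only: UN_extend_simps(4))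
  then have UB: "{x \<in> space M. T n x = t \<and> T (Suc n) x = u} = (\<Union>h\<in>H. ?B h)"
    unfolding UA[symmetric] by auto
  have eq: "emeasure M (?B h) = emeasure M (?A h) * ennreal (pmf (grow t) u)" if "h \<in> H" for h
  proof -
    have "measure M (?B h) =
        measure M {x \<in> space M. \<forall>i\<in>{1..n}. T i x = (h(Suc n := u)) i} *
        pmf (grow ((h(Suc n := u)) n)) ((h(Suc n := u)) (Suc n))"
      using process n unfolding port_process_def by blast
    also have "{x \<in> space M. \<forall>i\<in>{1..n}. T i x = (h(Suc n := u)) i} = ?A h" by auto
    finally have "measure M (?B h) = measure M (?A h) * pmf (grow t) u"
      using that by (simp add: H_def)
    then show ?thesis by (simp add: emeasure_eq_measure ennreal_mult)
  qed
  have "emeasure M {x \<in> space M. T n x = t \<and> T (Suc n) x = u} = (\<integral>\<^sup>+h. emeasure M (?B h) \<partial>count_space H)"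
    unfolding UB by (rule emeasure_UN_countable) (use sets H disj in auto)
  also have "\<dots> = (\<integral>\<^sup>+h. emeasure M (?A h) * ennreal (pmf (grow t) u) \<partial>count_space H)"
    by (rule nn_integral_cong) (use eq in simp)
  also have "\<dots> = (\<integral>\<^sup>+h. emeasure M (?A h) \<partial>count_space H) * ennreal (pmf (grow t) u)"
    by (rule nn_integral_multc) simp
  also have "(\<integral>\<^sup>+h. emeasure M (?A h) \<partial>count_space H) = emeasure M {x \<in> space M. T n x = t}"
    unfolding UA by (rule emeasure_UN_countable[symmetric]) (use sets H disj in auto)
  finally show ?thesis .
qed

lemma process_law:
  assumes "n \<ge> 1"
  shows "emeasure M {x \<in> space M. T n x = t} = ennreal (pmf (random_port n) t)"
  using assms
proof (induction n arbitrary: t rule: dec_induct)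
  case base
  have "AE x in M. T 1 x = PTree 1 []" using process by (simp add: port_process_def)
  then have "emeasure M {x \<in> space M. T 1 x = t} = emeasure M {x \<in> space M. PTree 1 [] = t}"
    using process_measurable[of 1] by (intro emeasure_eq_AE) auto
  also have "\<dots> = ennreal (pmf (random_port 1) t)"
    unfolding random_port_1 using emeasure_space_1
    by (cases "t = PTree 1 []") (auto simp: pmf_return indicator_def)
  finally show ?case by simp
next
  case (step n)
  have [measurable]: "T n \<in> measurable M (count_space UNIV)" "T (Suc n) \<in> measurable M (count_space UNIV)"
    using process_measurable step by simp_all
  have "{x \<in> space M. T (Suc n) x = t} = (\<Union>s. {x \<in> space M. T n x = s \<and> T (Suc n) x = t})"
    by auto
  then have "emeasure M {x \<in> space M. T (Suc n) x = t} =
      (\<integral>\<^sup>+s. emeasure M {x \<in> space M. T n x = s \<and> T (Suc n) x = t} \<partial>count_space UNIV)"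
    by (simp only:) (rule emeasure_UN_countable, auto simp: disjoint_family_on_def)
  also have "\<dots> = (\<integral>\<^sup>+s. ennreal (pmf (random_port n) s) * ennreal (pmf (grow s) t) \<partial>count_space UNIV)"
    using process_step step by simp
  also have "\<dots> = ennreal (pmf (random_port (Suc n)) t)"
    unfolding random_port_Suc[OF step.hyps(1)] by (simp add: ennreal_pmf_bind nn_integral_measure_pmf)
  finally show ?case .
qed

lemma distr_process:
  assumes n: "n \<ge> 1"
  shows "distr M (count_space UNIV) (T n) = measure_pmf (random_port n)"
proof (rule measure_eqI_countable[of _ UNIV])
  fix t
  have "emeasure (distr M (count_space UNIV) (T n)) {t} = emeasure M {x \<in> space M. T n x = t}"
    using process_measurable[OF n] by (simp add: emeasure_distr vimage_def Int_def conj_commute)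
  then show "emeasure (distr M (count_space UNIV) (T n)) {t} = emeasure (measure_pmf (random_port n)) {t}"
    using process_law[OF n] by (simp add: emeasure_pmf_single)
qed auto

lemma prob_process:
  assumes n: "n \<ge> 1"
  shows "prob {x \<in> space M. P (T n x)} = measure_pmf.prob (random_port n) {t. P t}"
proof -
  have "measure (distr M (count_space UNIV) (T n)) {t. P t} = prob {x \<in> space M. P (T n x)}"
    using process_measurable[OF n] by (subst measure_distr) (auto simp: vimage_def Int_def conj_commute)
  then show ?thesis using distr_process[OF n] by simp
qed

text \<open>A successor that \<open>grow\<close> cannot produce occurs with probability zero, and
  there are countably many pairs of trees; hence all exceptional events together form a null
  set.\<close>

lemma AE_width_mono:
  "AE x in M. \<forall>n\<ge>1. width (T n x) \<le> width (T (Suc n) x)"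
proof -
  have "AE x in M. n \<ge> 1 \<longrightarrow> width (T n x) \<le> width (T (Suc n) x)" for n
  proof (cases "n \<ge> 1")
    case True
    have [measurable]: "T n \<in> measurable M (count_space UNIV)" "T (Suc n) \<in> measurable M (count_space UNIV)"
      using process_measurable True by simp_all
    have "AE x in M. T n x = t \<and> T (Suc n) x = u \<longrightarrow> width t \<le> width u" for t u
    proof (cases "u \<in> set_pmf (grow t)")
      case True
      then show ?thesis using width_grow by auto
    next
      case False
      then have "emeasure M {x \<in> space M. T n x = t \<and> T (Suc n) x = u} = 0"
        using process_step[OF \<open>n \<ge> 1\<close>] by (simp add: pmf_eq_0_set_pmf)
      then have "AE x in M. \<not> (T n x = t \<and> T (Suc n) x = u)"
        by (subst AE_iff_measurable[of "{x \<in> space M. T n x = t \<and> T (Suc n) x = u}"]) auto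
      then show ?thesis by eventually_elim auto
    qed
    then have "AE x in M. \<forall>t u. T n x = t \<and> T (Suc n) x = u \<longrightarrow> width t \<le> width u"
      unfolding AE_all_countable by blast
    then show ?thesis by eventually_elim auto
  qed simp
  then show ?thesis by (simp add: AE_all_countable)
qed

end

section \<open>A moment inequality for one growth step\<close>

abbreviation expect :: "nat \<Rightarrow> (ptree \<Rightarrow> real) \<Rightarrow> real" where
  "expect n \<equiv> measure_pmf.expectation (random_port n)"

text \<open>A convex power lies above its tangent at \<open>c\<close>. Averaging this gives Jensen's
  inequality for integer exponents, for finite sums as well as for integrals.\<close>

lemma power_above_tangent:
  fixes x c :: real
  assumes "x \<ge> 0" "c \<ge> 0"
  shows "c ^ Suc k + real (Suc k) * c ^ k * (x - c) \<le> x ^ Suc k"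
proof (induction k)
  case (Suc k)
  have "c ^ Suc (Suc k) + real (Suc (Suc k)) * c ^ Suc k * (x - c) =
      x * (c ^ Suc k + real (Suc k) * c ^ k * (x - c)) - real (Suc k) * c ^ k * (x - c)\<^sup>2"
    by (simp add: algebra_simps power2_eq_square)
  also have "\<dots> \<le> x * x ^ Suc k"
  proof -
    have "0 \<le> real (Suc k) * c ^ k * (x - c)\<^sup>2" using assms by simp
    with mult_left_mono[OF Suc assms(1)] show ?thesis by linarith
  qed
  finally show ?case by simp
qed simp

lemma sum_power_mean_le:
  fixes x :: "'b \<Rightarrow> real"
  assumes "finite S" "S \<noteq> {}" "\<And>s. s \<in> S \<Longrightarrow> x s \<ge> 0"
  shows "((\<Sum>s\<in>S. x s) / card S) ^ Suc k \<le> (\<Sum>s\<in>S. x s ^ Suc k) / card S"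
proof -
  define c where "c = (\<Sum>s\<in>S. x s) / card S"
  have card: "real (card S) > 0" using assms by (simp add: card_gt_0_iff)
  have c: "c \<ge> 0" unfolding c_def using assms by (simp add: sum_nonneg)
  have "(\<Sum>s\<in>S. c ^ Suc k + real (Suc k) * c ^ k * (x s - c)) \<le> (\<Sum>s\<in>S. x s ^ Suc k)"
    using power_above_tangent assms c by (intro sum_mono) blast
  also have "(\<Sum>s\<in>S. c ^ Suc k + real (Suc k) * c ^ k * (x s - c)) =
      card S * c ^ Suc k + real (Suc k) * c ^ k * ((\<Sum>s\<in>S. x s) - card S * c)"
    by (simp only: sum.distrib sum_distrib_left[symmetric] sum_subtractf sum_constant)
  also have "(\<Sum>s\<in>S. x s) - card S * c = 0" using card by (simp add: c_def)
  finally show ?thesis using card unfolding c_def[symmetric] by (simp add: field_simps)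
qed

lemma power_cross_le:
  fixes x y :: real
  assumes "x \<ge> 0" "y \<ge> 0"
  shows "x ^ q * y \<le> x ^ Suc q + y ^ Suc q"
proof (cases "x \<le> y")
  case True
  then have "x ^ q * y \<le> y ^ q * y" using assms by (intro mult_right_mono power_mono) auto
  also have "\<dots> \<le> x ^ Suc q + y ^ Suc q" using assms by simp
  finally show ?thesis .
next
  case False
  then have "x ^ q * y \<le> x ^ q * x" using assms by (intro mult_left_mono) auto
  also have "\<dots> \<le> x ^ Suc q + y ^ Suc q" using assms by simp
  finally show ?thesis .
qed

text \<open>The recursion comes from the induction in \<open>power_expansion_le\<close>: one more
  factor \<open>A + 2 * R + D\<close> costs 1 for the leading term, \<open>6 * Suc q\<close> for the
  linear term and \<open>6 * step_const q\<close> for the error.\<close>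

fun step_const :: "nat \<Rightarrow> real" where
  "step_const 0 = 1"
| "step_const (Suc q) = 1 + 6 * real (Suc q) + 6 * step_const q"

lemma step_const_nonneg: "step_const q \<ge> 0"
  by (induction q) auto

text \<open>Meant for A = |Z|^2, D = |d|^2 and R = Re (cnj Z * d): the base is |Z + d|^2, and the
  assumption on \<open>R\<close> is the Cauchy-Schwarz inequality. The term linear in
  \<open>R\<close> is kept exactly because it averages to zero for a martingale difference; all the
  rest goes into two error terms.\<close>

lemma power_expansion_le:
  fixes A D R :: real
  assumes A: "A \<ge> 0" and D: "D \<ge> 0" and R: "R\<^sup>2 \<le> A * D"
  shows "(A + 2 * R + D) ^ Suc q \<le>
    A ^ Suc q + 2 * real (Suc q) * A ^ q * R + step_const q * (A ^ q * D + D ^ Suc q)"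
proof (induction q)
  case 0
  show ?case using D by simp
next
  case (Suc q)
  define K where "K = step_const q"
  have K: "K \<ge> 0" unfolding K_def by (rule step_const_nonneg)
  define p where "p = real (Suc q)"
  have p: "p \<ge> 0" by (simp add: p_def)
  define B where "B = A ^ q"
  define G where "G = D ^ q"
  define U where "U = A * B * D"
  define V where "V = D * D * G"
  have B: "B \<ge> 0" "G \<ge> 0" "U \<ge> 0" "V \<ge> 0" using A D by (auto simp: B_def G_def U_def V_def)
  \<comment> \<open>By the inequality between the two means |2 R| is at most A + D; so the base is
    nonnegative and at most 2 (A + D).\<close>
  have "4 * R\<^sup>2 \<le> (A + D)\<^sup>2" using R sum_squares_ge_zero[of "A - D" 0] by (simp add: power2_eq_square algebra_simps)
  then have "\<bar>2 * R\<bar> \<le> \<bar>A + D\<bar>" by (simp add: abs_le_square_iff power_mult_distrib)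
  then have R2: "2 * R \<le> A + D" "0 \<le> A + 2 * R + D" using A D by linarith+
  \<comment> \<open>Mixed monomials of the same degree are dominated by the sum of the extreme ones,
    \<open>U\<close> and \<open>V\<close>.\<close>
  have x1: "B * D * D \<le> U + V"
  proof -
    have "A ^ q * D \<le> A ^ Suc q + D ^ Suc q" by (rule power_cross_le[OF A D])
    from mult_right_mono[OF this D] show ?thesis
      by (simp add: B_def G_def U_def V_def algebra_simps)
  qed
  have x2: "A * (D * G) \<le> U + V"
  proof (cases "A \<le> D")
    case True
    then have "A * (D * G) \<le> D * (D * G)" using D B by (intro mult_right_mono) auto
    then show ?thesis using B(3) by (simp add: V_def algebra_simps)
  next
    case False
    then have "G \<le> B" unfolding G_def B_def using D by (intro power_mono) auto
    then have "A * D * G \<le> A * D * B" using A D by (intro mult_left_mono) auto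
    then show ?thesis using B(4) by (simp add: U_def algebra_simps)
  qed
  have y1: "4 * p * (B * R\<^sup>2) \<le> 4 * p * U"
    using mult_left_mono[OF R B(1)] p by (intro mult_left_mono) (auto simp: U_def algebra_simps)
  have y2: "p * (B * D) * (2 * R) \<le> p * (B * D) * (A + D)"
    using R2 p B D by (intro mult_left_mono) auto
  have y3: "K * (B * D + D * G) * (A + 2 * R + D) \<le> K * (B * D + D * G) * (2 * (A + D))"
    using R2 K B D by (intro mult_left_mono) auto
  have y4: "K * (B * D * D) \<le> K * (U + V)" "K * (A * (D * G)) \<le> K * (U + V)"
    "p * (B * D * D) \<le> p * (U + V)"
    using x1 x2 K p by (auto intro: mult_left_mono)
  have "(A + 2 * R + D) ^ Suc (Suc q) = (A + 2 * R + D) ^ Suc q * (A + 2 * R + D)" by simp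
  also have "\<dots> \<le> (A ^ Suc q + 2 * real (Suc q) * A ^ q * R + K * (A ^ q * D + D ^ Suc q)) * (A + 2 * R + D)"
    using Suc R2 unfolding K_def by (intro mult_right_mono) auto
  also have "\<dots> = (A * B + 2 * p * B * R + K * (B * D + D * G)) * (A + 2 * R + D)"
    by (simp add: B_def G_def p_def)
  also have "\<dots> = A * (A * B) + 2 * (p + 1) * (A * B) * R + U + 4 * p * (B * R\<^sup>2) + p * (B * D) * (2 * R)
      + K * (B * D + D * G) * (A + 2 * R + D)"
    by (simp add: U_def algebra_simps power2_eq_square)
  also have "\<dots> \<le> A * (A * B) + 2 * (p + 1) * (A * B) * R + U + 4 * p * U + p * (B * D) * (A + D)
      + K * (B * D + D * G) * (2 * (A + D))"
    using y1 y2 y3 by linarith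
  also have "\<dots> = A * (A * B) + 2 * (p + 1) * (A * B) * R + U + 5 * (p * U) + p * (B * D * D)
      + 2 * (K * U + K * (B * D * D) + K * (A * (D * G)) + K * V)"
    by (simp add: U_def V_def algebra_simps)
  also have "\<dots> \<le> A * (A * B) + 2 * (p + 1) * (A * B) * R + (1 + 6 * p + 6 * K) * (U + V)"
  proof -
    have "(1 + 6 * p + 6 * K) * (U + V) =
        U + V + 6 * (p * U) + 6 * (p * V) + 6 * (K * U) + 6 * (K * V)"
      by (simp add: algebra_simps)
    moreover have "0 \<le> p * V" "0 \<le> K * U" "0 \<le> K * V" "0 \<le> p * U" using p B K by simp_all
    moreover have "X + U + 5 * pU + pb + 2 * (KU + Kb + Ka + KV) \<le> X + E"
      if "E = U + V + 6 * pU + 6 * pV + 6 * KU + 6 * KV" "0 \<le> pV" "0 \<le> KU" "0 \<le> KV" "0 \<le> pU"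
        "Kb \<le> KU + KV" "Ka \<le> KU + KV" "pb \<le> pU + pV"
      for X pU pb KU Kb Ka KV E pV :: real
      using that B(4) by (smt (verit))
    ultimately show ?thesis using y4[unfolded distrib_left] by blast
  qed
  finally show ?case
    by (simp add: U_def V_def B_def G_def p_def K_def algebra_simps)
qed

text \<open>A one-step Burkholder inequality: adding a martingale difference to \<open>Z\<close> increases the
  squared norm in the space with exponent \<open>2 p\<close> at most by a constant times that of the difference.\<close>

lemma moment_step:
  fixes f Z :: "ptree \<Rightarrow> complex" and a b :: real
  assumes n: "n \<ge> 1" and a: "a > 0" and b: "b > 0"
    and f: "\<And>t v i. port n t \<Longrightarrow> (v, i) \<in> slots t \<Longrightarrow> f (attach (Suc n) v i t) = Z t + d t (v, i)"
    and d: "\<And>t. port n t \<Longrightarrow> (\<Sum>s\<in>slots t. d t s) = 0"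
    and Ea: "expect n (\<lambda>t. norm (Z t) ^ (2 * Suc q)) \<le> a ^ Suc q"
    and Eb: "expect n (\<lambda>t. (\<Sum>s\<in>slots t. norm (d t s) ^ (2 * Suc q)) / (2 * real n - 1)) \<le> b ^ Suc q"
  shows "expect (Suc n) (\<lambda>t. norm (f t) ^ (2 * Suc q)) \<le> (a + (3 * step_const q + 1) * b) ^ Suc q"
proof -
  define K where "K = step_const q"
  have K: "K \<ge> 0" unfolding K_def by (rule step_const_nonneg)
  define N where "N = 2 * real n - 1"
  have N: "N > 0" using n by (simp add: N_def)
  define zz where "zz t = norm (Z t) ^ (2 * Suc q)" for t
  define dd where "dd t = (\<Sum>s\<in>slots t. norm (d t s) ^ (2 * Suc q)) / N" for t
  have "(\<Sum>(v, i)\<in>slots t. norm (f (attach (Suc n) v i t)) ^ (2 * Suc q)) / N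
      \<le> zz t + K * (a ^ q * b * (zz t / a ^ Suc q + dd t / b ^ Suc q) + dd t)" if t: "port n t" for t
  proof -
    define c where "c s = Re (cnj (Z t) * d t s)" for s
    have card: "real (card (slots t)) = N" using card_slots[OF t] n by (simp add: N_def of_nat_diff)
    have "(\<Sum>(v, i)\<in>slots t. norm (f (attach (Suc n) v i t)) ^ (2 * Suc q))
        = (\<Sum>s\<in>slots t. norm (Z t + d t s) ^ (2 * Suc q))"
      by (rule sum.cong) (use f t in auto)
    also have "\<dots> \<le> (\<Sum>s\<in>slots t. zz t + 2 * real (Suc q) * ((norm (Z t))\<^sup>2) ^ q * c s
        + K * (a ^ q * b * (zz t / a ^ Suc q + norm (d t s) ^ (2 * Suc q) / b ^ Suc q)
               + norm (d t s) ^ (2 * Suc q)))"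
    proof (rule sum_mono)
      fix s
      define A D where "A = (norm (Z t))\<^sup>2" and "D = (norm (d t s))\<^sup>2"
      have pos: "A \<ge> 0" "D \<ge> 0" by (auto simp: A_def D_def)
      have eq: "(norm (Z t + d t s))\<^sup>2 = A + 2 * c s + D"
        unfolding A_def D_def c_def cmod_power2 by (simp add: power2_eq_square algebra_simps)
      have "\<bar>c s\<bar> \<le> norm (cnj (Z t) * d t s)" unfolding c_def by (rule abs_Re_le_cmod)
      then have "(c s)\<^sup>2 \<le> (norm (cnj (Z t) * d t s))\<^sup>2" by (metis abs_le_square_iff abs_norm_cancel)
      also have "\<dots> = A * D" by (simp add: A_def D_def norm_mult power_mult_distrib)
      finally have R: "(c s)\<^sup>2 \<le> A * D" .
      \<comment> \<open>Young's inequality for \<open>A / a\<close> and \<open>D / b\<close>. With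
        these weights, each summand in the bracket has mean at most 1 once positions and trees are
        averaged.\<close>
      have cross: "A ^ q * D \<le> a ^ q * b * (A ^ Suc q / a ^ Suc q + D ^ Suc q / b ^ Suc q)"
      proof -
        have "(A / a) ^ q * (D / b) \<le> (A / a) ^ Suc q + (D / b) ^ Suc q"
          using pos a b by (intro power_cross_le) auto
        then have "a ^ q * b * ((A / a) ^ q * (D / b)) \<le> a ^ q * b * ((A / a) ^ Suc q + (D / b) ^ Suc q)"
          using a b by (intro mult_left_mono) auto
        moreover have "a ^ q * b * ((A / a) ^ q * (D / b)) = A ^ q * D"
          using a b by (simp add: power_divide)
        ultimately show ?thesis by (simp only: power_divide)
      qed
      have "norm (Z t + d t s) ^ (2 * Suc q) = (A + 2 * c s + D) ^ Suc q"
        by (simp only: power_mult eq)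
      also have "\<dots> \<le> A ^ Suc q + 2 * real (Suc q) * A ^ q * c s + K * (A ^ q * D + D ^ Suc q)"
        unfolding K_def by (rule power_expansion_le[OF pos R])
      also have "\<dots> \<le> A ^ Suc q + 2 * real (Suc q) * A ^ q * c s +
          K * (a ^ q * b * (A ^ Suc q / a ^ Suc q + D ^ Suc q / b ^ Suc q) + D ^ Suc q)"
        using cross K by (intro add_left_mono mult_left_mono add_right_mono) auto
      finally show "norm (Z t + d t s) ^ (2 * Suc q) \<le> zz t + 2 * real (Suc q) * ((norm (Z t))\<^sup>2) ^ q * c s
        + K * (a ^ q * b * (zz t / a ^ Suc q + norm (d t s) ^ (2 * Suc q) / b ^ Suc q)
               + norm (d t s) ^ (2 * Suc q))"
        unfolding zz_def power_mult A_def D_def .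
    qed
    also have "\<dots> = N * zz t + 2 * real (Suc q) * ((norm (Z t))\<^sup>2) ^ q * (\<Sum>s\<in>slots t. c s)
        + K * (a ^ q * b * (N * (zz t / a ^ Suc q) + N * dd t / b ^ Suc q) + N * dd t)"
      unfolding sum.distrib sum_distrib_left[symmetric] sum_divide_distrib[symmetric] sum_constant card dd_def
      using N by simp
    also have "(\<Sum>s\<in>slots t. c s) = 0"
    proof -
      have "(\<Sum>s\<in>slots t. c s) = Re (cnj (Z t) * (\<Sum>s\<in>slots t. d t s))"
        by (simp only: c_def Re_sum sum_distrib_left)
      then show ?thesis by (simp add: d[OF t])
    qed
    also have "N * zz t + 2 * real (Suc q) * ((norm (Z t))\<^sup>2) ^ q * 0
        + K * (a ^ q * b * (N * (zz t / a ^ Suc q) + N * dd t / b ^ Suc q) + N * dd t)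
        = N * (zz t + K * (a ^ q * b * (zz t / a ^ Suc q + dd t / b ^ Suc q) + dd t))"
      by (simp add: algebra_simps)
    finally show ?thesis using N by (simp add: field_simps)
  qed
  then have "expect (Suc n) (\<lambda>t. norm (f t) ^ (2 * Suc q))
      \<le> expect n (\<lambda>t. zz t + K * (a ^ q * b * (zz t / a ^ Suc q + dd t / b ^ Suc q) + dd t))"
    unfolding expectation_random_port_Suc[OF n] N_def[symmetric]
    by (intro expectation_random_port_mono[OF n]) auto
  also have "\<dots> = expect n zz + K * (a ^ q * b * (expect n zz / a ^ Suc q + expect n dd / b ^ Suc q) + expect n dd)"
    using n by simp
  also have "\<dots> \<le> a ^ Suc q + K * (a ^ q * b * (a ^ Suc q / a ^ Suc q + b ^ Suc q / b ^ Suc q) + b ^ Suc q)"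
  proof -
    have "expect n zz \<le> a ^ Suc q" "expect n dd \<le> b ^ Suc q"
      using Ea Eb unfolding zz_def dd_def N_def by auto
    then show ?thesis using K a b
      by (intro add_mono mult_left_mono divide_right_mono) auto
  qed
  also have "\<dots> = a ^ q * a + 2 * K * b * a ^ q + K * b * b ^ q"
    using a b by (simp add: algebra_simps)
  \<comment> \<open>Replacing \<open>a ^ q\<close> and \<open>b ^ q\<close> by powers of one larger
    base leaves the factor \<open>a + 3 * K * b\<close>. The summand 1 in \<open>3 * K + 1\<close>
    ensures that \<open>b\<close> does not exceed that base.\<close>
  also have "\<dots> \<le> (a + (3 * K + 1) * b) ^ q * a + 2 * K * b * (a + (3 * K + 1) * b) ^ q
      + K * b * (a + (3 * K + 1) * b) ^ q"
  proof -
    have Kb: "0 \<le> K * b" using K b by simp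
    have "(3 * K + 1) * b = 3 * (K * b) + b" by (simp add: algebra_simps)
    then have le: "a \<le> a + (3 * K + 1) * b" "b \<le> a + (3 * K + 1) * b" using Kb a b by linarith+
    show ?thesis
      using le a b K Kb by (intro add_mono mult_left_mono mult_right_mono power_mono) auto
  qed
  also have "\<dots> = (a + (3 * K + 1) * b) ^ q * (a + 3 * K * b)" by (simp add: algebra_simps)
  also have "\<dots> \<le> (a + (3 * K + 1) * b) ^ q * (a + (3 * K + 1) * b)"
    using a b K by (intro mult_left_mono) (auto simp: algebra_simps)
  finally show ?thesis by (simp only: power_Suc2 K_def)
qed

text \<open>Minkowski's inequality for a constant summand, in the space with exponent
  \<open>Suc q\<close>. Convexity is used with the weights \<open>a / (a + B)\<close> and
  \<open>B / (a + B)\<close>, for which the pointwise bound is an equality at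
  \<open>x t = a\<close>.\<close>

lemma moment_shift:
  assumes n: "n \<ge> 1" and a: "a > 0" and B: "B \<ge> 0"
    and x: "\<And>t. x t \<ge> 0" and le: "expect n (\<lambda>t. x t ^ Suc q) \<le> a ^ Suc q"
  shows "expect n (\<lambda>t. (x t + B) ^ Suc q) \<le> (a + B) ^ Suc q"
proof -
  have pt: "(x t + B) ^ Suc q \<le> (a + B) ^ q * (x t ^ Suc q / a ^ q + B)" for t
  proof -
    define \<alpha> \<beta> u m where "\<alpha> = a / (a + B)" and "\<beta> = B / (a + B)" and "u = (a + B) * x t / a" and "m = x t + B"
    have ab: "\<alpha> \<ge> 0" "\<beta> \<ge> 0" "\<alpha> + \<beta> = 1"
      using a B by (simp_all add: \<alpha>_def \<beta>_def add_divide_distrib[symmetric])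
    have nn: "u \<ge> 0" "m \<ge> 0" using a B x[of t] by (auto simp: u_def m_def)
    have mean: "\<alpha> * u + \<beta> * (a + B) = m"
      using a B by (simp add: \<alpha>_def \<beta>_def u_def m_def)
    have "\<alpha> * (m ^ Suc q + real (Suc q) * m ^ q * (u - m)) + \<beta> * (m ^ Suc q + real (Suc q) * m ^ q * ((a + B) - m))
        \<le> \<alpha> * u ^ Suc q + \<beta> * (a + B) ^ Suc q"
      using ab nn a B by (intro add_mono mult_left_mono power_above_tangent) auto
    also have "\<alpha> * (m ^ Suc q + real (Suc q) * m ^ q * (u - m)) + \<beta> * (m ^ Suc q + real (Suc q) * m ^ q * ((a + B) - m))
      = (\<alpha> + \<beta>) * m ^ Suc q + real (Suc q) * m ^ q * (\<alpha> * u + \<beta> * (a + B) - (\<alpha> + \<beta>) * m)"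
      by (simp add: algebra_simps)
    also have "\<dots> = m ^ Suc q" using ab mean by simp
    finally have "m ^ Suc q \<le> \<alpha> * u ^ Suc q + \<beta> * (a + B) ^ Suc q" .
    also have "\<alpha> * u ^ Suc q = (a + B) ^ q * (x t ^ Suc q / a ^ q)"
    proof -
      have "\<alpha> * u = x t" using a B by (simp add: \<alpha>_def u_def)
      then have "\<alpha> * u ^ Suc q = x t * u ^ q" by (simp only: power_Suc mult.assoc[symmetric])
      then show ?thesis by (simp add: u_def power_mult_distrib power_divide)
    qed
    also have "\<beta> * (a + B) ^ Suc q = (a + B) ^ q * B" using a B by (simp add: \<beta>_def)
    finally show ?thesis by (simp add: m_def algebra_simps)
  qed
  have "expect n (\<lambda>t. (x t + B) ^ Suc q) \<le> expect n (\<lambda>t. (a + B) ^ q * (x t ^ Suc q / a ^ q + B))"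
    by (rule expectation_random_port_mono[OF n pt])
  also have "\<dots> = (a + B) ^ q * (expect n (\<lambda>t. x t ^ Suc q) / a ^ q + B)" using n by simp
  also have "\<dots> \<le> (a + B) ^ q * (a ^ Suc q / a ^ q + B)"
    using le a B by (intro mult_left_mono add_right_mono divide_right_mono) auto
  also have "\<dots> = (a + B) ^ Suc q" using a by simp
  finally show ?thesis .
qed

text \<open>Bernoulli's inequality, from the convexity of exp.\<close>

lemma powr_le_one_plus:
  fixes a x :: real
  assumes "0 \<le> a" "a \<le> 1" "x \<ge> 0"
  shows "(1 + x) powr a \<le> 1 + a * x"
proof -
  have "exp ((1 - a) * 0 + a * ln (1 + x)) \<le> (1 - a) * exp 0 + a * exp (ln (1 + x))"
    using convex_onD[OF exp_convex, of a 0 "ln (1 + x)"] assms by simp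
  then show ?thesis using assms by (simp add: powr_def algebra_simps)
qed

lemma one_plus_le_powr:
  fixes a x :: real
  assumes "a \<ge> 1" "x \<ge> 0"
  shows "1 + a * x \<le> (1 + x) powr a"
proof -
  have "(1 + a * x) powr (1 / a) \<le> 1 + x"
    using powr_le_one_plus[of "1 / a" "a * x"] assms by simp
  then have "((1 + a * x) powr (1 / a)) powr a \<le> (1 + x) powr a"
    using assms by (intro powr_mono2) auto
  then show ?thesis using assms by (simp add: powr_powr)
qed

section \<open>Moments of the level polynomial\<close>

text \<open>Unlike for \<open>gf\<close>, the conditional mean after one step is a multiple of the
  current value, with no additive term.\<close>

definition slotgf :: "ptree \<Rightarrow> 'a::comm_ring_1 \<Rightarrow> 'a" where
  "slotgf t z = (1 + z) * gf t z - 1"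

lemma sum_slots_port:
  assumes "port n t"
  shows "(\<Sum>s\<in>slots t. z ^ Suc (level t (fst s))) = slotgf t z"
  using sum_slots[OF port_nodes(1)[OF assms], of z] by (simp add: slotgf_def case_prod_beta)

lemma real_card_slots: "port n t \<Longrightarrow> real (card (slots t)) = 2 * real n - 1"
  using card_slots[of n t] port_nodes(4)[of n t] by (simp add: of_nat_diff)

lemma gf_attach_port:
  assumes "port n t" "(v, i) \<in> slots t"
  shows "gf (attach m v i t) z = gf t z + z ^ Suc (level t v)"
    "slotgf (attach m v i t) z = slotgf t z + (1 + z) * z ^ Suc (level t v)"
  using gf_attach[OF port_nodes(1)[OF assms(1)], of v m i z] assms(2)
  by (auto simp: slots_def slotgf_def algebra_simps)

text \<open>Each factor is \<open>1 + (1 + z) / (2 * j - 1)\<close>: a new node of weight w adds (1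
  + z) w, and w is on average the current value divided by \<open>2 * j - 1\<close>. The tree with
  one node contributes \<open>z\<close>.\<close>

definition gmean :: "nat \<Rightarrow> 'a::field \<Rightarrow> 'a" where
  "gmean n z = z * (\<Prod>j=1..<n. (2 * of_nat j + z) / (2 * of_nat j - 1))"

lemma gmean_1: "gmean (Suc 0) z = z"
  by (simp add: gmean_def)

lemma gmean_Suc: "n \<ge> 1 \<Longrightarrow> gmean (Suc n) z = gmean n z * ((2 * of_nat n + z) / (2 * of_nat n - 1))"
  by (simp add: gmean_def prod.atLeastLessThan_Suc)

text \<open>Applied at y = |z|^(2 (q + 1)) with z near 1, where it controls the martingale
  increments, and at y = 2, where it controls the height of the tree.\<close>

lemma expect_slotgf:
  fixes y :: real
  assumes "n \<ge> 1"
  shows "expect n (\<lambda>t. slotgf t y) = gmean n y"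
  using assms
proof (induction n rule: dec_induct)
  case base
  then show ?case unfolding random_port_1 by (simp add: slotgf_def gmean_1)
next
  case (step n)
  have "expect (Suc n) (\<lambda>t. slotgf t y) = expect n (\<lambda>t. slotgf t y * ((2 * real n + y) / (2 * real n - 1)))"
    unfolding expectation_random_port_Suc[OF step.hyps(1)]
  proof (rule expectation_random_port_cong[OF step.hyps(1)])
    fix t assume t: "port n t"
    have "(\<Sum>(v, i)\<in>slots t. slotgf (attach (Suc n) v i t) y) =
        (\<Sum>s\<in>slots t. slotgf t y + (1 + y) * y ^ Suc (level t (fst s)))"
      by (rule sum.cong) (use gf_attach_port(2)[OF t] in auto)
    also have "\<dots> = (2 * real n - 1) * slotgf t y + (1 + y) * slotgf t y"
      by (simp only: sum.distrib sum_distrib_left[symmetric] sum_slots_port[OF t] sum_constant real_card_slots[OF t])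
    also have "\<dots> = slotgf t y * (2 * real n + y)" by (simp add: algebra_simps)
    finally show "(\<Sum>(v, i)\<in>slots t. slotgf (attach (Suc n) v i t) y) / (2 * real n - 1) =
        slotgf t y * ((2 * real n + y) / (2 * real n - 1))" by simp
  qed
  also have "\<dots> = gmean (Suc n) y" using step by (simp add: gmean_Suc)
  finally show ?case .
qed

text \<open>The order at y = 2 is n^(3/2), so the mean weight of a position grows at most like sqrt
  n. This is the loss that the increments near 1 can afford.\<close>

lemma gmean_le:
  fixes y :: real
  assumes "n \<ge> 1" "0 \<le> y" "y \<le> 2"
  shows "gmean n y \<le> y * (2 * real n - 1) * sqrt (real n)"
  using assms(1)
proof (induction n rule: dec_induct)
  case base
  then show ?case using assms by (simp add: gmean_1)
next
  case (step n)
  define x where "x = real n"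
  have x: "x \<ge> 1" using step by (simp add: x_def)
  have "(2 * x + 2) * sqrt x \<le> (2 * x + 1) * sqrt (x + 1)"
  proof (rule power2_le_imp_le)
    have "4 * x * (x + 1) \<le> (2 * x + 1)\<^sup>2" by (simp add: power2_eq_square algebra_simps)
    then have "4 * x * (x + 1) * (x + 1) \<le> (2 * x + 1)\<^sup>2 * (x + 1)" using x by (intro mult_right_mono) auto
    then show "((2 * x + 2) * sqrt x)\<^sup>2 \<le> ((2 * x + 1) * sqrt (x + 1))\<^sup>2"
      unfolding power_mult_distrib using x
      by (simp only: real_sqrt_pow2) (simp add: power2_eq_square algebra_simps)
  qed (use x in auto)
  then have *: "y * ((2 * x + 2) * sqrt x) \<le> y * ((2 * x + 1) * sqrt (x + 1))"
    using assms by (intro mult_left_mono) auto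
  have "gmean (Suc n) y = gmean n y * ((2 * x + y) / (2 * x - 1))"
    using step by (simp add: gmean_Suc x_def)
  also have "\<dots> \<le> (y * (2 * x - 1) * sqrt x) * ((2 * x + 2) / (2 * x - 1))"
    using step.IH assms x unfolding x_def[symmetric]
    by (intro mult_mono divide_right_mono) auto
  also have "\<dots> = y * ((2 * x + 2) * sqrt x)" using x by simp
  also note *
  finally show ?case by (simp add: x_def algebra_simps)
qed

text \<open>The true exponent is (1 + Re z) / 2, which is at least 15/16 here. The value 7/8
  suffices: its double against the sqrt n in the increments leaves n^(-5/4), which is
  summable.\<close>

lemma norm_gmean_ge:
  fixes z :: complex
  assumes "n \<ge> 1" "norm (z - 1) \<le> 1 / 8"
  shows "7 / 8 * real n powr (7 / 8) \<le> norm (gmean n z)"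
  using assms(1)
proof (induction n rule: dec_induct)
  case base
  have "1 - norm (z - 1) \<le> norm z" using norm_triangle_ineq2[of 1 "1 - z"] by (simp add: norm_minus_commute)
  then show ?case using assms by (simp add: gmean_1)
next
  case (step n)
  define x where "x = real n"
  have x: "x \<ge> 1" using step by (simp add: x_def)
  have Re: "Re z \<ge> 7 / 8" using abs_Re_le_cmod[of "z - 1"] assms(2) by simp
  have p: "1 + 7 / 8 * (1 / x) \<ge> (1 + 1 / x) powr (7 / 8)"
    using powr_le_one_plus[of "7 / 8" "1 / x"] x by simp
  have "1 + 7 / 8 * (1 / x) \<le> (2 * x + 7 / 8) / (2 * x - 1)"
    using x by (simp add: field_simps)
  also have "\<dots> \<le> norm (2 * of_nat n + z) / (2 * x - 1)"
    using complex_Re_le_cmod[of "2 * of_nat n + z"] Re x by (intro divide_right_mono) (auto simp: x_def)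
  also have "\<dots> = norm ((2 * of_nat n + z) / (2 * of_nat n - 1))"
  proof -
    have "norm (2 * of_nat n - 1 :: complex) = norm (of_real (2 * x - 1) :: complex)" by (simp add: x_def)
    also have "\<dots> = 2 * x - 1" unfolding norm_of_real using x by simp
    finally show ?thesis by (simp add: norm_divide)
  qed
  finally have q: "(1 + 1 / x) powr (7 / 8) \<le> norm ((2 * of_nat n + z) / (2 * of_nat n - 1))" using p by linarith
  have "real (Suc n) = x * (1 + 1 / x)" using x by (simp add: x_def field_simps)
  then have "7 / 8 * real (Suc n) powr (7 / 8) = (7 / 8 * x powr (7 / 8)) * (1 + 1 / x) powr (7 / 8)"
    using x by (simp add: powr_mult)
  also have "\<dots> \<le> norm (gmean n z) * norm ((2 * of_nat n + z) / (2 * of_nat n - 1))"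
    using step.IH q unfolding x_def[symmetric] by (intro mult_mono) auto
  finally show ?case unfolding gmean_Suc[OF step.hyps(1)] norm_mult .
qed

section \<open>The normalised martingale near 1\<close>

lemma norm_diff_power_le:
  fixes x m :: complex
  shows "norm (x - m) ^ k \<le> 2 ^ k * (norm x ^ k + norm m ^ k)"
proof -
  have "norm (x - m) \<le> 2 * max (norm x) (norm m)" using norm_triangle_ineq4[of x m] by simp
  then have "norm (x - m) ^ k \<le> (2 * max (norm x) (norm m)) ^ k" by (intro power_mono) auto
  also have "\<dots> = 2 ^ k * max (norm x) (norm m) ^ k" by (simp add: power_mult_distrib)
  also have "max (norm x) (norm m) ^ k \<le> norm x ^ k + norm m ^ k" by (simp add: max_def)
  finally show ?thesis by simp
qed

text \<open>The 2 (q + 1)-th powers of the moduli of the weights, summed over all positions, give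
  \<open>slotgf t y\<close> at the real point y = |z|^(2 (q + 1)). So a first moment controls the
  high moments of the increments as long as y is at most 2.\<close>

lemma near_increment:
  fixes z :: complex
  assumes n: "n \<ge> 1" and z: "norm (z - 1) \<le> 1 / 8" and y: "norm z ^ (2 * Suc q) \<le> 2"
  shows "expect n (\<lambda>t. (\<Sum>s\<in>slots t. norm ((1 + z) * (z ^ Suc (level t (fst s)) -
      slotgf t z / (2 * of_nat n - 1)) / gmean (Suc n) z) ^ (2 * Suc q)) / (2 * real n - 1))
    \<le> (200 * real n powr (- (5 / 4))) ^ Suc q"
proof -
  define N where "N = 2 * real n - 1"
  define k where "k = 2 * Suc q"
  define y where "y = norm z ^ k"
  define g where "g = norm (gmean (Suc n) z)"
  define w where "w = real n powr (7 / 8)"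
  have N: "N > 0" using n by (simp add: N_def)
  have w: "w > 0" using n by (simp add: w_def)
  have "w \<le> real (Suc n) powr (7 / 8)" unfolding w_def by (rule powr_mono2) auto
  then have g: "7 / 8 * w \<le> g" using norm_gmean_ge[of "Suc n" z] z by (simp add: g_def)
  have y: "0 \<le> y" "y \<le> 2" using y by (auto simp: y_def k_def)
  have z1: "norm (1 + z) \<le> 3" using norm_triangle_ineq[of 2 "z - 1"] z by simp
  have pt: "(\<Sum>s\<in>slots t. norm ((1 + z) * (z ^ Suc (level t (fst s)) -
      slotgf t z / (2 * of_nat n - 1)) / gmean (Suc n) z) ^ k) / N
    \<le> (3 / g) ^ k * (2 ^ k * 2) / N * slotgf t y" if t: "port n t" for t
  proof -
    define x where "x s = z ^ Suc (level t (fst s))" for s :: "nat \<times> nat"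
    define m where "m = slotgf t z / (2 * of_nat n - 1)"
    have ofN: "2 * of_nat n - 1 = (of_real N :: complex)" by (simp add: N_def)
    have m: "m = (\<Sum>s\<in>slots t. x s) / of_real N"
      unfolding m_def x_def sum_slots_port[OF t] ofN ..
    have card: "real (card (slots t)) = N" using real_card_slots[OF t] by (simp add: N_def)
    have sumx: "(\<Sum>s\<in>slots t. norm (x s) ^ k) = slotgf t y"
      using sum_slots_port[OF t, of y] unfolding x_def y_def norm_power
      by (simp only: power_mult[symmetric] mult.commute)
    have "norm m \<le> (\<Sum>s\<in>slots t. norm (x s)) / N"
      unfolding m norm_divide using N by (simp add: divide_right_mono norm_sum)
    then have "norm m ^ k \<le> ((\<Sum>s\<in>slots t. norm (x s)) / N) ^ k" by (intro power_mono) auto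
    also have "\<dots> \<le> (\<Sum>s\<in>slots t. norm (x s) ^ k) / N"
      using sum_power_mean_le[of "slots t" "\<lambda>s. norm (x s)" "2 * q + 1"] by (simp add: card k_def)
    finally have mk: "norm m ^ k \<le> slotgf t y / N" by (simp add: sumx)
    have "(\<Sum>s\<in>slots t. norm ((1 + z) * (x s - m) / gmean (Suc n) z) ^ k)
        \<le> (\<Sum>s\<in>slots t. (3 / g) ^ k * (2 ^ k * (norm (x s) ^ k + slotgf t y / N)))"
    proof (rule sum_mono)
      fix s
      have "norm ((1 + z) * (x s - m) / gmean (Suc n) z) ^ k = (norm (1 + z) / g) ^ k * norm (x s - m) ^ k"
        by (simp add: norm_mult norm_divide g_def power_mult_distrib power_divide)
      also have "\<dots> \<le> (3 / g) ^ k * (2 ^ k * (norm (x s) ^ k + norm m ^ k))"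
        using z1 g w norm_diff_power_le[of "x s" m k]
        by (intro mult_mono power_mono divide_right_mono) auto
      also have "\<dots> \<le> (3 / g) ^ k * (2 ^ k * (norm (x s) ^ k + slotgf t y / N))"
        using mk g w by (intro mult_left_mono add_left_mono) auto
      finally show "norm ((1 + z) * (x s - m) / gmean (Suc n) z) ^ k
        \<le> (3 / g) ^ k * (2 ^ k * (norm (x s) ^ k + slotgf t y / N))" .
    qed
    also have "\<dots> = (3 / g) ^ k * (2 ^ k * (slotgf t y + N * (slotgf t y / N)))"
      by (simp only: sum_distrib_left[symmetric] sum.distrib sumx sum_constant card)
    also have "\<dots> = (3 / g) ^ k * (2 ^ k * 2) * slotgf t y" using N by simp
    finally have "(\<Sum>s\<in>slots t. norm ((1 + z) * (x s - m) / gmean (Suc n) z) ^ k) / N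
        \<le> (3 / g) ^ k * (2 ^ k * 2) * slotgf t y / N"
      using N by (intro divide_right_mono) auto
    then show ?thesis by (simp add: x_def m_def)
  qed
  have "expect n (\<lambda>t. (\<Sum>s\<in>slots t. norm ((1 + z) * (z ^ Suc (level t (fst s)) -
      slotgf t z / (2 * of_nat n - 1)) / gmean (Suc n) z) ^ k) / N)
    \<le> expect n (\<lambda>t. (3 / g) ^ k * (2 ^ k * 2) / N * slotgf t y)"
    by (rule expectation_random_port_mono[OF n pt])
  also have "\<dots> = (3 / g) ^ k * (2 ^ k * 2) / N * gmean n y" using n expect_slotgf[of n y] by simp
  also have "\<dots> \<le> (3 / g) ^ k * (2 ^ k * 2) / N * (2 * N * sqrt n)"
  proof -
    have "y * N * sqrt n \<le> 2 * N * sqrt n" using y N by (intro mult_right_mono) auto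
    then have "gmean n y \<le> 2 * N * sqrt n" using gmean_le[OF n y] by (simp add: N_def)
    then show ?thesis using N g w by (intro mult_left_mono) auto
  qed
  also have "\<dots> = (6 / g) ^ k * (4 * sqrt n)"
    using N by (simp add: power_divide power_mult_distrib[symmetric])
  also have "\<dots> = (36 / g\<^sup>2) ^ Suc q * (4 * sqrt n)"
    by (simp only: k_def power_mult power_divide) simp
  \<comment> \<open>\<open>4 * sqrt n\<close> is at least 1 and hence at most its power. The
    constants multiply to 36 * 4 * (8/7)^2 = 9216/49, which is below 200.\<close>
  also have "\<dots> \<le> (36 / (7 / 8 * w)\<^sup>2) ^ Suc q * (4 * sqrt n) ^ Suc q"
  proof -
    have "(7 / 8 * w)\<^sup>2 \<le> g\<^sup>2" using g w by (intro power_mono) auto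
    then have "36 / g\<^sup>2 \<le> 36 / (7 / 8 * w)\<^sup>2" using w by (intro divide_left_mono mult_pos_pos) (auto intro: order.strict_trans2[of 0 "(7 / 8 * w)\<^sup>2"])
    moreover have "(4 * sqrt n) ^ 1 \<le> (4 * sqrt n) ^ Suc q"
      using n by (intro power_increasing) (auto intro: order_trans[of 1 "4 * 1"])
    ultimately show ?thesis by (intro mult_mono power_mono) auto
  qed
  also have "\<dots> = (36 / (7 / 8 * w)\<^sup>2 * (4 * sqrt n)) ^ Suc q" by (simp only: power_mult_distrib)
  also have "\<dots> \<le> (200 * real n powr (- (5 / 4))) ^ Suc q"
  proof (rule power_mono)
    have "w\<^sup>2 = real n powr (7 / 4)" using n by (simp add: w_def power2_eq_square flip: powr_add)
    moreover have "sqrt n / real n powr (7 / 4) = real n powr (- (5 / 4))"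
      using n by (simp add: powr_half_sqrt[symmetric] flip: powr_diff)
    ultimately have e: "sqrt n / w\<^sup>2 = real n powr (- (5 / 4))" by simp
    have "36 / (7 / 8 * w)\<^sup>2 * (4 * sqrt n) = (9216 / 49) * (sqrt n / w\<^sup>2)"
      by (simp add: power_mult_distrib power_divide)
    also have "\<dots> \<le> 200 * (sqrt n / w\<^sup>2)" by (intro mult_right_mono) auto
    finally show "36 / (7 / 8 * w)\<^sup>2 * (4 * sqrt n) \<le> 200 * real n powr (- (5 / 4))" by (simp only: e)
  qed auto
  finally show ?thesis by (simp only: k_def N_def)
qed

text \<open>The squared norms of the increments, in the space with exponent 2 (q + 1), are summable;
  iterating \<open>moment_step\<close> then bounds the normalised martingale uniformly in
  \<open>n\<close>.\<close>

lemma moment_near: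
  "\<exists>K r. 0 < r \<and> r \<le> 1 / 8 \<and> K > 0 \<and> (\<forall>n\<ge>1. \<forall>z::complex. norm (z - 1) \<le> r \<longrightarrow>
    expect n (\<lambda>t. norm (slotgf t z) ^ (2 * Suc q)) \<le> (K * (norm (gmean n z))\<^sup>2) ^ Suc q)"
proof -
  define C where "C = 3 * step_const q + 1"
  have C1: "C \<ge> 1" using step_const_nonneg[of q] by (simp add: C_def)
  note C = C1 moment_step[where q = q, folded C_def]
  \<comment> \<open>Then |z|^(2 (q + 1)) <= exp (1/4) <= 2, as the increment bound requires; the
    disc shrinks as the order of the moment grows.\<close>
  define r where "r = 1 / (8 * real (Suc q))"
  define b where "b j = 200 * real j powr (- (5 / 4))" for j
  have r: "0 < r" "r \<le> 1 / 8" by (auto simp: r_def field_simps)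
  have "summable b" unfolding b_def by (intro summable_mult) (simp add: summable_real_powr_iff)
  moreover have b0: "b j \<ge> 0" for j by (simp add: b_def)
  ultimately have sb: "(\<Sum>j=1..<n. b j) \<le> suminf b" for n
    by (intro sum_le_suminf) auto
  define a where "a n = 1 + C * (\<Sum>j=1..<n. b j)" for n
  have a: "a n > 0" for n using C(1) b0 unfolding a_def by (intro add_pos_nonneg mult_nonneg_nonneg sum_nonneg) auto
  have main: "expect n (\<lambda>t. norm (slotgf t z / gmean n z) ^ (2 * Suc q)) \<le> a n ^ Suc q"
    if n: "n \<ge> 1" and z: "norm (z - 1) \<le> r" for n and z :: complex
    using n
  proof (induction n rule: dec_induct)
    case base
    have "z \<noteq> 0" using z r by auto
    then show ?case unfolding random_port_1 by (simp add: slotgf_def gmean_1 a_def)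
  next
    case (step n)
    have zr: "norm (z - 1) \<le> 1 / 8" using z r by simp
    have g0: "gmean m z \<noteq> 0" if "m \<ge> 1" for m
      using norm_gmean_ge[OF that zr] that by auto
    have N0: "2 * of_nat n - 1 \<noteq> (0::complex)"
    proof -
      have "2 * of_nat n - 1 = (of_real (2 * real n - 1) :: complex)" by simp
      also have "\<dots> \<noteq> 0" unfolding of_real_eq_0_iff using step by simp
      finally show ?thesis .
    qed
    have y: "norm z ^ (2 * Suc q) \<le> 2"
    proof -
      have "norm z \<le> 1 + r" using norm_triangle_ineq[of 1 "z - 1"] z by simp
      also have "\<dots> \<le> exp r" by (rule exp_ge_add_one_self)
      finally have "norm z ^ (2 * Suc q) \<le> exp r ^ (2 * Suc q)" by (intro power_mono) auto
      also have "\<dots> = exp (real (2 * Suc q) * r)" by (rule exp_of_nat_mult[symmetric])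
      also have "real (2 * Suc q) * r = 1 / 4" by (simp add: r_def field_simps)
      also have "exp (1 / 4) \<le> exp (1 / 2 :: real)" by simp
      also have "\<dots> \<le> 2" using exp_half_le2 by simp
      finally show ?thesis .
    qed
    have "expect (Suc n) (\<lambda>t. norm (slotgf t z / gmean (Suc n) z) ^ (2 * Suc q)) \<le> (a n + C * b n) ^ Suc q"
    proof (rule C(2)[OF step.hyps(1) a _ _ _ step.IH])
      show "b n > 0" using step by (simp add: b_def)
      show "expect n (\<lambda>t. (\<Sum>s\<in>slots t. norm ((1 + z) * (z ^ Suc (level t (fst s)) -
          slotgf t z / (2 * of_nat n - 1)) / gmean (Suc n) z) ^ (2 * Suc q)) / (2 * real n - 1)) \<le> b n ^ Suc q"
        unfolding b_def by (rule near_increment[OF step.hyps(1) zr y])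
    next
      fix t v i assume t: "port n t" "(v, i) \<in> slots t"
      \<comment> \<open>The martingale property with cleared denominators: the conditional mean of
        \<open>slotgf\<close> divided by the next \<open>gmean\<close> is the current
        quotient.\<close>
      have eq: "gmean (Suc n) z * (2 * of_nat n - 1) = gmean n z * (2 * of_nat n + z)"
        using step N0 by (simp add: gmean_Suc)
      have "gmean (Suc n) z * (2 * of_nat n - 1) \<noteq> 0" using N0 g0[of "Suc n"] by simp
      then have W: "2 * of_nat n + z \<noteq> 0" unfolding eq by simp
      have "slotgf t z / gmean n z = slotgf t z * (2 * of_nat n + z) / (gmean (Suc n) z * (2 * of_nat n - 1))"
        unfolding eq using W by (rule mult_divide_mult_cancel_right[symmetric])
      also have "\<dots> = (slotgf t z + (1 + z) * slotgf t z / (2 * of_nat n - 1)) / gmean (Suc n) z"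
        using N0 g0[of "Suc n"] by (simp add: field_simps)
      finally show "slotgf (attach (Suc n) v i t) z / gmean (Suc n) z = slotgf t z / gmean n z +
          (1 + z) * (z ^ Suc (level t (fst (v, i))) - slotgf t z / (2 * of_nat n - 1)) / gmean (Suc n) z"
        unfolding gf_attach_port(2)[OF t] by (simp add: add_divide_distrib diff_divide_distrib algebra_simps)
    next
      fix t assume t: "port n t"
      have "of_nat (card (slots t)) = (2 * of_nat n - 1 :: complex)"
        using arg_cong[OF real_card_slots[OF t], of complex_of_real] by simp
      then show "(\<Sum>s\<in>slots t. (1 + z) * (z ^ Suc (level t (fst s)) -
          slotgf t z / (2 * of_nat n - 1)) / gmean (Suc n) z) = 0"
        using N0 by (simp add: sum_divide_distrib[symmetric] sum_distrib_left[symmetric] sum_subtractf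
          sum_slots_port[OF t] del: power_Suc)
    qed
    also have "a n + C * b n = a (Suc n)" using step by (simp add: a_def algebra_simps)
    finally show ?case .
  qed
  show ?thesis
  proof (rule exI[of _ "1 + C * suminf b"], rule exI[of _ r], intro conjI r allI impI)
    have "0 \<le> suminf b" using sb[of 1] by simp
    then show "0 < 1 + C * suminf b" using C(1) by (intro add_pos_nonneg) auto
    fix n :: nat and z :: complex
    assume n: "1 \<le> n" and z: "norm (z - 1) \<le> r"
    have "norm (z - 1) \<le> 1 / 8" using z r by simp
    then have "norm (gmean n z) > 0" using norm_gmean_ge[OF n] n by fastforce
    define g where "g = norm (gmean n z)"
    have g: "g > 0" using \<open>norm (gmean n z) > 0\<close> by (simp add: g_def)
    have "expect n (\<lambda>t. norm (slotgf t z) ^ (2 * Suc q)) =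
        expect n (\<lambda>t. (g\<^sup>2) ^ Suc q * norm (slotgf t z / gmean n z) ^ (2 * Suc q))"
      using g by (intro expectation_random_port_cong[OF n])
        (simp only: norm_divide power_divide power_mult[symmetric] g_def[symmetric], simp)
    also have "\<dots> \<le> (g\<^sup>2) ^ Suc q * a n ^ Suc q"
      unfolding integral_mult_right_zero using main[OF n z] by (intro mult_left_mono) auto
    also have "\<dots> = (a n * g\<^sup>2) ^ Suc q" by (simp only: power_mult_distrib mult.commute)
    also have "\<dots> \<le> ((1 + C * suminf b) * g\<^sup>2) ^ Suc q"
      using a[of n] sb[of n] C(1) unfolding a_def
      by (intro power_mono mult_right_mono add_left_mono mult_left_mono) (auto intro: mult_nonneg_nonneg less_imp_le)
    finally show "expect n (\<lambda>t. norm (slotgf t z) ^ (2 * Suc q)) \<le> ((1 + C * suminf b) * (norm (gmean n z))\<^sup>2) ^ Suc q"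
      by (simp only: g_def)
  qed
qed

section \<open>The polynomial on the unit circle away from 1\<close>

lemma norm_gf_le:
  fixes z :: complex
  assumes "norm z \<le> 1"
  shows "norm (gf t z) \<le> length (nodes t)"
proof (induction t)
  case (PTree a ts)
  have "norm (\<Sum>t\<leftarrow>ts'. gf t z) \<le> (\<Sum>t\<leftarrow>ts'. real (length (nodes t)))" if "set ts' \<subseteq> set ts" for ts'
    using that
  proof (induction ts')
    case (Cons s ts')
    then show ?case using PTree.IH[of s] norm_triangle_ineq[of "gf s z" "\<Sum>t\<leftarrow>ts'. gf t z"] by simp
  qed simp
  moreover have "(\<Sum>t\<leftarrow>ts. real (length (nodes t))) = real (length (concat (map nodes ts)))"
    by (induction ts) auto
  ultimately have *: "norm (\<Sum>t\<leftarrow>ts. gf t z) \<le> real (length (concat (map nodes ts)))" by force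
  have "norm (gf (PTree a ts) z) \<le> 1 + norm z * norm (\<Sum>t\<leftarrow>ts. gf t z)"
    using norm_triangle_ineq[of 1 "z * (\<Sum>t\<leftarrow>ts. gf t z)"] by (simp add: norm_mult)
  also have "\<dots> \<le> 1 + norm (\<Sum>t\<leftarrow>ts. gf t z)" using assms by (simp add: mult_left_le_one_le)
  finally show ?case using * by simp
qed

text \<open>For |z| = 1 and x = Re z the quotient is |2 n + z|^2 / (2 n - 1)^2, the squared growth
  factor of one step. The factor 1 + 1 / n^2 pays for the additive shift by \<open>1 / N'\<close> in
  \<open>moment_far\<close>.\<close>

lemma far_factor:
  fixes x \<kappa> n :: real
  assumes n: "n \<ge> 1" and x: "x \<le> \<kappa>" "\<kappa> \<le> 1" "-1 \<le> \<kappa>"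
  shows "(4 * n\<^sup>2 + 4 * n * x + 1) / (2 * n - 1)\<^sup>2 * (1 + 1 / n\<^sup>2) \<le> 1 + (1 + \<kappa>) / n + 15 / n\<^sup>2"
proof -
  have N: "2 * n - 1 > 0" using n by simp
  have N2: "4 * n\<^sup>2 / (2 * n - 1)\<^sup>2 \<le> 1 + 3 / n"
  proof -
    have "4 * n\<^sup>2 * n \<le> (n + 3) * (2 * n - 1)\<^sup>2"
    proof -
      have "(n + 3) * (2 * n - 1)\<^sup>2 - 4 * n\<^sup>2 * n = (n - 1) * (8 * n - 3)"
        by (simp add: power2_eq_square algebra_simps)
      moreover have "(n - 1) * (8 * n - 3) \<ge> 0" using n by (intro mult_nonneg_nonneg) auto
      ultimately show ?thesis by linarith
    qed
    then show ?thesis using n N by (simp add: field_simps)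
  qed
  have "(4 * n\<^sup>2 + 4 * n * x + 1) / (2 * n - 1)\<^sup>2 \<le> (4 * n\<^sup>2 + 4 * n * \<kappa> + 1) / (2 * n - 1)\<^sup>2"
    using n x by (intro divide_right_mono) auto
  also have "\<dots> = 1 + (1 + \<kappa>) / n * (4 * n\<^sup>2 / (2 * n - 1)\<^sup>2)"
  proof -
    have "4 * n\<^sup>2 + 4 * n * \<kappa> + 1 = (2 * n - 1)\<^sup>2 + (1 + \<kappa>) * (4 * n)"
      by (simp add: power2_eq_square algebra_simps)
    moreover have "(1 + \<kappa>) / n * (4 * n\<^sup>2) = (1 + \<kappa>) * (4 * n)" using n by (simp add: power2_eq_square)
    ultimately show ?thesis using N by (simp add: add_divide_distrib)
  qed
  also have "\<dots> \<le> 1 + (1 + \<kappa>) / n * (1 + 3 / n)"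
    using N2 n x by (intro add_left_mono mult_left_mono) auto
  also have "\<dots> = 1 + (1 + \<kappa>) / n + 3 * (1 + \<kappa>) / n\<^sup>2"
    using n by (simp add: power2_eq_square algebra_simps)
  also have "\<dots> \<le> 1 + (1 + \<kappa>) / n + 6 / n\<^sup>2"
    using n x by (intro add_left_mono divide_right_mono) auto
  finally have le: "(4 * n\<^sup>2 + 4 * n * x + 1) / (2 * n - 1)\<^sup>2 \<le> 1 + (1 + \<kappa>) / n + 6 / n\<^sup>2" .
  have n1: "1 / n\<^sup>2 \<le> 1" "1 / n \<le> 1" using n by (auto simp: field_simps)
  have "(4 * n\<^sup>2 + 4 * n * x + 1) / (2 * n - 1)\<^sup>2 * (1 + 1 / n\<^sup>2) \<le> (1 + (1 + \<kappa>) / n + 6 / n\<^sup>2) * (1 + 1 / n\<^sup>2)"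
    using le by (intro mult_right_mono) auto
  also have "\<dots> = 1 + (1 + \<kappa>) / n + 6 / n\<^sup>2 + (1 + (1 + \<kappa>) / n + 6 / n\<^sup>2) / n\<^sup>2"
    by (simp add: algebra_simps add_divide_distrib)
  also have "\<dots> \<le> 1 + (1 + \<kappa>) / n + 6 / n\<^sup>2 + (1 + 2 + 6) / n\<^sup>2"
  proof -
    have "(1 + \<kappa>) / n \<le> 2 / 1" using n x by (intro frac_le) auto
    moreover have "6 / n\<^sup>2 \<le> 6" using n1 by simp
    ultimately show ?thesis by (intro add_left_mono divide_right_mono add_mono) auto
  qed
  finally show ?thesis by simp
qed

text \<open>The exponent is the midpoint between \<open>1 + \<kappa>\<close>, the rate of the growth
  factor, and 2. The gap below it absorbs the errors and the additive constant; the gap above it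
  makes the polynomial of smaller order than \<open>n\<close>.\<close>

lemma far_growth:
  fixes \<kappa> c :: real
  assumes \<kappa>: "1 / 2 \<le> \<kappa>" "\<kappa> < 1" and c: "c \<ge> 0" and \<theta>: "\<theta> = (3 + \<kappa>) / 2"
  shows "\<exists>N\<ge>1. \<forall>n\<ge>N. (1 + (1 + \<kappa>) / real n + 15 / (real n)\<^sup>2) * real n powr \<theta> + c \<le> real (Suc n) powr \<theta>"
proof -
  define \<eta> where "\<eta> = (1 - \<kappa>) / 2"
  have \<eta>: "\<eta> > 0" "\<theta> = 1 + \<kappa> + \<eta>" using \<kappa> by (auto simp: \<eta>_def \<theta> field_simps)
  \<comment> \<open>The first threshold makes \<open>15 / x\<close> at most
    \<open>\<eta> / 2\<close>, the second makes \<open>c\<close> at most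
    \<open>\<eta> / 2 * sqrt x\<close>.\<close>
  define B where "B = max (30 / \<eta>) ((2 * c / \<eta>)\<^sup>2)"
  obtain N where N: "real N \<ge> B" using real_arch_simple by blast
  show ?thesis
  proof (intro exI[of _ "max 1 N"] conjI allI impI)
    fix n assume n: "max 1 N \<le> n"
    define x where "x = real n"
    have x: "x \<ge> 1" "x \<ge> 30 / \<eta>" "x \<ge> (2 * c / \<eta>)\<^sup>2"
      using n N by (auto simp: x_def B_def)
    have "2 * c / \<eta> \<le> sqrt x" using x(3) by (rule real_le_rsqrt)
    also have "\<dots> = x powr (1 / 2)" using x by (simp add: powr_half_sqrt)
    also have "\<dots> \<le> x powr (\<theta> - 1)" using x \<kappa> by (intro powr_mono) (auto simp: \<theta>)
    finally have "c \<le> \<eta> / 2 * x powr (\<theta> - 1)" using \<eta> by (simp add: field_simps)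
    also have "\<dots> \<le> (\<eta> - 15 / x) * x powr (\<theta> - 1)"
      using x \<eta> by (intro mult_right_mono) (auto simp: field_simps)
    also have "x powr (\<theta> - 1) = x powr \<theta> / x" using x by (simp add: powr_diff)
    also have "(\<eta> - 15 / x) * (x powr \<theta> / x) = (\<eta> / x - 15 / x\<^sup>2) * x powr \<theta>"
      using x by (simp add: power2_eq_square field_simps)
    finally have "(1 + (1 + \<kappa>) / x + 15 / x\<^sup>2) * x powr \<theta> + c \<le>
        (1 + (1 + \<kappa>) / x + 15 / x\<^sup>2) * x powr \<theta> + (\<eta> / x - 15 / x\<^sup>2) * x powr \<theta>" by simp
    also have "\<dots> = x powr \<theta> * (1 + \<theta> * (1 / x))"
      unfolding \<eta>(2) by (simp add: algebra_simps add_divide_distrib)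
    also have "\<dots> \<le> x powr \<theta> * (1 + 1 / x) powr \<theta>"
      using x \<kappa> by (intro mult_left_mono one_plus_le_powr) (auto simp: \<theta>)
    also have "\<dots> = (x * (1 + 1 / x)) powr \<theta>" using x by (simp add: powr_mult)
    also have "x * (1 + 1 / x) = real (Suc n)" using x by (simp add: x_def field_simps)
    finally show "(1 + (1 + \<kappa>) / real n + 15 / (real n)\<^sup>2) * real n powr \<theta> + c \<le> real (Suc n) powr \<theta>"
      by (simp only: x_def)
  qed simp
qed

text \<open>Away from 1 the mean can be much smaller than the fluctuations, so dividing by it is
  useless. The recursion is run for \<open>gf\<close> itself: its conditional mean after one step is
  \<open>\<alpha> * gf t z - 1 / N'\<close> with |alpha|^2 close to 1 + (1 + Re z) / n, and its
  increments around this mean have modulus at most 2.\<close>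

lemma moment_far:
  assumes \<delta>: "0 < \<delta>" "\<delta> \<le> 1"
  shows "\<exists>K \<theta>. K > 0 \<and> 0 < \<theta> \<and> \<theta> < 2 \<and> (\<forall>n\<ge>1. \<forall>z::complex. norm z = 1 \<longrightarrow> norm (z - 1) \<ge> \<delta> \<longrightarrow>
    expect n (\<lambda>t. norm (gf t z) ^ (2 * Suc q)) \<le> (K * real n powr \<theta>) ^ Suc q)"
proof -
  define C where "C = 3 * step_const q + 1"
  have C1: "C \<ge> 1" using step_const_nonneg[of q] by (simp add: C_def)
  note C = C1 moment_step[where q = q, folded C_def]
  \<comment> \<open>On the unit circle |z - 1|^2 = 2 - 2 Re z, so this is the largest value of Re z
    at distance at least \<open>\<delta>\<close> from 1.\<close>
  define \<kappa> where "\<kappa> = 1 - \<delta>\<^sup>2 / 2"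
  define \<theta> where "\<theta> = (3 + \<kappa>) / 2"
  have "\<delta>\<^sup>2 \<le> 1" using \<delta> by (simp add: power_le_one)
  then have \<kappa>: "1 / 2 \<le> \<kappa>" "\<kappa> < 1" using \<delta> by (auto simp: \<kappa>_def)
  define A where "A n = 1 + (1 + \<kappa>) / real n + 15 / (real n)\<^sup>2" for n
  have A: "A n > 0" if "n \<ge> 1" for n using that \<kappa> unfolding A_def by (intro add_pos_nonneg) auto
  \<comment> \<open>\<open>2 + 4 * C\<close> is what one step adds: 2 from the shift in the
    conditional mean and \<open>C * 4\<close> from increments of modulus at most 2.\<close>
  obtain N where N: "N \<ge> 1" "\<And>n. n \<ge> N \<Longrightarrow> A n * real n powr \<theta> + (2 + 4 * C) \<le> real (Suc n) powr \<theta>"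
    using far_growth[OF \<kappa> _ \<theta>_def, of "2 + 4 * C"] C1 unfolding A_def by auto
  \<comment> \<open>Up to \<open>N\<close> nodes the trivial bound \<open>norm_gf_le\<close>
    suffices.\<close>
  define K where "K = (real N)\<^sup>2"
  have K: "K \<ge> 1" using N(1) by (simp add: K_def)
  have \<theta>: "\<theta> > 0" "\<theta> < 2" using \<kappa> by (auto simp: \<theta>_def)
  have small: "expect n (\<lambda>t. norm (gf t z) ^ (2 * Suc q)) \<le> (K * real n powr \<theta>) ^ Suc q"
    if n: "n \<ge> 1" "n \<le> N" and z: "norm z = 1" for n and z :: complex
  proof -
    have "expect n (\<lambda>t. norm (gf t z) ^ (2 * Suc q)) \<le> expect n (\<lambda>t. (K * real n powr \<theta>) ^ Suc q)"
    proof (rule expectation_random_port_mono[OF n(1)])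
      fix t assume t: "port n t"
      have "norm (gf t z) \<le> real N" using norm_gf_le[of z t] z port_nodes(3)[OF t] n by simp
      then have "norm (gf t z) ^ (2 * Suc q) \<le> real N ^ (2 * Suc q)" by (intro power_mono) auto
      also have "\<dots> = K ^ Suc q" by (simp only: K_def power_mult)
      also have "\<dots> \<le> (K * real n powr \<theta>) ^ Suc q"
      proof (rule power_mono)
        have "1 \<le> real n powr \<theta>" using n \<theta> by (intro ge_one_powr_ge_zero) auto
        then show "K \<le> K * real n powr \<theta>" using K by simp
      qed (use K in simp)
      finally show "norm (gf t z) ^ (2 * Suc q) \<le> (K * real n powr \<theta>) ^ Suc q" .
    qed
    then show ?thesis by simp
  qed
  have main: "expect n (\<lambda>t. norm (gf t z) ^ (2 * Suc q)) \<le> (K * real n powr \<theta>) ^ Suc q"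
    if n: "n \<ge> N" and z: "norm z = 1" "norm (z - 1) \<ge> \<delta>" for n and z :: complex
    using n
  proof (induction n rule: dec_induct)
    case base
    then show ?case using small[OF N(1) order_refl z(1)] .
  next
    case (step n)
    have n: "n \<ge> 1" using step N by simp
    define a where "a = K * real n powr \<theta>"
    have a: "a > 0" using K n by (simp add: a_def)
    define x where "x = real n"
    have x: "x \<ge> 1" using n by (simp add: x_def)
    define N' where "N' = 2 * x - 1"
    have N': "N' \<ge> 1" using x by (simp add: N'_def)
    have ofN: "2 * of_nat n - 1 = (of_real N' :: complex)" by (simp add: N'_def x_def)
    define \<alpha> where "\<alpha> = (2 * of_nat n + z) / of_real N'"
    have Re: "Re z \<le> \<kappa>"
    proof -
      have z2: "(Re z)\<^sup>2 + (Im z)\<^sup>2 = 1" using z(1) cmod_power2[of z] by simp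
      have "\<delta>\<^sup>2 \<le> (norm (z - 1))\<^sup>2" using z \<delta> by (intro power_mono) auto
      also have "\<dots> = 2 - 2 * Re z" unfolding cmod_power2 using z2 by (simp add: power2_eq_square algebra_simps)
      finally show ?thesis by (simp add: \<kappa>_def)
    qed
    have \<alpha>: "(norm \<alpha>)\<^sup>2 * (1 + 1 / x\<^sup>2) \<le> A n"
    proof -
      have z2: "(Re z)\<^sup>2 + (Im z)\<^sup>2 = 1" using z(1) cmod_power2[of z] by simp
      have "(norm (2 * of_nat n + z))\<^sup>2 = 4 * x\<^sup>2 + 4 * x * Re z + 1"
        unfolding cmod_power2 using z2 by (simp add: x_def power2_eq_square algebra_simps)
      moreover have "(norm \<alpha>)\<^sup>2 = (norm (2 * of_nat n + z))\<^sup>2 / N'\<^sup>2"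
        by (simp add: \<alpha>_def norm_divide power_divide)
      ultimately have "(norm \<alpha>)\<^sup>2 = (4 * x\<^sup>2 + 4 * x * Re z + 1) / (2 * x - 1)\<^sup>2"
        by (simp only: N'_def)
      then show ?thesis using far_factor[OF x Re] \<kappa> by (simp add: A_def x_def)
    qed
    have "expect (Suc n) (\<lambda>t. norm (gf t z) ^ (2 * Suc q)) \<le> ((A n * a + 2) + C * 4) ^ Suc q"
    proof (rule C(2)[where Z = "\<lambda>t. gf t z + slotgf t z / of_real N'"
          and d = "\<lambda>t s. z ^ Suc (level t (fst s)) - slotgf t z / of_real N'"])
      show "n \<ge> 1" "A n * a + 2 > 0" "(4::real) > 0" using n a A[OF n] by (auto intro: add_pos_pos)
    next
      fix t v i assume "port n t" "(v, i) \<in> slots t"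
      then show "gf (attach (Suc n) v i t) z = gf t z + slotgf t z / of_real N' +
          (z ^ Suc (level t (fst (v, i))) - slotgf t z / of_real N')"
        by (simp add: gf_attach_port(1))
    next
      fix t assume t: "port n t"
      have "of_nat (card (slots t)) = (of_real N' :: complex)"
        using arg_cong[OF real_card_slots[OF t], of complex_of_real] by (simp add: N'_def x_def)
      then show "(\<Sum>s\<in>slots t. z ^ Suc (level t (fst s)) - slotgf t z / of_real N') = 0"
        using N' by (simp add: sum_subtractf sum_slots_port[OF t] del: power_Suc)
    next
      have "expect n (\<lambda>t. norm (gf t z + slotgf t z / of_real N') ^ (2 * Suc q))
          \<le> expect n (\<lambda>t. (A n * (norm (gf t z))\<^sup>2 + 2) ^ Suc q)"
      proof (rule expectation_random_port_mono[OF n])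
        fix t
        have "gf t z + slotgf t z / of_real N' = \<alpha> * gf t z - 1 / of_real N'"
        proof -
          have "\<alpha> = 1 + (1 + z) / of_real N'"
          proof -
            have "2 * of_nat n + z = of_real N' + (1 + z)" by (simp add: N'_def x_def)
            then show ?thesis unfolding \<alpha>_def using N' by (simp add: add_divide_distrib)
          qed
          then show ?thesis by (simp add: slotgf_def algebra_simps diff_divide_distrib)
        qed
        then have "norm (gf t z + slotgf t z / of_real N') \<le> norm \<alpha> * norm (gf t z) + 1 / N'"
          using norm_triangle_ineq4[of "\<alpha> * gf t z" "1 / of_real N'"] N' by (simp add: norm_mult norm_divide)
        then have "(norm (gf t z + slotgf t z / of_real N'))\<^sup>2 \<le> (norm \<alpha> * norm (gf t z) + 1 / N')\<^sup>2"
          by (intro power_mono) auto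
        \<comment> \<open>(u + v)^2 <= u^2 (1 + 1 / x^2) + v^2 (1 + x^2): the factor on the large
          term is harmless in the product over all steps, and the second term stays bounded because
          v = 1 / N' is of order 1 / x.\<close>
        also have "\<dots> \<le> (norm \<alpha> * norm (gf t z))\<^sup>2 * (1 + 1 / x\<^sup>2) + (1 / N')\<^sup>2 * (1 + x\<^sup>2)"
        proof -
          have "0 \<le> (norm \<alpha> * norm (gf t z) / x - 1 / N' * x)\<^sup>2" by simp
          also have "\<dots> = (norm \<alpha> * norm (gf t z))\<^sup>2 * (1 / x\<^sup>2) + (1 / N')\<^sup>2 * x\<^sup>2 - 2 * (norm \<alpha> * norm (gf t z)) * (1 / N')"
            using x by (simp add: power2_diff power_divide power_mult_distrib)
          finally show ?thesis by (simp add: power2_sum distrib_left)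
        qed
        also have "\<dots> \<le> A n * (norm (gf t z))\<^sup>2 + 2"
        proof (rule add_mono)
          show "(norm \<alpha> * norm (gf t z))\<^sup>2 * (1 + 1 / x\<^sup>2) \<le> A n * (norm (gf t z))\<^sup>2"
            using mult_right_mono[OF \<alpha>, of "(norm (gf t z))\<^sup>2"] by (simp add: power_mult_distrib mult.commute mult.left_commute)
          have "0 \<le> (7 * x - 1) * (x - 1)" using x by (intro mult_nonneg_nonneg) auto
          then have "1 + x\<^sup>2 \<le> 2 * N'\<^sup>2" by (simp add: N'_def power2_eq_square algebra_simps)
          then show "(1 / N')\<^sup>2 * (1 + x\<^sup>2) \<le> 2" using N' by (simp add: power_divide field_simps)
        qed
        finally have "((norm (gf t z + slotgf t z / of_real N'))\<^sup>2) ^ Suc q \<le> (A n * (norm (gf t z))\<^sup>2 + 2) ^ Suc q"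
          by (intro power_mono) auto
        then show "norm (gf t z + slotgf t z / of_real N') ^ (2 * Suc q) \<le> (A n * (norm (gf t z))\<^sup>2 + 2) ^ Suc q"
          by (simp only: power_mult)
      qed
      also have "\<dots> \<le> (A n * a + 2) ^ Suc q"
      proof (rule moment_shift[OF n])
        show "A n * a > 0" using A[OF n] a by simp
        show "A n * (norm (gf t z))\<^sup>2 \<ge> 0" for t using A[OF n] by simp
        have "expect n (\<lambda>t. (A n * (norm (gf t z))\<^sup>2) ^ Suc q) = A n ^ Suc q * expect n (\<lambda>t. norm (gf t z) ^ (2 * Suc q))"
          unfolding integral_mult_right_zero[symmetric] power_mult_distrib power_mult ..
        also have "\<dots> \<le> A n ^ Suc q * a ^ Suc q"
          using step.IH A[OF n] unfolding a_def by (intro mult_left_mono) auto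
        finally show "expect n (\<lambda>t. (A n * (norm (gf t z))\<^sup>2) ^ Suc q) \<le> (A n * a) ^ Suc q"
          by (simp only: power_mult_distrib)
      qed simp
      finally show "expect n (\<lambda>t. norm (gf t z + slotgf t z / of_real N') ^ (2 * Suc q)) \<le> (A n * a + 2) ^ Suc q" .
    next
      have "expect n (\<lambda>t. (\<Sum>s\<in>slots t. norm (z ^ Suc (level t (fst s)) - slotgf t z / of_real N') ^ (2 * Suc q)) / (2 * real n - 1))
        \<le> expect n (\<lambda>t. 4 ^ Suc q)"
      proof (rule expectation_random_port_mono[OF n])
        fix t assume t: "port n t"
        have card: "real (card (slots t)) = N'" using real_card_slots[OF t] by (simp add: N'_def x_def)
        have nz: "norm (z ^ k) = 1" for k using z(1) by (simp add: norm_power)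
        have "norm (slotgf t z) \<le> (\<Sum>s\<in>slots t. norm (z ^ Suc (level t (fst s))))"
          unfolding sum_slots_port[OF t, symmetric] by (rule norm_sum)
        also have "\<dots> = N'" by (simp only: nz sum_constant card mult_1_right)
        finally have "norm (slotgf t z / of_real N') \<le> 1" using N' by (simp add: norm_divide)
        then have d: "norm (z ^ Suc (level t (fst s)) - slotgf t z / of_real N') \<le> 2" for s :: "nat \<times> nat"
          using norm_triangle_ineq4[of "z ^ Suc (level t (fst s))" "slotgf t z / of_real N'"] nz[of "Suc (level t (fst s))"] by linarith
        have "(\<Sum>s\<in>slots t. norm (z ^ Suc (level t (fst s)) - slotgf t z / of_real N') ^ (2 * Suc q))
            \<le> (\<Sum>s\<in>slots t. 2 ^ (2 * Suc q))"
          by (intro sum_mono power_mono d) auto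
        also have "\<dots> = N' * 4 ^ Suc q" by (simp only: sum_constant card power_mult) simp
        finally show "(\<Sum>s\<in>slots t. norm (z ^ Suc (level t (fst s)) - slotgf t z / of_real N') ^ (2 * Suc q)) / (2 * real n - 1) \<le> 4 ^ Suc q"
          using N' unfolding N'_def x_def by (simp add: field_simps)
      qed
      then show "expect n (\<lambda>t. (\<Sum>s\<in>slots t. norm (z ^ Suc (level t (fst s)) - slotgf t z / of_real N') ^ (2 * Suc q)) / (2 * real n - 1))
        \<le> 4 ^ Suc q" by simp
    qed
    also have "\<dots> \<le> (K * real (Suc n) powr \<theta>) ^ Suc q"
    proof (rule power_mono)
      have "A n * a + 2 + C * 4 \<le> K * (A n * real n powr \<theta>) + K * (2 + 4 * C)"
        using mult_right_mono[OF K, of "2 + 4 * C"] C1 by (simp add: a_def algebra_simps)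
      also have "\<dots> \<le> K * real (Suc n) powr \<theta>"
        using N(2)[of n] step K by (simp add: distrib_left[symmetric])
      finally show "A n * a + 2 + C * 4 \<le> K * real (Suc n) powr \<theta>" .
    qed (use A[OF n] a C1 in simp)
    finally show ?case .
  qed
  show ?thesis
  proof (rule exI[of _ K], rule exI[of _ \<theta>], intro conjI \<theta> allI impI)
    show "0 < K" using K by simp
    fix n :: nat and z :: complex
    assume "1 \<le> n" "norm z = 1" "\<delta> \<le> norm (z - 1)"
    then show "expect n (\<lambda>t. norm (gf t z) ^ (2 * Suc q)) \<le> (K * real n powr \<theta>) ^ Suc q"
      using small[of n z] main[of n z] by (cases "n \<le> N") auto
  qed
qed

section \<open>Cauchy estimates on circles\<close>

lemma continuous_circlepath: "continuous_on {0..1} (circlepath z r)"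
  using path_circlepath by (simp add: path_def)

lemma norm_circlepath_diff:
  assumes "r \<ge> 0"
  shows "norm (circlepath z r x - z) = r"
proof -
  have "2 * of_real pi * \<i> * of_real x = \<i> * of_real (2 * pi * x)" by simp
  then have "norm (exp (2 * of_real pi * \<i> * of_real x)) = 1"
    by (metis norm_exp_i_times)
  then show ?thesis using assms by (simp add: circlepath norm_mult)
qed

lemma integrable_on_circlepath:
  fixes f :: "complex \<Rightarrow> 'a::banach"
  assumes "continuous_on (sphere z r) f" "r \<ge> 0"
  shows "(\<lambda>x. f (circlepath z r x)) integrable_on {0..1}"
    "continuous_on {0..1} (\<lambda>x. f (circlepath z r x))"
proof -
  show c: "continuous_on {0..1} (\<lambda>x. f (circlepath z r x))"
    using continuous_circlepath
    by (rule continuous_on_compose2[OF assms(1)])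
       (auto simp: dist_norm norm_minus_commute[of z] norm_circlepath_diff assms(2))
  show "(\<lambda>x. f (circlepath z r x)) integrable_on {0..1}"
    using c by (rule integrable_continuous_real)
qed

text \<open>Cauchy's formula with the mean of the modulus over the circle in place of its maximum.
  For random \<open>f\<close>, moment bounds at single points pass to the mean but not to the
  maximum.\<close>

lemma norm_taylor_coeff_le:
  assumes f: "f holomorphic_on ball z \<rho>" and r: "0 < r" "r < \<rho>"
  shows "norm ((deriv ^^ k) f z / fact k) \<le> integral {0..1} (\<lambda>x. norm (f (circlepath z r x))) / r ^ k"
proof -
  have cont: "continuous_on (cball z r) f"
    using f r by (intro holomorphic_on_imp_continuous_on holomorphic_on_subset[OF f]) auto
  have hol: "f holomorphic_on ball z r" using f r by (elim holomorphic_on_subset) auto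
  have "((\<lambda>u. f u / (u - z) ^ Suc k) has_contour_integral (2 * pi * \<i> / fact k * (deriv ^^ k) f z)) (circlepath z r)"
    by (rule Cauchy_has_contour_integral_higher_derivative_circlepath[OF cont hol]) (use r in simp)
  then have int: "((\<lambda>x. f (circlepath z r x) / (circlepath z r x - z) ^ Suc k *
      vector_derivative (circlepath z r) (at x within {0..1})) has_integral (2 * pi * \<i> / fact k * (deriv ^^ k) f z)) {0..1}"
    by (simp add: has_contour_integral_def)
  have gint: "(\<lambda>x. 2 * pi / r ^ k * norm (f (circlepath z r x))) integrable_on {0..1}"
    using r continuous_on_subset[OF cont, of "sphere z r"]
    by (intro integrable_on_mult_right integrable_on_circlepath(1) continuous_on_norm) auto
  have "norm (2 * pi * \<i> / fact k * (deriv ^^ k) f z) \<le>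
      integral {0..1} (\<lambda>x. 2 * pi / r ^ k * norm (f (circlepath z r x)))"
    unfolding integral_unique[OF int, symmetric]
  proof (rule Henstock_Kurzweil_Integration.integral_norm_bound_integral[OF _ gint])
    show "(\<lambda>x. f (circlepath z r x) / (circlepath z r x - z) ^ Suc k *
      vector_derivative (circlepath z r) (at x within {0..1})) integrable_on {0..1}"
      using int by (rule has_integral_integrable)
    fix x :: real assume x: "x \<in> {0..1}"
    have "norm (vector_derivative (circlepath z r) (at x within {0..1})) = 2 * pi * r"
    proof -
      have "vector_derivative (circlepath z r) (at x within {0..1}) = 2 * of_real pi * \<i> * (circlepath z r x - z)"
      proof -
        have "circlepath z r x - z = of_real r * exp (2 * of_real pi * \<i> * of_real x)"
          by (simp add: circlepath)
        then show ?thesis using vector_derivative_circlepath01[of x z r] x by simp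
      qed
      then show ?thesis using r by (simp add: norm_mult norm_circlepath_diff)
    qed
    then show "norm (f (circlepath z r x) / (circlepath z r x - z) ^ Suc k *
      vector_derivative (circlepath z r) (at x within {0..1})) \<le> 2 * pi / r ^ k * norm (f (circlepath z r x))"
      using r by (simp add: norm_mult norm_divide norm_power norm_circlepath_diff mult_ac)
  qed
  also have "\<dots> = 2 * pi * (integral {0..1} (\<lambda>x. norm (f (circlepath z r x))) / r ^ k)" by simp
  also have "norm (2 * pi * \<i> / fact k * (deriv ^^ k) f z) = 2 * pi * norm ((deriv ^^ k) f z / fact k)"
    by (simp add: norm_mult norm_divide)
  finally have *: "2 * pi * norm ((deriv ^^ k) f z / fact k) \<le>
      2 * pi * (integral {0..1} (\<lambda>x. norm (f (circlepath z r x))) / r ^ k)" .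
  show ?thesis by (rule mult_left_le_imp_le[OF *]) simp
qed

text \<open>From degree 2 on, the power series is dominated by a geometric series with ratio at most
  1/2; hence the factor 2.\<close>

lemma taylor_second_order:
  assumes f: "f holomorphic_on ball z \<rho>" and r: "0 < r" "r < \<rho>"
    and w: "norm (w - z) \<le> r / 2" and R: "R = integral {0..1} (\<lambda>x. norm (f (circlepath z r x)))"
  shows "norm (f w - f z - deriv f z * (w - z)) \<le> 2 * R / r\<^sup>2 * (norm (w - z))\<^sup>2"
    "norm (deriv f z) \<le> R / r"
proof -
  define c where "c k = (deriv ^^ k) f z / fact k" for k
  define u where "u = norm (w - z)"
  have c: "norm (c k) \<le> R / r ^ k" for k
    unfolding c_def R by (rule norm_taylor_coeff_le[OF f r])
  have R0: "R \<ge> 0" using order_trans[OF norm_ge_zero c[of 0]] by simp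
  show "norm (deriv f z) \<le> R / r" using c[of 1] by (simp add: c_def)
  have q: "0 \<le> u / r" "u / r \<le> 1 / 2" using w r by (auto simp: u_def field_simps)
  have nq: "norm (u / r) < 1" unfolding real_norm_def abs_of_nonneg[OF q(1)] using q(2) by linarith
  have "w \<in> ball z \<rho>" using w r by (simp add: dist_norm norm_minus_commute)
  then have s: "(\<lambda>k. c k * (w - z) ^ k) sums f w"
    unfolding c_def by (rule holomorphic_power_series[OF f])
  have "(\<Sum>k<2. c k * (w - z) ^ k) = f z + deriv f z * (w - z)" by (simp add: c_def numeral_2_eq_2)
  then have s2: "(\<lambda>k. c (k + 2) * (w - z) ^ (k + 2)) sums (f w - (f z + deriv f z * (w - z)))"
    using sums_split_initial_segment[OF s, of 2] by simp
  have g: "(\<lambda>k. R * (u / r)\<^sup>2 * (u / r) ^ k) sums (R * (u / r)\<^sup>2 * (1 / (1 - u / r)))"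
    using nq by (intro sums_mult geometric_sums)
  have "norm (suminf (\<lambda>k. c (k + 2) * (w - z) ^ (k + 2))) \<le> suminf (\<lambda>k. R * (u / r)\<^sup>2 * (u / r) ^ k)"
  proof (rule norm_suminf_le)
    fix k
    have "norm (c (k + 2) * (w - z) ^ (k + 2)) \<le> R / r ^ (k + 2) * u ^ (k + 2)"
      unfolding norm_mult norm_power u_def[symmetric] using c[of "k + 2"] by (intro mult_right_mono) (auto simp: u_def)
    also have "\<dots> = R * (u / r)\<^sup>2 * (u / r) ^ k"
      by (simp add: power_divide power_add power2_eq_square)
    finally show "norm (c (k + 2) * (w - z) ^ (k + 2)) \<le> R * (u / r)\<^sup>2 * (u / r) ^ k" .
  qed (use g sums_summable in blast)
  then have "norm (f w - (f z + deriv f z * (w - z))) \<le> R * (u / r)\<^sup>2 * (1 / (1 - u / r))"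
    using sums_unique[OF s2] sums_unique[OF g] by simp
  also have "\<dots> \<le> R * (u / r)\<^sup>2 * 2"
  proof (rule mult_left_mono)
    have "1 / 2 \<le> 1 - u / r" "0 < 1 - u / r" using q by linarith+
    then have "1 / (1 - u / r) \<le> 1 / (1 / 2)" by (intro divide_left_mono) auto
    then show "1 / (1 - u / r) \<le> 2" by simp
  qed (use R0 in simp)
  also have "\<dots> = 2 * R / r\<^sup>2 * u\<^sup>2" by (simp add: power_divide)
  finally show "norm (f w - f z - deriv f z * (w - z)) \<le> 2 * R / r\<^sup>2 * (norm (w - z))\<^sup>2"
    by (simp add: u_def diff_diff_eq)
qed

lemma power_integral_le:
  fixes f :: "real \<Rightarrow> real"
  assumes f: "continuous_on {0..1} f" "\<And>x. x \<in> {0..1} \<Longrightarrow> f x \<ge> 0"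
  shows "(integral {0..1} f) ^ Suc k \<le> integral {0..1} (\<lambda>x. f x ^ Suc k)"
proof -
  define c where "c = integral {0..1} f"
  have int: "f integrable_on {0..1}" "(\<lambda>x. f x ^ Suc k) integrable_on {0..1}"
    by (intro integrable_continuous_real continuous_on_power f(1))+
  have c: "c \<ge> 0" unfolding c_def by (rule Henstock_Kurzweil_Integration.integral_nonneg[OF int(1)]) (use f in auto)
  have "integral {0..1} (\<lambda>x. c ^ Suc k + real (Suc k) * c ^ k * (f x - c)) \<le> integral {0..1} (\<lambda>x. f x ^ Suc k)"
    using int by (intro integral_le power_above_tangent f c) (auto intro!: integrable_add integrable_on_mult_right integrable_diff)
  also have "integral {0..1} (\<lambda>x. c ^ Suc k + real (Suc k) * c ^ k * (f x - c)) = c ^ Suc k"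
  proof -
    have "((\<lambda>x. c ^ Suc k + real (Suc k) * c ^ k * (f x - c)) has_integral
        (c ^ Suc k * 1 + real (Suc k) * c ^ k * (c - c * 1))) {0..1}"
      using integrable_integral[OF int(1)] has_integral_const_real[of "1::real" 0 1]
        has_integral_const_real[of "c" 0 1] has_integral_const_real[of "c ^ Suc k" 0 1]
      by (intro has_integral_add has_integral_mult_right has_integral_diff) (auto simp: c_def)
    then show ?thesis by (simp add: integral_unique)
  qed
  finally show ?thesis by (simp only: c_def)
qed

section \<open>Moments of means over circles\<close>

lemma expect_eq_sum:
  assumes "n \<ge> 1"
  shows "expect n f = (\<Sum>t | port n t. f t) / card {t. port n t}"
  unfolding random_port_def
  using port_exists[OF assms] finite_port by (subst integral_pmf_of_set) auto

text \<open>Jensen's inequality on the circle, followed by an exchange of the integral with a finite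
  average over trees.\<close>

lemma expect_integral_power_le:
  fixes h :: "ptree \<Rightarrow> real \<Rightarrow> real"
  assumes n: "n \<ge> 1" and h: "\<And>t. continuous_on {0..1} (h t)" "\<And>t x. h t x \<ge> 0"
    and B: "\<And>x. x \<in> {0..1} \<Longrightarrow> expect n (\<lambda>t. h t x ^ Suc k) \<le> B"
  shows "expect n (\<lambda>t. (integral {0..1} (h t)) ^ Suc k) \<le> B"
proof -
  define c where "c = real (card {t. port n t})"
  have int: "(\<lambda>x. h t x ^ Suc k) integrable_on {0..1}" for t
    by (rule integrable_continuous_real, rule continuous_on_power, rule h(1))
  have "expect n (\<lambda>t. (integral {0..1} (h t)) ^ Suc k) \<le> expect n (\<lambda>t. integral {0..1} (\<lambda>x. h t x ^ Suc k))"
    by (intro expectation_random_port_mono[OF n] power_integral_le h)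
  also have "\<dots> = integral {0..1} (\<lambda>x. expect n (\<lambda>t. h t x ^ Suc k))"
    unfolding expect_eq_sum[OF n] c_def[symmetric]
    by (subst integral_divide, subst integral_sum) (use int finite_port in auto)
  also have "\<dots> \<le> integral {0..1} (\<lambda>x::real. B)"
  proof (rule integral_le)
    show "(\<lambda>x. expect n (\<lambda>t. h t x ^ Suc k)) integrable_on {0..1}"
      unfolding expect_eq_sum[OF n] by (intro integrable_on_divide integrable_sum) (use int finite_port in auto)
  qed (use B in auto)
  finally show ?thesis by simp
qed

section \<open>Upper bound for the mean near 1\<close>

lemma abs_log_increment:
  fixes x :: real
  assumes "x \<ge> 1"
  shows "\<bar>1 / (2 * x + 1) - ln (1 + 1 / x) / 2\<bar> \<le> 1 / (2 * x * (2 * x + 1))"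
proof -
  have "ln (1 + 1 / x) \<le> 1 / x" by (rule ln_add_one_self_le_self) (use assms in auto)
  moreover have "ln (1 + 1 / x) \<ge> 1 / (x + 1)"
  proof -
    have "ln (1 + (- 1 / (x + 1))) \<le> - 1 / (x + 1)"
      using assms by (intro ln_add_one_self_le_self2) (auto simp: field_simps)
    moreover have "1 + (- 1 / (x + 1)) = inverse (1 + 1 / x)" using assms by (simp add: field_simps)
    ultimately show ?thesis using assms by (simp add: ln_inverse)
  qed
  moreover have "1 / (2 * x + 1) - (1 / x) / 2 = - (1 / (2 * x * (2 * x + 1)))"
    using assms by (simp add: field_simps)
  moreover have "1 / (2 * x + 1) - (1 / (x + 1)) / 2 \<le> 1 / (2 * x * (2 * x + 1))"
  proof -
    have "1 / (2 * x + 1) - (1 / (x + 1)) / 2 = 1 / ((2 * x + 2) * (2 * x + 1))"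
      using assms by (simp add: field_simps)
    also have "\<dots> \<le> 1 / (2 * x * (2 * x + 1))"
      using assms by (intro divide_left_mono mult_right_mono mult_pos_pos) auto
    finally show ?thesis .
  qed
  moreover have "l \<le> c \<Longrightarrow> b \<le> l \<Longrightarrow> a - c / 2 = - d \<Longrightarrow> a - b / 2 \<le> d \<Longrightarrow> \<bar>a - l / 2\<bar> \<le> d"
    for a b c d l :: real
    by linarith
  ultimately show ?thesis by blast
qed

lemma norm_one_plus_le_exp: "norm (1 + v) \<le> exp (Re v + (norm v)\<^sup>2 / 2)"
proof (rule power2_le_imp_le)
  have "(norm (1 + v))\<^sup>2 = 1 + (2 * Re v + (norm v)\<^sup>2)"
    unfolding cmod_power2 by (simp add: power2_eq_square algebra_simps)
  also have "\<dots> \<le> exp (2 * Re v + (norm v)\<^sup>2)" by (rule exp_ge_add_one_self)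
  also have "\<dots> = (exp (Re v + (norm v)\<^sup>2 / 2))\<^sup>2" by (simp add: exp_double[symmetric] algebra_simps)
  finally show "(norm (1 + v))\<^sup>2 \<le> (exp (Re v + (norm v)\<^sup>2 / 2))\<^sup>2" .
qed simp

text \<open>With v = (z - 1) / (2 j + 1) the factors are (2 j + 1) / (2 j - 1) times 1 + v. The
  first part telescopes to 2 n - 1, and Re v adds up to ln n / 2 times Re (z - 1). The error of step
  j is at most 1 / (j (j + 1)), which telescopes as well; this is the term
  \<open>1 - 1 / real n\<close> carried through the induction.\<close>

lemma norm_gmean_le:
  fixes z :: complex
  assumes n: "n \<ge> 1" and z: "norm (z - 1) \<le> 1 / 8"
  shows "norm (gmean n z) \<le> 12 * real n * exp (ln (real n) / 2 * Re (z - 1))"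
proof -
  define u where "u = z - 1"
  have u: "norm u \<le> 1" using z by (simp add: u_def)
  have "norm (gmean n z) \<le> norm z * (2 * real n - 1) * exp (ln (real n) / 2 * Re u + (1 - 1 / real n))"
    using n
  proof (induction n rule: dec_induct)
    case base
    then show ?case by (simp add: gmean_1)
  next
    case (step n)
    define x where "x = real n"
    have x: "x \<ge> 1" using step by (simp add: x_def)
    define v where "v = u / of_real (2 * x + 1)"
    have N: "2 * of_nat n - 1 = (of_real (2 * x - 1) :: complex)" by (simp add: x_def)
    have "(2 * of_nat n + z) = of_real (2 * x + 1) * (1 + v)"
    proof -
      have "c * (1 + u / c) = c + u" if "c \<noteq> 0" for c by (simp add: distrib_left that)
      moreover have "of_real (2 * x + 1) \<noteq> (0 :: complex)" unfolding of_real_eq_0_iff using x by simp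
      ultimately have "of_real (2 * x + 1) * (1 + v) = of_real (2 * x + 1) + u"
        unfolding v_def by blast
      then show ?thesis by (simp add: u_def x_def)
    qed
    then have "norm ((2 * of_nat n + z) / (2 * of_nat n - 1)) = (2 * x + 1) / (2 * x - 1) * norm (1 + v)"
      unfolding N norm_divide using x by (simp only: norm_mult norm_of_real) simp
    also have "\<dots> \<le> (2 * x + 1) / (2 * x - 1) * exp (ln (1 + 1 / x) / 2 * Re u + 1 / (x * (x + 1)))"
    proof (intro mult_left_mono order_trans[OF norm_one_plus_le_exp])
      have Rev: "Re v = Re u * (1 / (2 * x + 1))" unfolding v_def Re_divide_of_real by simp
      have "\<bar>Re u\<bar> \<le> 1" using abs_Re_le_cmod[of u] u by linarith
      then have "\<bar>Re u * (1 / (2 * x + 1) - ln (1 + 1 / x) / 2)\<bar> \<le> 1 * (1 / (2 * x * (2 * x + 1)))"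
        unfolding abs_mult by (intro mult_mono abs_log_increment x) auto
      then have 1: "Re v \<le> ln (1 + 1 / x) / 2 * Re u + 1 / (2 * x * (2 * x + 1))"
        unfolding Rev by (simp add: algebra_simps abs_le_iff)
      have "norm v = norm u / (2 * x + 1)" unfolding v_def norm_divide norm_of_real using x by simp
      also have "\<dots> \<le> 1 / (2 * x + 1)" using u x by (intro divide_right_mono) auto
      finally have "(norm v)\<^sup>2 \<le> (1 / (2 * x + 1))\<^sup>2" by (intro power_mono) auto
      also have "\<dots> \<le> 1 / (x * (x + 1))"
      proof -
        have "0 < x * (x + 1)" using x by (intro mult_pos_pos) auto
        moreover have "x * (x + 1) \<le> (2 * x + 1)\<^sup>2" using x by (simp add: power2_eq_square algebra_simps)
        ultimately show ?thesis unfolding power_divide by (intro frac_le) auto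
      qed
      finally have 2: "(norm v)\<^sup>2 / 2 \<le> 1 / (x * (x + 1)) / 2" by simp
      have "1 / (2 * x * (2 * x + 1)) \<le> 1 / (x * (x + 1) * 2)"
      proof (rule divide_left_mono)
        show "x * (x + 1) * 2 \<le> 2 * x * (2 * x + 1)" using x by (simp add: algebra_simps)
        show "0 < 2 * x * (2 * x + 1) * (x * (x + 1) * 2)" using x by (intro mult_pos_pos) auto
      qed simp
      then have 3: "1 / (2 * x * (2 * x + 1)) \<le> 1 / (x * (x + 1)) / 2" by simp
      show "exp (Re v + (norm v)\<^sup>2 / 2) \<le> exp (ln (1 + 1 / x) / 2 * Re u + 1 / (x * (x + 1)))"
        unfolding exp_le_cancel_iff using 1 2 3 by linarith
    qed (use x in auto)
    finally have le: "norm ((2 * of_nat n + z) / (2 * of_nat n - 1)) \<le>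
        (2 * x + 1) / (2 * x - 1) * exp (ln (1 + 1 / x) / 2 * Re u + 1 / (x * (x + 1)))" .
    have "norm (gmean (Suc n) z) \<le> (norm z * (2 * x - 1) * exp (ln x / 2 * Re u + (1 - 1 / x))) *
        ((2 * x + 1) / (2 * x - 1) * exp (ln (1 + 1 / x) / 2 * Re u + 1 / (x * (x + 1))))"
      unfolding gmean_Suc[OF step.hyps(1)] norm_mult
      using step.IH le x unfolding x_def[symmetric] by (intro mult_mono) auto
    also have "\<dots> = norm z * (2 * x + 1) * (exp (ln x / 2 * Re u + (1 - 1 / x)) *
        exp (ln (1 + 1 / x) / 2 * Re u + 1 / (x * (x + 1))))"
      using x by simp
    also have "\<dots> = norm z * (2 * x + 1) * exp (ln (x + 1) / 2 * Re u + (1 - 1 / (x + 1)))"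
    proof -
      have "x + 1 = x * (1 + 1 / x)" using x by (simp add: field_simps)
      moreover have "1 + 1 / x > 0" using x by (intro add_pos_nonneg) auto
      ultimately have "ln (x + 1) = ln x + ln (1 + 1 / x)" using x by (simp add: ln_mult)
      moreover have "1 / (x * (x + 1)) = 1 / x - 1 / (x + 1)" using x by (simp add: field_simps)
      ultimately have "ln x / 2 * Re u + (1 - 1 / x) + (ln (1 + 1 / x) / 2 * Re u + 1 / (x * (x + 1)))
          = ln (x + 1) / 2 * Re u + (1 - 1 / (x + 1))"
        by (simp add: algebra_simps add_divide_distrib)
      then show ?thesis by (simp only: exp_add[symmetric])
    qed
    finally show ?case by (simp add: x_def add.commute)
  qed
  also have "\<dots> \<le> 2 * (2 * real n) * (exp (ln (real n) / 2 * Re u) * 3)"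
  proof (intro mult_mono)
    show "norm z \<le> 2" using norm_triangle_ineq[of 1 u] u by (simp add: u_def)
    have "exp (1 - 1 / real n) \<le> exp 1" using n by simp
    also have "\<dots> \<le> 3" by (rule exp_le)
    finally show "exp (ln (real n) / 2 * Re u + (1 - 1 / real n)) \<le> exp (ln (real n) / 2 * Re u) * 3"
      by (simp only: exp_add) simp
  qed (use n in auto)
  finally show ?thesis by (simp add: u_def)
qed

section \<open>Poisson weights as Fourier coefficients\<close>

lemma sin_ge_half:
  assumes "0 \<le> y" "y \<le> pi / 2"
  shows "y / 2 \<le> sin y"
proof -
  have "\<bar>sin y - (\<Sum>m<3. sin_coeff m * y ^ m)\<bar> \<le> inverse (fact 3) * \<bar>y\<bar> ^ 3"
    by (rule Maclaurin_sin_bound)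
  also have "(\<Sum>m<3. sin_coeff m * y ^ m) = y"
    by (simp add: sin_coeff_def eval_nat_numeral)
  finally have "\<bar>sin y - y\<bar> \<le> y ^ 3 / 6"
    using assms by (simp add: fact_numeral field_simps)
  then have s: "sin y \<ge> y - y ^ 3 / 6" by linarith
  have "pi \<le> 16 / 5" using pi_approx by simp
  then have "y \<le> 8 / 5" using assms by linarith
  then have "y\<^sup>2 \<le> (8 / 5)\<^sup>2" using assms by (intro power_mono) auto
  then have "y\<^sup>2 \<le> 3" by (simp add: power2_eq_square)
  then have "y * y\<^sup>2 \<le> y * 3" using assms by (intro mult_left_mono)
  then have "y ^ 3 \<le> 3 * y" by (simp add: power2_eq_square power3_eq_cube mult.assoc)
  then show ?thesis using s by linarith
qed

lemma norm_unit_circle_diff: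
  "(norm (circlepath 0 1 x - 1))\<^sup>2 = 4 * (sin (pi * x))\<^sup>2"
proof -
  have "circlepath 0 1 x = cis (2 * (pi * x))"
    by (simp add: circlepath cis_conv_exp mult_ac)
  then have "(norm (circlepath 0 1 x - 1))\<^sup>2 = (cos (2 * (pi * x)) - 1)\<^sup>2 + (sin (2 * (pi * x)))\<^sup>2"
    by (simp add: cmod_power2)
  also have "\<dots> = 2 - 2 * cos (2 * (pi * x))"
    using sin_cos_squared_add[of "2 * (pi * x)"] by (simp add: power2_eq_square algebra_simps)
  also have "cos (2 * (pi * x)) = 1 - 2 * (sin (pi * x))\<^sup>2" by (rule cos_double_sin)
  finally show ?thesis by simp
qed

text \<open>The path over \<open>{0..1}\<close> meets the point 1 at both ends, hence the two
  alternatives.\<close>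

lemma norm_unit_circle_ge:
  assumes "x \<in> {0..1}"
  shows "8 * x\<^sup>2 \<le> (norm (circlepath 0 1 x - 1))\<^sup>2 \<or> 8 * (1 - x)\<^sup>2 \<le> (norm (circlepath 0 1 x - 1))\<^sup>2"
proof -
  have *: "8 * y\<^sup>2 \<le> 4 * (sin (pi * y))\<^sup>2" if "0 \<le> y" "y \<le> 1 / 2" for y
  proof -
    have "pi * y \<le> pi * (1 / 2)" using that by (intro mult_left_mono) auto
    then have "pi * y / 2 \<le> sin (pi * y)" using that by (intro sin_ge_half) auto
    moreover have "3 * y / 2 \<le> pi * y / 2" using that pi_gt3 by (intro divide_right_mono mult_right_mono) auto
    ultimately have "(3 * y / 2)\<^sup>2 \<le> (sin (pi * y))\<^sup>2" using that by (intro power_mono) auto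
    then have "9 * y\<^sup>2 \<le> 4 * (sin (pi * y))\<^sup>2" by (simp add: power_divide power_mult_distrib)
    then show ?thesis using zero_le_power2[of y] by linarith
  qed
  show ?thesis
  proof (cases "x \<le> 1 / 2")
    case True
    then show ?thesis using *[of x] assms by (simp add: norm_unit_circle_diff)
  next
    case False
    have "sin (pi * (1 - x)) = sin (pi * x)" by (simp add: right_diff_distrib)
    then show ?thesis using *[of "1 - x"] False assms by (simp add: norm_unit_circle_diff)
  qed
qed

lemma mult_sqrt_eq_powr:
  fixes l :: real
  assumes "l > 0"
  shows "l * sqrt l = l powr (3 / 2)" "l powr (- 3 / 2) = 1 / (l * sqrt l)"
proof -
  have "l * sqrt l = l powr 1 * l powr (1 / 2)" using assms by (simp add: powr_half_sqrt)
  also have "\<dots> = l powr (3 / 2)" by (subst powr_add[symmetric]) simp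
  finally show e: "l * sqrt l = l powr (3 / 2)" .
  have "l powr (- 3 / 2) = inverse (l powr (3 / 2))" using powr_minus[of l "3 / 2"] by simp
  then show "l powr (- 3 / 2) = 1 / (l * sqrt l)" by (simp only: e divide_inverse mult_1_left)
qed

text \<open>The exponential is the modulus of exp (l (z - 1)) on the unit circle, and |z - 1|^2 is
  the size of a second-order remainder. The bound y exp (-y) <= 2 / (1 + y) replaces this Gaussian
  integral by one with antiderivative arctan, once for each end of the interval.\<close>

lemma kernel_integral_le:
  fixes l :: real
  assumes l: "l > 0"
  shows "integral {0..1} (\<lambda>x. (norm (circlepath 0 1 x - 1))\<^sup>2 * exp (- l * (norm (circlepath 0 1 x - 1))\<^sup>2 / 2))
    \<le> 8 * l powr (- 3 / 2)"
proof -
  \<comment> \<open>Then (a w)^2 = 4 l w^2, which is the lower bound for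
    \<open>y = l * s / 2\<close> when \<open>s\<close> is at least 8 w^2.\<close>
  define a where "a = 2 * sqrt l"
  have a: "a > 0" "a\<^sup>2 = 4 * l" using l by (auto simp: a_def power_mult_distrib)
  have I1: "((\<lambda>x. 1 / (1 + (a * x)\<^sup>2)) has_integral (arctan a / a)) {0..1}"
  proof -
    have "((\<lambda>x. 1 / (1 + (a * x)\<^sup>2)) has_integral (arctan (a * 1) / a - arctan (a * 0) / a)) {0..1}"
    proof (rule fundamental_theorem_of_calculus)
      fix x :: real
      have "((\<lambda>x. arctan (a * x) / a) has_real_derivative (inverse (1 + (a * x)\<^sup>2) * (a * 1)) / a) (at x within {0..1})"
        by (intro DERIV_cdivide DERIV_chain2[OF DERIV_arctan] DERIV_cmult DERIV_ident)
      then show "((\<lambda>x. arctan (a * x) / a) has_vector_derivative 1 / (1 + (a * x)\<^sup>2)) (at x within {0..1})"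
        using a(1) by (simp add: has_real_derivative_iff_has_vector_derivative divide_inverse mult.assoc)
    qed simp
    then show ?thesis by simp
  qed
  have I2: "((\<lambda>x. 1 / (1 + (a * (1 - x))\<^sup>2)) has_integral (arctan a / a)) {0..1}"
  proof -
    have "((\<lambda>x. 1 / (1 + (a * (1 - x))\<^sup>2)) has_integral (- arctan (a * (1 - 1)) / a - (- arctan (a * (1 - 0)) / a))) {0..1}"
    proof (rule fundamental_theorem_of_calculus)
      fix x :: real
      have "((\<lambda>x. - arctan (a * (1 - x)) / a) has_real_derivative (- (inverse (1 + (a * (1 - x))\<^sup>2) * (a * (0 - 1)))) / a) (at x within {0..1})"
        by (intro DERIV_cdivide DERIV_minus DERIV_chain2[OF DERIV_arctan] DERIV_cmult DERIV_diff DERIV_const DERIV_ident)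
      then show "((\<lambda>x. - arctan (a * (1 - x)) / a) has_vector_derivative 1 / (1 + (a * (1 - x))\<^sup>2)) (at x within {0..1})"
        using a(1) by (simp add: has_real_derivative_iff_has_vector_derivative divide_inverse mult.assoc)
    qed simp
    then show ?thesis by simp
  qed
  have pt: "s * exp (- l * s / 2) \<le> 4 / l * (1 / (1 + (a * x)\<^sup>2) + 1 / (1 + (a * (1 - x))\<^sup>2))"
    if x: "x \<in> {0..1}" and s: "s = (norm (circlepath 0 1 x - 1))\<^sup>2" for x s
  proof -
    define y where "y = l * s / 2"
    have y: "y \<ge> 0" using l by (simp add: y_def s)
    have "1 + y + y\<^sup>2 / 2 \<le> exp y" by (rule exp_lower_Taylor_quadratic[OF y])
    then have "y * (1 + y) \<le> 2 * exp y" using y by (simp add: power2_eq_square algebra_simps)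
    then have "y * exp (- y) \<le> 2 / (1 + y)" using y by (simp add: exp_minus field_simps)
    then have "2 / l * (y * exp (- y)) \<le> 2 / l * (2 / (1 + y))" using l by (intro mult_left_mono) auto
    then have 1: "s * exp (- l * s / 2) \<le> 4 / l * (1 / (1 + y))" using l by (simp add: y_def)
    have 2: "1 / (1 + y) \<le> 1 / (1 + (a * w)\<^sup>2)" if "8 * w\<^sup>2 \<le> s" for w
    proof -
      have "l / 2 * (8 * w\<^sup>2) \<le> l / 2 * s" using that l by (intro mult_left_mono) auto
      then have "(a * w)\<^sup>2 \<le> y" by (simp add: power_mult_distrib a(2) y_def)
      then show ?thesis by (intro divide_left_mono) (auto intro!: mult_pos_pos add_pos_nonneg y)
    qed
    have "1 / (1 + y) \<le> 1 / (1 + (a * x)\<^sup>2) + 1 / (1 + (a * (1 - x))\<^sup>2)"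
    proof -
      have nn: "0 \<le> 1 / (1 + (a * w)\<^sup>2)" for w by simp
      show ?thesis
        using norm_unit_circle_ge[OF x] 2[of x] 2[of "1 - x"] nn[of x] nn[of "1 - x"] unfolding s[symmetric]
        by linarith
    qed
    then have "4 / l * (1 / (1 + y)) \<le> 4 / l * (1 / (1 + (a * x)\<^sup>2) + 1 / (1 + (a * (1 - x))\<^sup>2))"
      using l by (intro mult_left_mono) auto
    with 1 show ?thesis by linarith
  qed
  have I: "((\<lambda>x. 4 / l * (1 / (1 + (a * x)\<^sup>2) + 1 / (1 + (a * (1 - x))\<^sup>2))) has_integral
      (4 / l * (arctan a / a + arctan a / a))) {0..1}"
    by (intro has_integral_mult_right has_integral_add I1 I2)
  have "integral {0..1} (\<lambda>x. (norm (circlepath 0 1 x - 1))\<^sup>2 * exp (- l * (norm (circlepath 0 1 x - 1))\<^sup>2 / 2))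
    \<le> 4 / l * (arctan a / a + arctan a / a)"
    unfolding integral_unique[OF I, symmetric]
  proof (rule integral_le)
    show "(\<lambda>x. (norm (circlepath 0 1 x - 1))\<^sup>2 * exp (- l * (norm (circlepath 0 1 x - 1))\<^sup>2 / 2)) integrable_on {0..1}"
      by (intro integrable_on_circlepath(1)[where f = "\<lambda>z. (norm (z - 1))\<^sup>2 * exp (- l * (norm (z - 1))\<^sup>2 / 2)"]
          continuous_intros) auto
    show "(\<lambda>x. 4 / l * (1 / (1 + (a * x)\<^sup>2) + 1 / (1 + (a * (1 - x))\<^sup>2))) integrable_on {0..1}"
      using I by (rule has_integral_integrable)
  qed (rule pt, auto)
  also have "\<dots> \<le> 4 / l * (2 / a + 2 / a)"
  proof -
    have "arctan a \<le> 2" using arctan_ubound[of a] pi_less_4 by linarith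
    then show ?thesis using l a by (intro mult_left_mono add_mono divide_right_mono) auto
  qed
  also have "\<dots> = 8 / (l * sqrt l)" using l by (simp add: a_def)
  also have "\<dots> = 8 * l powr (- 3 / 2)" unfolding mult_sqrt_eq_powr(2)[OF l] by simp
  finally show ?thesis .
qed

section \<open>Poisson weights and the coefficients of the model\<close>

definition pois :: "real \<Rightarrow> nat \<Rightarrow> real" where
  "pois l k = exp (- l) * l ^ k / fact k"

lemma pois_nonneg: "l \<ge> 0 \<Longrightarrow> pois l k \<ge> 0"
  by (simp add: pois_def)

lemma pois_le_1:
  assumes "l \<ge> 0"
  shows "pois l k \<le> 1"
proof -
  have s: "(\<lambda>k. l ^ k /\<^sub>R fact k) sums exp l" by (rule exp_converges)
  have "(\<Sum>j\<in>{k}. l ^ j /\<^sub>R fact j) \<le> exp l"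
    unfolding sums_unique[OF s] by (rule sum_le_suminf) (use s sums_summable assms in auto)
  then have "exp (- l) * (l ^ k /\<^sub>R fact k) \<le> exp (- l) * exp l" by (intro mult_left_mono) auto
  then show ?thesis by (simp add: pois_def exp_minus_inverse divide_inverse mult_ac)
qed

lemma pois_Suc: "l > 0 \<Longrightarrow> pois l (Suc k) * (real (Suc k) / l) = pois l k"
  by (simp add: pois_def field_simps del: of_nat_Suc)

text \<open>The tilt is unbounded in \<open>k\<close>, but \<open>pois l k * k / l\<close> is again
  a Poisson weight, namely that of \<open>k - 1\<close>, or zero for \<open>k = 0\<close>.\<close>

lemma abs_pois_tilt_le:
  assumes "l > 0"
  shows "\<bar>pois l k * (1 + \<xi> * (real k - l) / l)\<bar> \<le> 1 + \<bar>\<xi>\<bar>"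
proof -
  define p where "p = pois l k * (real k / l)"
  have p: "0 \<le> p" "p \<le> 1"
    using pois_Suc[OF assms] pois_nonneg[of l] pois_le_1[of l] assms
    by (cases k; force simp: p_def)+
  have q: "0 \<le> pois l k" "pois l k \<le> 1" using pois_nonneg pois_le_1 assms by auto
  have "pois l k * (1 + \<xi> * (real k - l) / l) = pois l k + \<xi> * (p - pois l k)"
    using assms by (simp add: p_def field_simps)
  moreover have "\<bar>\<xi> * (p - pois l k)\<bar> \<le> \<bar>\<xi>\<bar> * 1"
    unfolding abs_mult using p q by (intro mult_left_mono) auto
  ultimately show ?thesis using q by linarith
qed

lemma gf_has_fps_expansion:
  "(\<lambda>z. gf t z) has_fps_expansion Abs_fps (\<lambda>k. of_nat (profile t k) :: complex)"
proof (induction t)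
  case (PTree a ts)
  have "(\<lambda>z. \<Sum>t\<leftarrow>ts'. gf t z) has_fps_expansion (\<Sum>t\<leftarrow>ts'. Abs_fps (\<lambda>k. of_nat (profile t k) :: complex))"
    if "set ts' \<subseteq> set ts" for ts'
    using that by (induction ts') (auto intro!: has_fps_expansion_add PTree.IH)
  then have "(\<lambda>z. \<Sum>t\<leftarrow>ts. gf t z) has_fps_expansion (\<Sum>t\<leftarrow>ts. Abs_fps (\<lambda>k. of_nat (profile t k) :: complex))"
    by blast
  then have "(\<lambda>z. 1 + z * (\<Sum>t\<leftarrow>ts. gf t z)) has_fps_expansion
      1 + fps_X * (\<Sum>t\<leftarrow>ts. Abs_fps (\<lambda>k. of_nat (profile t k) :: complex))"
    by (intro has_fps_expansion_add has_fps_expansion_mult has_fps_expansion_1 has_fps_expansion_fps_X)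
  moreover have "1 + fps_X * (\<Sum>t\<leftarrow>ts. Abs_fps (\<lambda>k. of_nat (profile t k) :: complex)) =
      Abs_fps (\<lambda>k. of_nat (profile (PTree a ts) k))"
  proof (rule fps_ext)
    fix k
    have *: "fps_nth (\<Sum>t\<leftarrow>ts. Abs_fps (\<lambda>k. of_nat (profile t k) :: complex)) j = of_nat (\<Sum>t\<leftarrow>ts. profile t j)" for j
      by (induction ts) auto
    show "fps_nth (1 + fps_X * (\<Sum>t\<leftarrow>ts. Abs_fps (\<lambda>k. of_nat (profile t k) :: complex))) k =
      fps_nth (Abs_fps (\<lambda>k. of_nat (profile (PTree a ts) k))) k"
      by (cases k) (auto simp: *)
  qed
  ultimately show ?case by simp
qed

lemma holomorphic_gf: "(\<lambda>z. gf t z) holomorphic_on A"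
proof (induction t)
  case (PTree a ts)
  have "(\<lambda>z. \<Sum>t\<leftarrow>ts'. gf t z) holomorphic_on A" if "set ts' \<subseteq> set ts" for ts'
    using that by (induction ts') (auto intro!: holomorphic_intros PTree.IH)
  then show ?case by (auto intro!: holomorphic_intros)
qed

text \<open>exp (l (z - 1)) generates the Poisson weights, and multiplication by z shifts them to
  \<open>pois l (k - 1)\<close>, which is \<open>pois l k * k / l\<close>. So the factor
  \<open>z - 1\<close> turns into \<open>(k - l) / l\<close>.\<close>

lemma taylor_coeff_deviation:
  fixes l :: real and c :: complex
  assumes l: "l > 0"
  shows "(deriv ^^ k) (\<lambda>z::complex. gf t z - c * exp (of_real l * (z - 1)) * (1 + \<zeta> * (z - 1))) 0 / fact k =
    of_nat (profile t k) - c * of_real (pois l k) * (1 + \<zeta> * of_real ((real k - l) / l))"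
proof -
  define c' where "c' = c * exp (- of_real l)"
  define E where "E = fps_exp (of_real l :: complex)"
  have eq: "(\<lambda>z::complex. gf t z - c * exp (of_real l * (z - 1)) * (1 + \<zeta> * (z - 1))) =
    (\<lambda>z. gf t z - c' * ((1 - \<zeta>) * exp (of_real l * z) + \<zeta> * (z * exp (of_real l * z))))"
  proof (rule ext)
    fix z :: complex
    have "exp (of_real l * (z - 1)) = exp (- of_real l) * exp (of_real l * z)"
      by (simp add: exp_add[symmetric] algebra_simps)
    then show "gf t z - c * exp (of_real l * (z - 1)) * (1 + \<zeta> * (z - 1)) =
      gf t z - c' * ((1 - \<zeta>) * exp (of_real l * z) + \<zeta> * (z * exp (of_real l * z)))"
      by (simp add: c'_def algebra_simps)
  qed
  have "(\<lambda>z. gf t z - c' * ((1 - \<zeta>) * exp (of_real l * z) + \<zeta> * (z * exp (of_real l * z)))) has_fps_expansion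
    Abs_fps (\<lambda>k. of_nat (profile t k)) - fps_const c' * (fps_const (1 - \<zeta>) * E + fps_const \<zeta> * (fps_X * E))"
    unfolding E_def
    by (intro has_fps_expansion_diff gf_has_fps_expansion has_fps_expansion_cmult_left has_fps_expansion_add
        has_fps_expansion_mult has_fps_expansion_fps_X has_fps_expansion_exp)
  then have "(deriv ^^ k) (\<lambda>z::complex. gf t z - c * exp (of_real l * (z - 1)) * (1 + \<zeta> * (z - 1))) 0 / fact k =
    fps_nth (Abs_fps (\<lambda>k. of_nat (profile t k)) - fps_const c' * (fps_const (1 - \<zeta>) * E + fps_const \<zeta> * (fps_X * E))) k"
    unfolding eq by (rule fps_nth_fps_expansion[symmetric])
  also have "\<dots> = of_nat (profile t k) - c' * ((1 - \<zeta>) * (of_real l ^ k / fact k) +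
      \<zeta> * (of_real l ^ k / fact k * (of_nat k / of_real l)))"
  proof (cases k)
    case 0
    then show ?thesis by (simp add: E_def)
  next
    case (Suc j)
    have "x * a / (d * f) * (d / x) = a / f" if "d \<noteq> 0" "x \<noteq> 0" for x a d f :: complex
      using that by simp
    from this[of "of_nat (Suc j)" "of_real l" "of_real l ^ j" "fact j"] l
    have "of_real l ^ Suc j / fact (Suc j) * (of_nat (Suc j) / of_real l) = (of_real l ^ j / fact j :: complex)"
      unfolding power_Suc fact_Suc by (simp del: of_nat_Suc)
    moreover have "fps_nth (Abs_fps (\<lambda>k. of_nat (profile t k)) - fps_const c' * (fps_const (1 - \<zeta>) * E + fps_const \<zeta> * (fps_X * E))) (Suc j)
      = of_nat (profile t (Suc j)) - c' * ((1 - \<zeta>) * (of_real l ^ Suc j / fact (Suc j)) + \<zeta> * (of_real l ^ j / fact j))"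
      by (simp add: E_def del: power_Suc fact_Suc)
    ultimately show ?thesis unfolding Suc by (simp only:)
  qed
  also have "\<dots> = of_nat (profile t k) - c * of_real (pois l k) * (1 + \<zeta> * of_real ((real k - l) / l))"
  proof -
    define q r where "q = of_real l ^ k / (fact k :: complex)" and "r = of_nat k / (of_real l :: complex)"
    have "of_real (pois l k) = exp (- of_real l) * q"
    proof -
      have "exp (- of_real l :: complex) = of_real (exp (- l))"
        using exp_of_real[of "- l", where ?'a = complex] by simp
      then show ?thesis unfolding pois_def q_def by simp
    qed
    moreover have "of_real ((real k - l) / l) = r - 1"
      unfolding r_def using l by (simp add: diff_divide_distrib)
    moreover have "y - c * e * ((1 - \<zeta>) * q + \<zeta> * (q * r)) = y - c * (e * q) * (1 + \<zeta> * (r - 1))" for y e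
      by (simp add: algebra_simps)
    ultimately show ?thesis unfolding c'_def q_def[symmetric] r_def[symmetric] by (simp only:)
  qed
  finally show ?thesis .
qed

section \<open>Expansion of the profile\<close>

text \<open>By \<open>gf_eq_tiltgf\<close> this is the quotient of gf - 1 / (1 + z) by (n - 1/2) exp
  (l (z - 1)) with l = ln n / 2: a function holomorphic near 1 whose value at 1 is 1 for every PORT
  of \<open>n\<close> nodes.\<close>

definition tiltgf :: "nat \<Rightarrow> ptree \<Rightarrow> complex \<Rightarrow> complex" where
  "tiltgf n t z = 2 * slotgf t z * exp (- of_real (ln (real n) / 2) * (z - 1)) / ((2 * of_nat n - 1) * (1 + z))"

text \<open>By Cauchy's estimate this one random variable controls both the derivative of
  \<open>tiltgf\<close> at 1 and the remainder of second order.\<close>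

definition nearint :: "real \<Rightarrow> nat \<Rightarrow> ptree \<Rightarrow> real" where
  "nearint r n t = integral {0..1} (\<lambda>x. norm (tiltgf n t (circlepath 1 r x)))"

text \<open>A continuous substitute for the indicator function of \<open>|z - 1| > r / 2\<close>: at least 1 there, and
  zero where \<open>|z - 1| \<le> r / 4\<close>.\<close>

definition farwt :: "real \<Rightarrow> complex \<Rightarrow> real" where
  "farwt r z = max 0 (norm (z - 1) - r / 4) * (4 / r)"

definition farint :: "real \<Rightarrow> ptree \<Rightarrow> real" where
  "farint r t = integral {0..1} (\<lambda>x. norm (gf t (circlepath 0 1 x)) * farwt r (circlepath 0 1 x))"

lemma one_plus_nonzero: "norm (z - 1) < 2 \<Longrightarrow> 1 + z \<noteq> (0::complex)"
proof
  assume "norm (z - 1) < 2" "1 + z = 0"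
  moreover from this have "z = -1" by (simp add: add_eq_0_iff)
  ultimately show False by simp
qed

lemma of_nat_odd_nonzero: "n \<ge> 1 \<Longrightarrow> (2 * of_nat n - 1 :: complex) \<noteq> 0"
proof -
  assume "n \<ge> 1"
  then have "(of_real (2 * real n - 1) :: complex) \<noteq> 0" unfolding of_real_eq_0_iff by simp
  then show ?thesis by simp
qed

lemma holomorphic_slotgf: "(\<lambda>z. slotgf t z) holomorphic_on A"
  unfolding slotgf_def by (intro holomorphic_intros holomorphic_gf)

lemma holomorphic_tiltgf:
  assumes "n \<ge> 1"
  shows "tiltgf n t holomorphic_on ball 1 2"
proof -
  have "1 + z \<noteq> 0" if "z \<in> ball 1 2" for z :: complex
    using that one_plus_nonzero[of z] by (simp add: dist_norm norm_minus_commute)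
  then show ?thesis
    unfolding tiltgf_def using of_nat_odd_nonzero[OF assms]
    by (intro holomorphic_intros holomorphic_slotgf) auto
qed

lemma tiltgf_1: "port n t \<Longrightarrow> tiltgf n t 1 = 1"
  using of_nat_odd_nonzero[of n] port_nodes[of n t] by (simp add: tiltgf_def slotgf_def gf_1)

lemma gf_eq_tiltgf:
  assumes "n \<ge> 1" "1 + z \<noteq> 0"
  shows "gf t z = of_real (real n - 1 / 2) * exp (of_real (ln (real n) / 2) * (z - 1)) * tiltgf n t z + 1 / (1 + z)"
proof -
  define l where "l = (of_real (ln (real n) / 2) :: complex)"
  have h1: "exp (l * (z - 1)) * exp (- l * (z - 1)) = 1" by (simp add: exp_add[symmetric])
  have h2: "of_real (real n - 1 / 2) = (2 * of_nat n - 1) / (2 :: complex)" by (simp add: field_simps)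
  have h3: "c / 2 * e * (2 * X * e' / (c * d)) = X / d" if "c \<noteq> 0" "e * e' = 1" for c e X e' d :: complex
  proof -
    have "c / 2 * e * (2 * X * e' / (c * d)) = (e * e') * X / d" using that(1) by (simp add: field_simps)
    then show ?thesis using that(2) by simp
  qed
  have "of_real (real n - 1 / 2) * exp (l * (z - 1)) * tiltgf n t z = slotgf t z / (1 + z)"
    unfolding tiltgf_def l_def[symmetric] h2 by (rule h3[OF of_nat_odd_nonzero[OF assms(1)] h1])
  moreover have "gf t z = slotgf t z / (1 + z) + 1 / (1 + z)"
    using assms(2) by (simp add: slotgf_def add_divide_distrib[symmetric])
  ultimately show ?thesis by (simp only: l_def)
qed

lemma Re_diff_unit_circle:
  assumes "norm z = 1"
  shows "Re (z - 1) = - (norm (z - 1))\<^sup>2 / 2"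
proof -
  have "(Re z)\<^sup>2 + (Im z)\<^sup>2 = 1" using assms cmod_power2[of z] by simp
  then show ?thesis unfolding cmod_power2 by (simp add: power2_eq_square algebra_simps)
qed

text \<open>\<open>D\<close> is the polynomial minus its first-order model, and its coefficients are
  bounded by the mean of |D| over the unit circle. Near 1 the Taylor remainder of \<open>F\<close>
  leads to the kernel integral. Elsewhere the two parts are bounded separately: the polynomial by
  \<open>farint\<close>, the model by the factor exp (- l r^2 / 8).\<close>

lemma profile_deviation:
  assumes t: "port n t" and l: "l = ln (real n) / 2" "l > 0" and r: "0 < r" "r \<le> 1 / 8"
  shows "\<exists>\<xi>. \<bar>\<xi>\<bar> \<le> nearint r n t / r \<and>
    (\<forall>k. \<bar>real (profile t k) - (real n - 1 / 2) * (pois l k * (1 + \<xi> * (real k - l) / l))\<bar> \<le>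
      real n * (2 * nearint r n t / r\<^sup>2) * (8 * l powr (- 3 / 2)) + 1 + farint r t
      + real n * exp (- l * r\<^sup>2 / 8) * (1 + 2 * nearint r n t / r))"
proof -
  have n: "n \<ge> 1" by (rule port_nodes(4)[OF t])
  define R where "R = nearint r n t"
  define F where "F = tiltgf n t"
  define \<zeta> where "\<zeta> = deriv F 1"
  define c where "c = (of_real (real n - 1 / 2) :: complex)"
  define D where "D z = gf t z - c * exp (of_real l * (z - 1)) * (1 + \<zeta> * (z - 1))" for z
  have nc: "norm c \<le> real n" unfolding c_def norm_of_real using n by simp
  have F: "F holomorphic_on ball 1 2" "F 1 = 1"
    using holomorphic_tiltgf[OF n] tiltgf_1[OF t] by (simp_all add: F_def)
  have R: "R = integral {0..1} (\<lambda>x. norm (F (circlepath 1 r x)))" by (simp add: R_def nearint_def F_def)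
  have \<zeta>: "norm \<zeta> \<le> R / r"
    unfolding \<zeta>_def using taylor_second_order(2)[OF F(1) r(1) _ _ R, of 1] r by simp
  have R0: "R \<ge> 0" using order_trans[OF norm_ge_zero \<zeta>] r by (simp add: zero_le_divide_iff)
  have Dz: "norm (D z) \<le> real n * (2 * R / r\<^sup>2) * ((norm (z - 1))\<^sup>2 * exp (- l * (norm (z - 1))\<^sup>2 / 2))
      + 1 + norm (gf t z) * farwt r z + real n * exp (- l * r\<^sup>2 / 8) * (1 + 2 * R / r)"
    if z: "norm z = 1" for z
  proof -
    have ex: "norm (exp (of_real l * (z - 1))) = exp (- l * (norm (z - 1))\<^sup>2 / 2)"
      unfolding norm_exp_eq_Re using Re_diff_unit_circle[OF z] by (simp del: minus_complex.sel one_complex.sel)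
    have nn: "0 \<le> real n * (2 * R / r\<^sup>2) * ((norm (z - 1))\<^sup>2 * exp (- l * (norm (z - 1))\<^sup>2 / 2))"
      "0 \<le> norm (gf t z) * farwt r z" "0 \<le> real n * exp (- l * r\<^sup>2 / 8) * (1 + 2 * R / r)"
      using R0 r by (auto simp: farwt_def)
    show ?thesis
    proof (cases "norm (z - 1) \<le> r / 2")
      case True
      have z1: "1 \<le> norm (1 + z)" using norm_triangle_ineq2[of 2 "1 - z"] True r by (simp add: norm_minus_commute)
      then have nz: "1 + z \<noteq> 0" by auto
      \<comment> \<open>The fraction comes from the constant -1 in \<open>slotgf\<close>; near 1 its
        modulus is at most 1, which is the lone summand 1 of the bound.\<close>
      have "D z = c * exp (of_real l * (z - 1)) * (F z - F 1 - \<zeta> * (z - 1)) + 1 / (1 + z)"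
      proof -
        define e where "e = exp (of_real l * (z - 1))"
        have "gf t z = c * e * F z + 1 / (1 + z)"
          using gf_eq_tiltgf[OF n nz, of t] unfolding e_def c_def F_def l(1) .
        then show ?thesis unfolding D_def F(2) e_def[symmetric] by (simp add: algebra_simps)
      qed
      then have "norm (D z) \<le> norm c * norm (exp (of_real l * (z - 1))) * norm (F z - F 1 - \<zeta> * (z - 1)) + norm (1 / (1 + z))"
        by (metis norm_mult norm_triangle_ineq)
      also have "\<dots> \<le> real n * exp (- l * (norm (z - 1))\<^sup>2 / 2) * (2 * R / r\<^sup>2 * (norm (z - 1))\<^sup>2) + 1"
      proof (intro add_mono mult_mono)
        show "norm (F z - F 1 - \<zeta> * (z - 1)) \<le> 2 * R / r\<^sup>2 * (norm (z - 1))\<^sup>2"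
          unfolding \<zeta>_def by (rule taylor_second_order(1)[OF F(1) r(1) _ True R]) (use r in simp)
        show "norm (1 / (1 + z)) \<le> 1" using z1 by (simp add: norm_divide divide_le_eq)
      qed (use nc ex in auto)
      finally show ?thesis using nn by (simp add: mult_ac)
    next
      case False
      have "1 \<le> farwt r z"
      proof -
        have "r / 4 * (4 / r) \<le> max 0 (norm (z - 1) - r / 4) * (4 / r)"
          using False r by (intro mult_right_mono) auto
        moreover have "r / 4 * (4 / r) = 1" using r by simp
        ultimately show ?thesis by (simp only: farwt_def)
      qed
      then have 1: "norm (gf t z) \<le> norm (gf t z) * farwt r z" by (simp add: mult_le_cancel_left1)
      have "(r / 2)\<^sup>2 \<le> (norm (z - 1))\<^sup>2" using False r by (intro power_mono) auto
      then have "l * (r / 2)\<^sup>2 \<le> l * (norm (z - 1))\<^sup>2" using l by (intro mult_left_mono) auto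
      then have 2: "exp (- l * (norm (z - 1))\<^sup>2 / 2) \<le> exp (- l * r\<^sup>2 / 8)" by (simp add: power_divide)
      have "norm (1 + \<zeta> * (z - 1)) \<le> 1 + norm \<zeta> * norm (z - 1)"
        using norm_triangle_ineq[of 1 "\<zeta> * (z - 1)"] by (simp add: norm_mult)
      also have "\<dots> \<le> 1 + R / r * 2"
        using \<zeta> norm_triangle_ineq4[of z 1] z R0 r by (intro add_left_mono mult_mono) auto
      finally have 3: "norm (1 + \<zeta> * (z - 1)) \<le> 1 + 2 * R / r" by (simp add: mult_ac)
      have "norm (D z) \<le> norm (gf t z) + norm (c * exp (of_real l * (z - 1)) * (1 + \<zeta> * (z - 1)))"
        unfolding D_def by (rule norm_triangle_ineq4)
      also have "norm (c * exp (of_real l * (z - 1)) * (1 + \<zeta> * (z - 1))) \<le> real n * exp (- l * r\<^sup>2 / 8) * (1 + 2 * R / r)"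
        unfolding norm_mult ex using nc 2 3 by (intro mult_mono) auto
      finally show ?thesis using 1 nn(1) by linarith
    qed
  qed
  have Dhol: "D holomorphic_on ball 0 2"
    unfolding D_def by (intro holomorphic_intros holomorphic_gf)
  have Dk: "norm ((deriv ^^ k) D 0 / fact k) \<le>
      real n * (2 * R / r\<^sup>2) * (8 * l powr (- 3 / 2)) + 1 + farint r t
      + real n * exp (- l * r\<^sup>2 / 8) * (1 + 2 * R / r)" for k
  proof -
    let ?c = "circlepath 0 1"
    have i1: "(\<lambda>x. (norm (?c x - 1))\<^sup>2 * exp (- l * (norm (?c x - 1))\<^sup>2 / 2)) integrable_on {0..1}"
      by (intro integrable_on_circlepath(1)[where f = "\<lambda>z. (norm (z - 1))\<^sup>2 * exp (- l * (norm (z - 1))\<^sup>2 / 2)"]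
          continuous_intros) auto
    have i2: "(\<lambda>x. norm (gf t (?c x)) * farwt r (?c x)) integrable_on {0..1}"
      unfolding farwt_def
      by (intro integrable_on_circlepath(1)[where f = "\<lambda>z. norm (gf t z) * (max 0 (norm (z - 1) - r / 4) * (4 / r))"]
          continuous_intros holomorphic_on_imp_continuous_on holomorphic_gf) auto
    have "norm ((deriv ^^ k) D 0 / fact k) \<le> integral {0..1} (\<lambda>x. norm (D (?c x))) / 1 ^ k"
      by (rule norm_taylor_coeff_le[OF Dhol]) auto
    also have "\<dots> = integral {0..1} (\<lambda>x. norm (D (?c x)))" by simp
    also have "\<dots> \<le> integral {0..1} (\<lambda>x. real n * (2 * R / r\<^sup>2) * ((norm (?c x - 1))\<^sup>2 * exp (- l * (norm (?c x - 1))\<^sup>2 / 2))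
      + 1 + norm (gf t (?c x)) * farwt r (?c x) + real n * exp (- l * r\<^sup>2 / 8) * (1 + 2 * R / r))"
    proof (rule integral_le)
      show "(\<lambda>x. norm (D (?c x))) integrable_on {0..1}"
        by (rule integrable_on_circlepath(1)[where f = "\<lambda>z. norm (D z)"])
           (auto intro!: continuous_intros holomorphic_on_imp_continuous_on holomorphic_on_subset[OF Dhol])
      show "(\<lambda>x. real n * (2 * R / r\<^sup>2) * ((norm (?c x - 1))\<^sup>2 * exp (- l * (norm (?c x - 1))\<^sup>2 / 2))
      + 1 + norm (gf t (?c x)) * farwt r (?c x) + real n * exp (- l * r\<^sup>2 / 8) * (1 + 2 * R / r)) integrable_on {0..1}"
        by (intro integrable_add integrable_on_mult_right i1 i2) auto
      fix x :: real
      show "norm (D (?c x)) \<le> real n * (2 * R / r\<^sup>2) * ((norm (?c x - 1))\<^sup>2 * exp (- l * (norm (?c x - 1))\<^sup>2 / 2))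
      + 1 + norm (gf t (?c x)) * farwt r (?c x) + real n * exp (- l * r\<^sup>2 / 8) * (1 + 2 * R / r)"
        using norm_circlepath_diff[of 1 0 x] by (intro Dz) simp
    qed
    also have "\<dots> = real n * (2 * R / r\<^sup>2) * integral {0..1} (\<lambda>x. (norm (?c x - 1))\<^sup>2 * exp (- l * (norm (?c x - 1))\<^sup>2 / 2))
      + 1 + farint r t + real n * exp (- l * r\<^sup>2 / 8) * (1 + 2 * R / r)"
    proof -
      have "((\<lambda>x. real n * (2 * R / r\<^sup>2) * ((norm (?c x - 1))\<^sup>2 * exp (- l * (norm (?c x - 1))\<^sup>2 / 2))
      + 1 + norm (gf t (?c x)) * farwt r (?c x) + real n * exp (- l * r\<^sup>2 / 8) * (1 + 2 * R / r)) has_integral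
        real n * (2 * R / r\<^sup>2) * integral {0..1} (\<lambda>x. (norm (?c x - 1))\<^sup>2 * exp (- l * (norm (?c x - 1))\<^sup>2 / 2))
      + 1 * (1 - 0) + farint r t + real n * exp (- l * r\<^sup>2 / 8) * (1 + 2 * R / r) * (1 - 0)) {0..1}"
        using has_integral_const_real[of "1 :: real" 0 1]
          has_integral_const_real[of "real n * exp (- l * r\<^sup>2 / 8) * (1 + 2 * R / r)" 0 1]
        unfolding farint_def
        by (intro has_integral_add has_integral_mult_right integrable_integral i1 i2) (auto simp: mult_ac)
      then show ?thesis by (simp add: integral_unique)
    qed
    also have "\<dots> \<le> real n * (2 * R / r\<^sup>2) * (8 * l powr (- 3 / 2))
      + 1 + farint r t + real n * exp (- l * r\<^sup>2 / 8) * (1 + 2 * R / r)"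
      using kernel_integral_le[OF l(2)] R0 by (intro add_right_mono mult_left_mono) auto
    finally show ?thesis .
  qed
  show ?thesis
  \<comment> \<open>Profile and Poisson weights are real, so passing to real parts replaces the
    complex derivative by its real part.\<close>
  proof (intro exI[of _ "Re \<zeta>"] conjI allI)
    show "\<bar>Re \<zeta>\<bar> \<le> nearint r n t / r" using \<zeta> abs_Re_le_cmod[of \<zeta>] by (simp add: R_def)
    fix k
    have eq: "(deriv ^^ k) D 0 / fact k = of_nat (profile t k) - c * of_real (pois l k) * (1 + \<zeta> * of_real ((real k - l) / l))"
      unfolding D_def by (rule taylor_coeff_deviation[OF l(2)])
    have "Re ((deriv ^^ k) D 0 / fact k) = real (profile t k) - (real n - 1 / 2) * (pois l k * (1 + Re \<zeta> * (real k - l) / l))"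
    proof -
      have "c * of_real (pois l k) * (1 + \<zeta> * of_real ((real k - l) / l)) =
          of_real ((real n - 1 / 2) * pois l k) * (1 + of_real ((real k - l) / l) * \<zeta>)"
        by (simp only: c_def of_real_mult mult.commute[of \<zeta>])
      moreover have "Re (of_nat Y - of_real a * (1 + of_real b * \<zeta>)) = real Y - a * (1 + b * Re \<zeta>)" for Y a b
        by simp
      moreover have "(real n - 1 / 2) * pois l k * (1 + (real k - l) / l * Re \<zeta>) =
          (real n - 1 / 2) * (pois l k * (1 + Re \<zeta> * (real k - l) / l))"
        by (simp add: mult_ac)
      ultimately show ?thesis unfolding eq by (simp only:)
    qed
    then show "\<bar>real (profile t k) - (real n - 1 / 2) * (pois l k * (1 + Re \<zeta> * (real k - l) / l))\<bar> \<le>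
      real n * (2 * nearint r n t / r\<^sup>2) * (8 * l powr (- 3 / 2)) + 1 + farint r t
      + real n * exp (- l * r\<^sup>2 / 8) * (1 + 2 * nearint r n t / r)"
      using Dk[of k] abs_Re_le_cmod[of "(deriv ^^ k) D 0 / fact k"] unfolding R_def by linarith
  qed
qed

section \<open>Moments of the two circle means\<close>

lemma moment_nearint:
  assumes n: "n \<ge> 1" and r: "0 < r" "r \<le> 1 / 8" and K: "K > 0"
    and near: "\<And>z::complex. norm (z - 1) \<le> r \<Longrightarrow>
      expect n (\<lambda>t. norm (slotgf t z) ^ (2 * Suc q)) \<le> (K * (norm (gmean n z))\<^sup>2) ^ Suc q"
  shows "expect n (\<lambda>t. nearint r n t ^ (2 * Suc q)) \<le> (576 * K) ^ Suc q"
proof -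
  define l where "l = ln (real n) / 2"
  have z_le: "norm (circlepath 1 r x - 1) = r" for x using norm_circlepath_diff[of r 1 x] r by simp
  have "expect n (\<lambda>t. nearint r n t ^ Suc (2 * q + 1)) \<le> (576 * K) ^ Suc q"
    unfolding nearint_def
  proof (rule expect_integral_power_le[OF n])
    fix t
    have "continuous_on (sphere 1 r) (tiltgf n t)"
      by (rule holomorphic_on_imp_continuous_on, rule holomorphic_on_subset[OF holomorphic_tiltgf[OF n]])
         (use r in auto)
    then show "continuous_on {0..1} (\<lambda>x. norm (tiltgf n t (circlepath 1 r x)))"
      using r by (intro integrable_on_circlepath(2)[where f = "\<lambda>z. norm (tiltgf n t z)"] continuous_on_norm) auto
  next
    fix x :: real
    define z where "z = circlepath 1 r x"
    have z: "norm (z - 1) \<le> r" "norm (z - 1) \<le> 1 / 8" using z_le r by (simp_all add: z_def)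
    define e where "e = exp (- l * Re (z - 1))"
    have pt: "norm (tiltgf n t z) \<le> 2 / real n * e * norm (slotgf t z)" for t
    proof -
      have "1 \<le> norm (1 + z)" using norm_triangle_ineq2[of 2 "1 - z"] z by (simp add: norm_minus_commute)
      moreover have "norm (2 * of_nat n - 1 :: complex) = 2 * real n - 1"
      proof -
        have "norm (2 * of_nat n - 1 :: complex) = norm (of_real (2 * real n - 1) :: complex)" by simp
        then show ?thesis unfolding norm_of_real using n by simp
      qed
      ultimately have d: "real n \<le> norm ((2 * of_nat n - 1) * (1 + z))"
        unfolding norm_mult using n mult_mono[of "real n" "2 * real n - 1" 1 "norm (1 + z)"] by simp
      have "norm (tiltgf n t z) = 2 * norm (slotgf t z) * e / norm ((2 * of_nat n - 1) * (1 + z))"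
        unfolding tiltgf_def norm_divide e_def l_def norm_mult[of "2 * slotgf t z"] norm_exp_eq_Re norm_mult[of 2] by simp
      also have "\<dots> \<le> 2 * norm (slotgf t z) * e / real n"
        using d n by (intro divide_left_mono) (auto simp: e_def intro!: mult_pos_pos order.strict_trans2[OF _ d])
      finally show ?thesis by (simp add: mult_ac)
    qed
    have "expect n (\<lambda>t. norm (tiltgf n t z) ^ (2 * Suc q)) \<le>
        expect n (\<lambda>t. (2 / real n * e) ^ (2 * Suc q) * norm (slotgf t z) ^ (2 * Suc q))"
      unfolding power_mult_distrib[symmetric] by (intro expectation_random_port_mono[OF n] power_mono pt) auto
    also have "\<dots> = ((2 / real n * e)\<^sup>2) ^ Suc q * expect n (\<lambda>t. norm (slotgf t z) ^ (2 * Suc q))"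
      by (simp only: integral_mult_right_zero power_mult)
    also have "\<dots> \<le> ((2 / real n * e)\<^sup>2) ^ Suc q * (K * (norm (gmean n z))\<^sup>2) ^ Suc q"
      using near[OF z(1)] by (intro mult_left_mono) auto
    also have "\<dots> = ((2 / real n * e)\<^sup>2 * (K * (norm (gmean n z))\<^sup>2)) ^ Suc q"
      by (simp only: power_mult_distrib)
    also have "\<dots> \<le> ((2 / real n * e)\<^sup>2 * (K * (12 * real n * exp (l * Re (z - 1)))\<^sup>2)) ^ Suc q"
      using norm_gmean_le[OF n z(2)] K unfolding l_def
      by (intro power_mono mult_left_mono) auto
    \<comment> \<open>The exponential normalisation of \<open>tiltgf\<close> cancels the growth of
      \<open>gmean\<close>; 576 is the square of 2 * 12.\<close>
    also have "(2 / real n * e)\<^sup>2 * (K * (12 * real n * exp (l * Re (z - 1)))\<^sup>2) = 576 * K * (e * exp (l * Re (z - 1)))\<^sup>2"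
      using n by (simp add: power_mult_distrib power_divide)
    also have "e * exp (l * Re (z - 1)) = 1" by (simp add: e_def exp_add[symmetric])
    finally show "expect n (\<lambda>t. norm (tiltgf n t (circlepath 1 r x)) ^ Suc (2 * q + 1)) \<le> (576 * K) ^ Suc q"
      by (simp add: z_def)
  qed simp
  then show ?thesis by simp
qed

lemma moment_farint:
  assumes n: "n \<ge> 1" and r: "0 < r" "r \<le> 1 / 8" and K: "K > 0"
    and far: "\<And>z::complex. norm z = 1 \<Longrightarrow> norm (z - 1) \<ge> r / 4 \<Longrightarrow>
      expect n (\<lambda>t. norm (gf t z) ^ (2 * Suc q)) \<le> (K * real n powr \<theta>) ^ Suc q"
  shows "expect n (\<lambda>t. farint r t ^ (2 * Suc q)) \<le> (64 / r\<^sup>2 * K * real n powr \<theta>) ^ Suc q"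
proof -
  have "expect n (\<lambda>t. farint r t ^ Suc (2 * q + 1)) \<le> (64 / r\<^sup>2 * K * real n powr \<theta>) ^ Suc q"
    unfolding farint_def
  proof (rule expect_integral_power_le[OF n])
    fix t
    show "continuous_on {0..1} (\<lambda>x. norm (gf t (circlepath 0 1 x)) * farwt r (circlepath 0 1 x))"
      unfolding farwt_def
      by (intro integrable_on_circlepath(2)[where f = "\<lambda>z. norm (gf t z) * (max 0 (norm (z - 1) - r / 4) * (4 / r))"]
          continuous_intros holomorphic_on_imp_continuous_on holomorphic_gf) auto
    show "0 \<le> norm (gf t (circlepath 0 1 x)) * farwt r (circlepath 0 1 x)" for x
      using r by (simp add: farwt_def)
  next
    fix x :: real
    define z where "z = circlepath 0 1 x"
    have z: "norm z = 1" using norm_circlepath_diff[of 1 0 x] by (simp add: z_def)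
    have "expect n (\<lambda>t. (norm (gf t z) * farwt r z) ^ (2 * Suc q)) \<le> (64 / r\<^sup>2 * K * real n powr \<theta>) ^ Suc q"
    proof (cases "norm (z - 1) \<ge> r / 4")
      case True
      \<comment> \<open>On the unit circle |z - 1| <= 2, so the weight is at most 2 * (4 / r); its
        square is the 64 / r^2 of the bound.\<close>
      have w: "0 \<le> farwt r z" "farwt r z \<le> 8 / r"
      proof -
        have "max 0 (norm (z - 1) - r / 4) \<le> 2" using norm_triangle_ineq4[of z 1] z r by simp
        then have "farwt r z \<le> 2 * (4 / r)" unfolding farwt_def using r by (intro mult_right_mono) auto
        then show "farwt r z \<le> 8 / r" by simp
      qed (use r in \<open>simp add: farwt_def\<close>)
      have "expect n (\<lambda>t. (norm (gf t z) * farwt r z) ^ (2 * Suc q)) = ((farwt r z)\<^sup>2) ^ Suc q * expect n (\<lambda>t. norm (gf t z) ^ (2 * Suc q))"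
        unfolding power_mult_distrib integral_mult_left_zero power_mult by (rule mult.commute)
      also have "\<dots> \<le> ((8 / r)\<^sup>2) ^ Suc q * (K * real n powr \<theta>) ^ Suc q"
        using far[OF z True] w by (intro mult_mono power_mono integral_nonneg) auto
      also have "\<dots> = ((8 / r)\<^sup>2 * (K * real n powr \<theta>)) ^ Suc q" by (simp only: power_mult_distrib)
      also have "(8 / r)\<^sup>2 * (K * real n powr \<theta>) = 64 / r\<^sup>2 * K * real n powr \<theta>" by (simp add: power_divide)
      finally show ?thesis .
    next
      case False
      \<comment> \<open>The weight vanishes exactly where no moment bound is assumed.\<close>
      then have "farwt r z = 0" by (simp add: farwt_def)
      then show ?thesis using K by simp
    qed
    then show "expect n (\<lambda>t. (norm (gf t (circlepath 0 1 x)) * farwt r (circlepath 0 1 x)) ^ Suc (2 * q + 1))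
        \<le> (64 / r\<^sup>2 * K * real n powr \<theta>) ^ Suc q"
      by (simp add: z_def)
  qed
  then show ?thesis by simp
qed

section \<open>Stirling's formula and the Poisson peak\<close>

text \<open>The logarithm of n! / (n^(n + 1/2) exp (-n)). It decreases, while its difference with 1
  / (4 n) increases; the limit therefore comes with an explicit rate.\<close>

definition stirling :: "nat \<Rightarrow> real" where
  "stirling n = ln (fact n) - (real n + 1 / 2) * ln (real n) + real n"

text \<open>The midpoint and the trapezoidal bound for ln (n + 1) - ln n, regarded as an integral of
  1 / x.\<close>

lemma stirling_diff:
  assumes "n \<ge> 1"
  shows "0 \<le> stirling n - stirling (Suc n)"
    "stirling n - stirling (Suc n) \<le> 1 / 4 * (1 / real n - 1 / real (Suc n))"
proof -
  define x where "x = real n"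
  have x: "x \<ge> 1" using assms by (simp add: x_def)
  have "ln (fact (Suc n)) = ln (x + 1) + ln (fact n :: real)"
    unfolding fact_Suc by (subst ln_mult) (simp_all add: x_def add.commute)
  then have d: "stirling n - stirling (Suc n) = (x + 1 / 2) * (ln (x + 1) - ln x) - 1"
    by (simp add: stirling_def x_def algebra_simps)
  have "2 * (x + 1 - x) / (x + (x + 1)) \<le> ln (x + 1) - ln x"
    by (rule ln_inverse_approx_ge) (use x in auto)
  moreover have "2 * (x + 1 - x) / (x + (x + 1)) = 2 * 1 / (2 * x + 1)" by simp
  ultimately have "(x + 1 / 2) * (2 * 1 / (2 * x + 1)) \<le> (x + 1 / 2) * (ln (x + 1) - ln x)"
    using x by (intro mult_left_mono) auto
  moreover have "(x + 1 / 2) * (2 * 1 / (2 * x + 1)) = 1" using x by (simp add: field_simps)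
  ultimately show "0 \<le> stirling n - stirling (Suc n)" unfolding d by linarith
  have "(x + 1 / 2) * (ln (x + 1) - ln x) \<le> (x + 1 / 2) * (1 * (inverse x + inverse (x + 1)) / 2)"
    using x by (intro mult_left_mono ln_inverse_approx_le) auto
  also have "(x + 1 / 2) * (1 * (inverse x + inverse (x + 1)) / 2) = 1 + 1 / 4 * (1 / x - 1 / (x + 1))"
  proof -
    define w where "w = x * (x + 1)"
    have w: "w > 0" using x by (simp add: w_def)
    have i: "inverse x + inverse (x + 1) = (2 * x + 1) / w" "1 / x - 1 / (x + 1) = 1 / w"
      using x by (simp_all add: w_def field_simps)
    have "(x + 1 / 2) * (1 * ((2 * x + 1) / w) / 2) = ((x + 1 / 2) * (2 * x + 1) / 2) / w" by simp
    also have "(x + 1 / 2) * (2 * x + 1) / 2 = w + 1 / 4" by (simp add: w_def algebra_simps)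
    finally show ?thesis unfolding i using w by (simp add: add_divide_distrib)
  qed
  finally have up: "(x + 1 / 2) * (ln (x + 1) - ln x) \<le> 1 + 1 / 4 * (1 / x - 1 / (x + 1))" .
  have "real (Suc n) = x + 1" "real n = x" by (simp_all add: x_def)
  then show "stirling n - stirling (Suc n) \<le> 1 / 4 * (1 / real n - 1 / real (Suc n))"
    unfolding d using up by (simp only:)
qed

text \<open>Rewrites the Wallis product in factorials, so that its limit pi / 2 determines the
  constant in Stirling's formula.\<close>

lemma wallis_product:
  "(\<Prod>k=1..n. (4 * (real k)\<^sup>2) / (4 * (real k)\<^sup>2 - 1)) = 2 ^ (4 * n) * fact n ^ 4 / ((fact (2 * n))\<^sup>2 * (2 * real n + 1))"
proof (induction n)
  case (Suc n)
  define x where "x = real n"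
  have x: "x \<ge> 0" by (simp add: x_def)
  have f: "fact (2 * Suc n) = (2 * x + 2) * (2 * x + 1) * (fact (2 * n) :: real)"
    by (simp add: x_def algebra_simps)
  have g: "fact (Suc n) = (x + 1) * (fact n :: real)" by (simp add: x_def)
  have p: "(2::real) ^ (4 * Suc n) = 16 * 2 ^ (4 * n)" by (simp add: power_add)
  have nz: "2 * x + 1 \<noteq> 0" "2 * x + 2 \<noteq> 0" "2 * x + 3 \<noteq> 0" "x + 1 \<noteq> 0" "fact (2 * n) \<noteq> (0::real)"
    using x by (simp_all add: add_nonneg_eq_0_iff)
  have s: "4 * (real (Suc n))\<^sup>2 - 1 = (2 * x + 1) * (2 * x + 3)" "real (Suc n) = x + 1"
    by (simp_all add: x_def power2_eq_square algebra_simps)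
  have "prod f {1..Suc n} = prod f {1..n} * f (Suc n)" for f :: "nat \<Rightarrow> real" by simp
  then have "(\<Prod>k=1..Suc n. (4 * (real k)\<^sup>2) / (4 * (real k)\<^sup>2 - 1)) =
      2 ^ (4 * n) * fact n ^ 4 / ((fact (2 * n))\<^sup>2 * (2 * real n + 1)) * (4 * (real (Suc n))\<^sup>2 / (4 * (real (Suc n))\<^sup>2 - 1))"
    by (simp only: Suc)
  also have "\<dots> = 2 ^ (4 * n) * fact n ^ 4 / ((fact (2 * n))\<^sup>2 * (2 * x + 1)) * (4 * (x + 1)\<^sup>2 / ((2 * x + 1) * (2 * x + 3)))"
    unfolding s(1) unfolding s(2) by (simp only: x_def)
  also have "\<dots> = 2 ^ (4 * Suc n) * fact (Suc n) ^ 4 / ((fact (2 * Suc n))\<^sup>2 * (2 * x + 3))"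
  proof -
    have "a * b ^ 4 / (c\<^sup>2 * u) * (4 * w\<^sup>2 / (u * v)) = 16 * a * (w * b) ^ 4 / ((2 * w * u * c)\<^sup>2 * v)"
      if "u \<noteq> 0" "v \<noteq> 0" "c \<noteq> 0" "w \<noteq> 0" for a b c u v w :: real
      using that by (simp add: power2_eq_square power4_eq_xxxx divide_simps)
    from this[OF nz(1) nz(3) nz(5) nz(4), of "2 ^ (4 * n)" "fact n"]
    show ?thesis unfolding f g p by (simp add: algebra_simps)
  qed
  finally show ?case by (simp add: x_def algebra_simps)
qed simp

lemma stirling_bounds:
  assumes "n \<ge> 1"
  shows "ln (2 * pi) / 2 \<le> stirling n" "stirling n \<le> ln (2 * pi) / 2 + 1 / (4 * real n)"
proof -
  have dec: "stirling m \<le> stirling k" "stirling k - 1 / (4 * real k) \<le> stirling m - 1 / (4 * real m)"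
    if "1 \<le> k" "k \<le> m" for k m
  proof -
    show "stirling m \<le> stirling k" using that(2)
    proof (induction m rule: dec_induct)
      case (step m)
      then show ?case using stirling_diff(1)[of m] that(1) by simp
    qed simp
    show "stirling k - 1 / (4 * real k) \<le> stirling m - 1 / (4 * real m)" using that(2)
    proof (induction m rule: dec_induct)
      case (step m)
      have "1 / 4 * (1 / real m - 1 / real (Suc m)) = 1 / (4 * real m) - 1 / (4 * real (Suc m))"
        by (simp add: right_diff_distrib)
      then show ?case using stirling_diff(2)[of m] step that(1) by linarith
    qed simp
  qed
  define S where "S = lim (\<lambda>n. stirling (Suc n))"
  have "convergent (\<lambda>n. stirling (Suc n))"
  proof (rule Bseq_monoseq_convergent)
    have "decseq (\<lambda>n. stirling (Suc n))" unfolding decseq_def using dec(1) by auto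
    then show "monoseq (\<lambda>n. stirling (Suc n))" by (simp add: decseq_imp_monoseq)
    have "stirling 1 - 1 \<le> stirling (Suc n) \<and> stirling (Suc n) \<le> stirling 1" for n
    proof -
      have "0 \<le> 1 / (4 * real (Suc n))" by simp
      moreover have "stirling 1 - 1 / 4 \<le> stirling (Suc n) - 1 / (4 * real (Suc n))"
        using dec(2)[of 1 "Suc n"] by simp
      ultimately show ?thesis using dec(1)[of 1 "Suc n"] by linarith
    qed
    then have "\<bar>stirling (Suc n)\<bar> \<le> \<bar>stirling 1\<bar> + 1" for n by (smt (verit, best))
    then show "Bseq (\<lambda>n. stirling (Suc n))" by (intro BseqI'[of _ "\<bar>stirling 1\<bar> + 1"]) simp
  qed
  then have "(\<lambda>n. stirling (Suc n)) \<longlonglongrightarrow> S" unfolding S_def by (simp add: convergent_LIMSEQ_iff)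
  then have lim: "stirling \<longlonglongrightarrow> S" by (rule LIMSEQ_imp_Suc)
  have lim2: "(\<lambda>n. stirling (2 * n)) \<longlonglongrightarrow> S"
    by (rule filterlim_compose[OF lim]) (rule filterlim_subseq, auto simp: strict_mono_def)
  have "(\<lambda>n. ln (real n) - ln (2 * real n + 1)) \<longlonglongrightarrow> - ln 2"
    by real_asymp
  \<comment> \<open>This combination is the logarithm of the Wallis product; comparing its limit
    computed here with ln (pi / 2) determines \<open>S\<close>.\<close>
  then have A: "(\<lambda>n. 4 * stirling n - 2 * stirling (2 * n) - ln 2 + (ln (real n) - ln (2 * real n + 1)))
      \<longlonglongrightarrow> 4 * S - 2 * S - ln 2 + - ln 2"
    by (intro tendsto_intros lim lim2)
  have "(\<lambda>n. ln (\<Prod>k=1..n. (4 * (real k)\<^sup>2) / (4 * (real k)\<^sup>2 - 1))) \<longlonglongrightarrow> ln (pi / 2)"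
    by (intro tendsto_ln wallis) simp
  moreover have "\<forall>\<^sub>F n in sequentially. ln (\<Prod>k=1..n. (4 * (real k)\<^sup>2) / (4 * (real k)\<^sup>2 - 1)) =
      4 * stirling n - 2 * stirling (2 * n) - ln 2 + (ln (real n) - ln (2 * real n + 1))"
    using eventually_ge_at_top[of 1]
  proof eventually_elim
    case (elim n)
    have "ln (2 ^ (4 * n) * fact n ^ 4 / ((fact (2 * n))\<^sup>2 * (2 * real n + 1))) =
        ln (2 ^ (4 * n) :: real) + ln (fact n ^ 4) - (ln ((fact (2 * n))\<^sup>2) + ln (2 * real n + 1))"
      by (simp add: ln_div ln_mult add_pos_nonneg)
    also have "\<dots> = 4 * real n * ln 2 + 4 * ln (fact n) - 2 * ln (fact (2 * n)) - ln (2 * real n + 1)"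
      by (simp add: ln_realpow)
    finally show ?case
      unfolding wallis_product stirling_def using elim by (simp add: ln_mult algebra_simps)
  qed
  ultimately have "(\<lambda>n. 4 * stirling n - 2 * stirling (2 * n) - ln 2 + (ln (real n) - ln (2 * real n + 1)))
      \<longlonglongrightarrow> ln (pi / 2)"
    by (rule Lim_transform_eventually)
  from LIMSEQ_unique[OF A this] have "2 * S = ln (pi / 2) + 2 * ln 2" by simp
  also have "\<dots> = ln (2 * pi)" by (simp add: ln_div ln_mult)
  finally have S: "S = ln (2 * pi) / 2" by simp
  show "ln (2 * pi) / 2 \<le> stirling n"
    unfolding S[symmetric] by (rule LIMSEQ_le_const2[OF lim]) (use dec(1)[OF assms] in blast)
  have "stirling n - 1 / (4 * real n) \<le> S"
  proof (rule LIMSEQ_le_const[OF lim], intro exI[of _ n] allI impI)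
    fix m assume "n \<le> m"
    moreover have "0 \<le> 1 / (4 * real m)" by simp
    ultimately show "stirling n - 1 / (4 * real n) \<le> stirling m" using dec(2)[OF assms, of m] by linarith
  qed
  then show "stirling n \<le> ln (2 * pi) / 2 + 1 / (4 * real n)" unfolding S by linarith
qed

text \<open>With x the floor of \<open>l\<close> and \<open>\<theta> = l - x\<close>, the logarithm
  of the ratio of the two quantities is the error in Stirling's formula, plus
  \<open>x * ln (1 + \<theta> / x) - \<theta>\<close>, plus half of
  \<open>ln (1 + \<theta> / x)\<close>. Each part is O(1/l).\<close>

lemma pois_peak:
  assumes l: "l \<ge> 1"
  shows "\<bar>pois l (nat \<lfloor>l\<rfloor>) - 1 / sqrt (2 * pi * l)\<bar> \<le> 20 / l * (1 / sqrt (2 * pi * l))"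
proof -
  define k where "k = nat \<lfloor>l\<rfloor>"
  define x where "x = real k"
  define \<theta> where "\<theta> = l - x"
  have k: "k \<ge> 1" "x \<le> l" "l < x + 1" using l unfolding x_def k_def by linarith+
  have x: "x \<ge> 1" "0 \<le> \<theta>" "\<theta> \<le> 1" using k by (auto simp: x_def \<theta>_def)
  define y where "y = ln (pois l k * sqrt (2 * pi * l))"
  have p: "pois l k > 0" using l by (simp add: pois_def)
  have "ln (pois l k) = x * ln l - l - ln (fact k)"
    using l by (simp add: pois_def ln_div ln_mult ln_realpow x_def)
  moreover have "ln (sqrt (2 * pi * l)) = ln (2 * pi) / 2 + ln l / 2"
    using l by (simp add: ln_sqrt ln_mult)
  moreover have "ln (pois l k * sqrt (2 * pi * l)) = ln (pois l k) + ln (sqrt (2 * pi * l))"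
    using p l by (simp add: ln_mult)
  moreover have "ln l = ln x + ln (1 + \<theta> / x)"
  proof -
    have "l = x * (1 + \<theta> / x)" using x by (simp add: \<theta>_def field_simps)
    moreover have "1 + \<theta> / x > 0" using x by (intro add_pos_nonneg) auto
    ultimately show ?thesis using x ln_mult[of x "1 + \<theta> / x"] by simp
  qed
  ultimately have y: "y = (ln (2 * pi) / 2 - stirling k) + (x * ln (1 + \<theta> / x) - \<theta>) + ln (1 + \<theta> / x) / 2"
    by (simp add: y_def stirling_def x_def \<theta>_def algebra_simps add_divide_distrib)
  have q: "0 \<le> \<theta> / x" "\<theta> / x \<le> 1 / x" "\<theta> / x \<le> 1" using x by (auto simp: field_simps)
  have up: "ln (1 + \<theta> / x) \<le> \<theta> / x" by (rule ln_add_one_self_le_self[OF q(1)])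
  have lo: "\<theta> / x - (\<theta> / x)\<^sup>2 \<le> ln (1 + \<theta> / x)" by (rule ln_one_plus_pos_lower_bound[OF q(1) q(3)])
  have "x * ln (1 + \<theta> / x) \<le> x * (\<theta> / x)" "x * (\<theta> / x - (\<theta> / x)\<^sup>2) \<le> x * ln (1 + \<theta> / x)"
    by (rule mult_left_mono[OF up], use x in simp) (rule mult_left_mono[OF lo], use x in simp)
  moreover have "x * (\<theta> / x) = \<theta>" "x * (\<theta> / x - (\<theta> / x)\<^sup>2) = \<theta> - \<theta>\<^sup>2 / x"
    using x by (simp_all add: power2_eq_square field_simps)
  moreover have "\<theta>\<^sup>2 / x \<le> 1 / x" using x by (intro divide_right_mono) (auto simp: power_le_one)
  ultimately have b: "- (1 / x) \<le> x * ln (1 + \<theta> / x) - \<theta>" "x * ln (1 + \<theta> / x) - \<theta> \<le> 0" by linarith+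
  have c: "0 \<le> ln (1 + \<theta> / x)" using q by simp
  have d: "ln (2 * pi) / 2 - stirling k \<le> 0" "- (1 / x) \<le> ln (2 * pi) / 2 - stirling k"
  proof -
    have "1 / (4 * x) \<le> 1 / x" using x by (intro divide_left_mono) auto
    then show "ln (2 * pi) / 2 - stirling k \<le> 0" "- (1 / x) \<le> ln (2 * pi) / 2 - stirling k"
      using stirling_bounds[OF k(1)] by (simp_all add: x_def)
  qed
  have "1 / x > 0" using x by simp
  then have y2: "\<bar>y\<bar> \<le> 2 * (1 / x)"
    unfolding y abs_le_iff using b c d up q by (auto; linarith)
  also have "1 / x \<le> 2 / l" using k x by (simp add: field_simps)
  finally have y4: "\<bar>y\<bar> \<le> 4 / l" by simp
  have y1: "\<bar>y\<bar> \<le> 2" using y2 x by (smt (verit, best) divide_le_eq_1)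
  \<comment> \<open>For positive \<open>y\<close> the chord of exp over [0, 2] has slope at most 4,
    because exp 2 <= 9; so 5 suffices, and 5 * 4 / l is the stated 20 / l.\<close>
  have "\<bar>exp y - 1\<bar> \<le> 5 * \<bar>y\<bar>"
  proof (cases "y \<ge> 0")
    case True
    have "exp y \<le> 1 + 5 * y"
    proof -
      have "exp ((1 - y / 2) * 0 + y / 2 * 2) \<le> (1 - y / 2) * exp 0 + y / 2 * exp 2"
        using convex_onD[OF exp_convex, of "y / 2" 0 2] True y1 by simp
      moreover have "exp 2 \<le> (9::real)"
      proof -
        have "exp 2 = exp 1 * exp (1::real)" by (simp flip: exp_add)
        also have "\<dots> \<le> 3 * 3" using exp_le by (intro mult_mono) auto
        finally show ?thesis by simp
      qed
      then have "y / 2 * exp 2 \<le> y / 2 * 9" using True by (intro mult_left_mono) auto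
      ultimately show ?thesis using True by simp
    qed
    then show ?thesis using True by simp
  next
    case False
    have "1 + y \<le> exp y" by (rule exp_ge_add_one_self)
    moreover have "exp y \<le> 1" using False by simp
    ultimately show ?thesis using False by linarith
  qed
  also have "\<dots> \<le> 20 / l" using y4 by simp
  also have "exp y = pois l k * sqrt (2 * pi * l)" unfolding y_def using p l by simp
  finally have "\<bar>pois l k * sqrt (2 * pi * l) - 1\<bar> * (1 / sqrt (2 * pi * l)) \<le> 20 / l * (1 / sqrt (2 * pi * l))"
    using l by (intro mult_right_mono) auto
  moreover have "\<bar>pois l k * sqrt (2 * pi * l) - 1\<bar> * (1 / sqrt (2 * pi * l)) = \<bar>pois l k - 1 / sqrt (2 * pi * l)\<bar>"
  proof -
    define w where "w = sqrt (2 * pi * l)"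
    have w: "w > 0" using l by (simp add: w_def)
    have "\<bar>pois l k * w - 1\<bar> * (1 / w) = \<bar>(pois l k * w - 1) * (1 / w)\<bar>" unfolding abs_mult using w by simp
    also have "(pois l k * w - 1) * (1 / w) = pois l k - 1 / w" using w by (simp add: field_simps)
    finally show ?thesis by (simp add: w_def)
  qed
  ultimately show ?thesis by (simp add: k_def)
qed

text \<open>Going d steps away from the peak divides the weight by at least the product of the
  factors 1 + j / l over j < d, hence by at least 1 + d (d - 1) / (2 l). Quadratic decay of this
  kind is all that is needed to beat a linear tilt.\<close>

lemma pois_decay:
  assumes l: "l \<ge> 1"
  shows "pois l k * (1 - 1 / (2 * l) + (real k - l)\<^sup>2 / (8 * l)) \<le> pois l (nat \<lfloor>l\<rfloor>)"
proof -
  define m where "m = nat \<lfloor>l\<rfloor>"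
  have m: "real m \<le> l" "l < real m + 1" using l unfolding m_def by linarith+
  have up: "pois l (m + d) * (1 + real d * (real d - 1) / (2 * l)) \<le> pois l m" for d
  proof (induction d)
    case (Suc d)
    have "1 + real (Suc d) * (real (Suc d) - 1) / (2 * l) =
        1 + real d * (real d - 1) / (2 * l) + real d / l"
      using l by (simp add: field_simps)
    also have "\<dots> \<le> (1 + real d * (real d - 1) / (2 * l)) * (1 + real d / l)"
    proof -
      have "0 \<le> real d * (real d - 1)" by (cases d) auto
      then have "0 \<le> real d * (real d - 1) / (2 * l) * (real d / l)" using l by simp
      moreover have "(1 + A) * (1 + e) = 1 + A + e + A * e" for A e :: real by (simp add: algebra_simps)
      ultimately show ?thesis by (simp only:)
    qed
    also have "\<dots> \<le> (1 + real d * (real d - 1) / (2 * l)) * (real (Suc (m + d)) / l)"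
    proof (intro mult_left_mono)
      have "1 + real d / l = (l + real d) / l" using l by (simp add: add_divide_distrib)
      also have "\<dots> \<le> real (Suc (m + d)) / l" using l m by (intro divide_right_mono) auto
      finally show "1 + real d / l \<le> real (Suc (m + d)) / l" .
      have "0 \<le> real d * (real d - 1)" by (cases d) auto
      then show "0 \<le> 1 + real d * (real d - 1) / (2 * l)" using l by simp
    qed
    finally have "pois l (Suc (m + d)) * (1 + real (Suc d) * (real (Suc d) - 1) / (2 * l)) \<le>
        pois l (Suc (m + d)) * ((1 + real d * (real d - 1) / (2 * l)) * (real (Suc (m + d)) / l))"
      using pois_nonneg[of l] l by (intro mult_left_mono) auto
    also have "\<dots> = pois l (m + d) * (1 + real d * (real d - 1) / (2 * l))"
    proof -
      have "pois l (Suc (m + d)) * (real (Suc (m + d)) / l) = pois l (m + d)" using l by (intro pois_Suc) simp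
      then show ?thesis by (metis mult.assoc mult.commute)
    qed
    finally show ?case using Suc by simp
  qed simp
  have down: "pois l (m - d) * (1 + real d * (real d - 1) / (2 * l)) \<le> pois l m" if "d \<le> m" for d
    using that
  proof (induction d)
    case (Suc d)
    define j where "j = m - Suc d"
    have j: "m - d = Suc j" "real (Suc j) \<le> l - real d" using Suc.prems m by (auto simp: j_def of_nat_diff)
    have dl: "real (Suc j) \<ge> 1" by simp
    have "real (Suc j) / l * (1 + real d / l) \<le> (l - real d) / l * (1 + real d / l)"
      using j l by (intro mult_right_mono divide_right_mono) auto
    also have "\<dots> = 1 - (real d / l)\<^sup>2" using l by (simp add: power2_eq_square field_simps)
    finally have le: "real (Suc j) / l * (1 + real d / l) \<le> 1" by (smt (verit, best) zero_le_power2)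
    have "1 + real (Suc d) * (real (Suc d) - 1) / (2 * l) =
        1 + real d * (real d - 1) / (2 * l) + real d / l"
      using l by (simp add: field_simps)
    also have "\<dots> \<le> (1 + real d * (real d - 1) / (2 * l)) * (1 + real d / l)"
    proof -
      have "0 \<le> real d * (real d - 1)" by (cases d) auto
      then have "0 \<le> real d * (real d - 1) / (2 * l) * (real d / l)" using l by simp
      moreover have "(1 + A) * (1 + e) = 1 + A + e + A * e" for A e :: real by (simp add: algebra_simps)
      ultimately show ?thesis by (simp only:)
    qed
    finally have "pois l j * (1 + real (Suc d) * (real (Suc d) - 1) / (2 * l)) \<le>
        pois l j * ((1 + real d * (real d - 1) / (2 * l)) * (1 + real d / l))"
      using pois_nonneg[of l] l by (intro mult_left_mono) auto
    also have "\<dots> = pois l (Suc j) * (1 + real d * (real d - 1) / (2 * l)) * (real (Suc j) / l * (1 + real d / l))"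
    proof -
      have "pois l j = pois l (Suc j) * (real (Suc j) / l)" using l by (intro pois_Suc[symmetric]) simp
      then show ?thesis by (simp only: mult_ac)
    qed
    also have "\<dots> \<le> pois l (Suc j) * (1 + real d * (real d - 1) / (2 * l)) * 1"
    proof (rule mult_left_mono[OF le])
      have "0 \<le> real d * (real d - 1)" by (cases d) auto
      then show "0 \<le> pois l (Suc j) * (1 + real d * (real d - 1) / (2 * l))"
        using l pois_nonneg[of l "Suc j"] by simp
    qed
    finally show ?case using Suc j(1) by (simp add: j_def)
  qed simp
  \<comment> \<open>The distances to \<open>l\<close> and to the peak differ by at most 1. The
    inequality (d + 1)^2 <= 4 d (d - 1) + 4 turns one into the other and accounts for the 8 and for
    the loss 1 / (2 l).\<close>
  have key: "1 - 1 / (2 * l) + (real k - l)\<^sup>2 / (8 * l) \<le> 1 + d * (d - 1) / (2 * l)"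
    if "\<bar>real k - l\<bar> \<le> d + 1" for d :: real
  proof -
    have "(real k - l)\<^sup>2 \<le> (d + 1)\<^sup>2" using that by (metis abs_ge_zero power2_abs power_mono)
    also have "\<dots> = 4 * (d * (d - 1)) + 4 - 3 * (d - 1)\<^sup>2" by (simp add: power2_eq_square algebra_simps)
    also have "\<dots> \<le> 4 * (d * (d - 1)) + 4" by simp
    finally have "(real k - l)\<^sup>2 / (8 * l) \<le> (4 * (d * (d - 1)) + 4) / (8 * l)" using l by (intro divide_right_mono) auto
    also have "\<dots> = d * (d - 1) / (2 * l) + 1 / (2 * l)" using l by (simp add: field_simps)
    finally show ?thesis by simp
  qed
  show ?thesis
  proof (cases "k \<ge> m")
    case True
    have "1 - 1 / (2 * l) + (real k - l)\<^sup>2 / (8 * l) \<le> 1 + real (k - m) * (real (k - m) - 1) / (2 * l)"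
      by (rule key) (use True m in \<open>auto simp: of_nat_diff\<close>)
    then have "pois l k * (1 - 1 / (2 * l) + (real k - l)\<^sup>2 / (8 * l)) \<le> pois l k * (1 + real (k - m) * (real (k - m) - 1) / (2 * l))"
      using pois_nonneg[of l k] l by (intro mult_left_mono) auto
    then show ?thesis using up[of "k - m"] True by (simp add: m_def)
  next
    case False
    have "1 - 1 / (2 * l) + (real k - l)\<^sup>2 / (8 * l) \<le> 1 + real (m - k) * (real (m - k) - 1) / (2 * l)"
      by (rule key) (use False m in \<open>auto simp: of_nat_diff\<close>)
    then have "pois l k * (1 - 1 / (2 * l) + (real k - l)\<^sup>2 / (8 * l)) \<le> pois l k * (1 + real (m - k) * (real (m - k) - 1) / (2 * l))"
      using pois_nonneg[of l k] l by (intro mult_left_mono) auto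
    then show ?thesis using down[of "m - k"] False by (simp add: m_def)
  qed
qed

section \<open>From the moment bounds to the profile\<close>

lemma powr_three_halves_bounds:
  fixes l :: real
  assumes "l \<ge> 1"
  shows "l powr (3 / 2) * l powr (- 3 / 2) = 1" "l powr (3 / 2) \<le> l\<^sup>2" "(l powr (3 / 2))\<^sup>2 = l ^ 3"
proof -
  show "l powr (3 / 2) * l powr (- 3 / 2) = 1" using assms by (simp flip: powr_add)
  have "l powr (3 / 2) \<le> l powr 2" using assms by (intro powr_mono) auto
  then show "l powr (3 / 2) \<le> l\<^sup>2" using assms by (simp add: powr_numeral)
  have "(l powr (3 / 2))\<^sup>2 = l powr 3" by (simp add: power2_eq_square flip: powr_add)
  then show "(l powr (3 / 2))\<^sup>2 = l ^ 3" using assms by (simp add: powr_numeral)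
qed

lemma half_ln_square_le: "n \<ge> 1 \<Longrightarrow> (ln (real n) / 2)\<^sup>2 \<le> real n"
proof -
  assume n: "n \<ge> 1"
  have "ln (sqrt (real n)) \<le> sqrt (real n)" using ln_le_minus_one[of "sqrt (real n)"] n by simp
  then have "ln (real n) / 2 \<le> sqrt (real n)" using n by (simp add: ln_sqrt)
  then have "(ln (real n) / 2)\<^sup>2 \<le> (sqrt (real n))\<^sup>2" using n by (intro power_mono) auto
  then show ?thesis by simp
qed

text \<open>The origin of the threshold 9 in the later statements: exp 2 <= 9.\<close>

lemma half_ln_ge_1: "n \<ge> 9 \<Longrightarrow> 1 \<le> ln (real n) / 2"
proof -
  assume n: "n \<ge> 9"
  have "exp 2 = exp 1 * exp (1::real)" by (simp flip: exp_add)
  also have "\<dots> \<le> 3 * 3" using exp_le by (intro mult_mono) auto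
  also have "\<dots> \<le> real n" using n by simp
  finally have "ln (exp 2) \<le> ln (real n)" using n by (subst ln_le_cancel_iff) auto
  then show ?thesis by simp
qed

lemma sum3_power_le:
  fixes a b :: real
  assumes "a \<ge> 0" "b \<ge> 0"
  shows "(1 + a + b) ^ k \<le> 3 ^ k * (1 + a ^ k + b ^ k)"
proof -
  define m where "m = max 1 (max a b)"
  have "1 + a + b \<le> 3 * m" by (simp add: m_def)
  then have "(1 + a + b) ^ k \<le> (3 * m) ^ k" using assms by (intro power_mono) auto
  also have "\<dots> = 3 ^ k * m ^ k" by (simp add: power_mult_distrib)
  also have "m ^ k \<le> 1 + a ^ k + b ^ k"
    using assms unfolding m_def max_def by auto
  finally show ?thesis by simp
qed

lemma nearint_nonneg:
  assumes "n \<ge> 1" "0 < r" "r \<le> 1 / 8"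
  shows "nearint r n t \<ge> 0"
  unfolding nearint_def
proof (rule Henstock_Kurzweil_Integration.integral_nonneg)
  have "continuous_on (sphere 1 r) (tiltgf n t)"
    by (rule holomorphic_on_imp_continuous_on, rule holomorphic_on_subset[OF holomorphic_tiltgf[OF assms(1)]])
       (use assms in auto)
  then show "(\<lambda>x. norm (tiltgf n t (circlepath 1 r x))) integrable_on {0..1}"
    using assms by (intro integrable_on_circlepath(1)[where f = "\<lambda>z. norm (tiltgf n t z)"] continuous_on_norm) auto
qed simp

lemma farint_nonneg:
  assumes "0 < r"
  shows "farint r t \<ge> 0"
  unfolding farint_def
proof (rule Henstock_Kurzweil_Integration.integral_nonneg)
  show "(\<lambda>x. norm (gf t (circlepath 0 1 x)) * farwt r (circlepath 0 1 x)) integrable_on {0..1}"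
    unfolding farwt_def
    by (intro integrable_on_circlepath(1)[where f = "\<lambda>z. norm (gf t z) * (max 0 (norm (z - 1) - r / 4) * (4 / r))"]
        continuous_intros holomorphic_on_imp_continuous_on holomorphic_gf) auto
qed (use assms in \<open>auto simp: farwt_def\<close>)

text \<open>\<open>\<xi>\<close> and \<open>Q\<close> are chosen for each \<open>n\<close> and
  \<open>q\<close> separately, since the radius of the disc depends on \<open>q\<close>; the moment
  bound \<open>K\<close> is common to all \<open>n\<close>.\<close>

lemma profile_expansion:
  "\<exists>K>0. \<forall>n\<ge>9. \<exists>\<xi> Q. (\<forall>t. 0 \<le> Q t) \<and>
    (\<forall>t. port n t \<longrightarrow> \<bar>\<xi> t\<bar> \<le> Q t \<and>
      (\<forall>k. \<bar>real (profile t k) / real n -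
          pois (ln (real n) / 2) k * (1 + \<xi> t * (real k - ln (real n) / 2) / (ln (real n) / 2))\<bar>
        \<le> Q t * (ln (real n) / 2) powr (- 3 / 2))) \<and>
    expect n (\<lambda>t. Q t ^ (2 * Suc q)) \<le> K"
proof -
  obtain K1 r where r: "0 < r" "r \<le> 1 / 8" and K1: "K1 > 0" and near: "\<And>n z. n \<ge> 1 \<Longrightarrow> norm (z - 1 :: complex) \<le> r \<Longrightarrow>
    expect n (\<lambda>t. norm (slotgf t z) ^ (2 * Suc q)) \<le> (K1 * (norm (gmean n z))\<^sup>2) ^ Suc q"
    using moment_near[of q] by blast
  have "0 < r / 4" "r / 4 \<le> 1" using r by auto
  then obtain K2 \<theta> where K2: "K2 > 0" and \<theta>: "0 < \<theta>" "\<theta> < 2" and far: "\<And>n z. n \<ge> 1 \<Longrightarrow> norm (z :: complex) = 1 \<Longrightarrow>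
    r / 4 \<le> norm (z - 1) \<Longrightarrow> expect n (\<lambda>t. norm (gf t z) ^ (2 * Suc q)) \<le> (K2 * real n powr \<theta>) ^ Suc q"
    using moment_far[of "r / 4" q] by blast
  \<comment> \<open>A third of the gap between n^theta and n^2. The gap absorbs l^3, the square of
    the scaling factor l^(3/2), because a logarithm is at most n^a / a.\<close>
  define a where "a = (2 - \<theta>) / 3"
  have a: "a > 0" using \<theta> by (simp add: a_def)
  define d where "d = r\<^sup>2 / 8"
  have d: "d > 0" using r by (simp add: d_def)
  \<comment> \<open>The sum of all coefficients that occur below, so that it dominates each group of
    them.\<close>
  define c where "c = 16 / r\<^sup>2 + 2 + 2 / d\<^sup>2 * (1 + 2 / r) + 1 / r"
  have c: "c > 0" using r d unfolding c_def by (intro add_pos_nonneg) auto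
  define K3 where "K3 = 64 / r\<^sup>2 * K2 / a ^ 3"
  have K3: "K3 > 0" using r K2 a by (simp add: K3_def)
  define K where "K = c ^ (2 * Suc q) * (3 ^ (2 * Suc q) * (1 + (576 * K1) ^ Suc q + K3 ^ Suc q))"
  have K: "K > 0" unfolding K_def using c K1 K3 by (intro mult_pos_pos add_pos_nonneg) auto
  show ?thesis
  proof (intro exI[of _ K] conjI K allI impI)
    fix n :: nat assume n9: "9 \<le> n"
    have n: "n \<ge> 1" using n9 by simp
    define l where "l = ln (real n) / 2"
    have l1: "l \<ge> 1" unfolding l_def by (rule half_ln_ge_1[OF n9])
    have l0: "l > 0" using l1 by simp
    define \<Lambda> where "\<Lambda> = l powr (3 / 2)"
    note \<Lambda> = powr_three_halves_bounds[OF l1, folded \<Lambda>_def]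
    have \<Lambda>0: "\<Lambda> > 0" using l0 by (simp add: \<Lambda>_def)
    have \<Lambda>n: "\<Lambda> / real n \<le> 1" using \<Lambda>(2) half_ln_square_le[OF n] n by (simp add: l_def)
    have \<Lambda>e: "\<Lambda> * exp (- l * r\<^sup>2 / 8) \<le> 2 / d\<^sup>2"
    proof -
      have "1 + d * l + (d * l)\<^sup>2 / 2 \<le> exp (d * l)" using d l0 by (intro exp_lower_Taylor_quadratic) simp
      moreover have "0 \<le> d * l" using d l0 by simp
      ultimately have "d\<^sup>2 * l\<^sup>2 \<le> 2 * exp (d * l)" by (simp add: power_mult_distrib)
      then have "l\<^sup>2 \<le> 2 / d\<^sup>2 * exp (d * l)" using d by (simp add: field_simps)
      then have "\<Lambda> \<le> 2 / d\<^sup>2 * exp (d * l)" using \<Lambda>(2) by linarith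
      then have "\<Lambda> * exp (- (d * l)) \<le> 2 / d\<^sup>2 * exp (d * l) * exp (- (d * l))" by (intro mult_right_mono) auto
      also have "\<dots> = 2 / d\<^sup>2" by (simp add: exp_minus)
      finally show ?thesis by (simp add: d_def mult_ac)
    qed
    define B where "B t = \<Lambda> * farint r t / real n" for t
    define Q where "Q t = c * (1 + nearint r n t + B t)" for t
    have R0: "nearint r n t \<ge> 0" for t by (rule nearint_nonneg[OF n r])
    have S0: "farint r t \<ge> 0" for t by (rule farint_nonneg[OF r(1)])
    have B0: "B t \<ge> 0" for t unfolding B_def using \<Lambda>0 S0[of t] by simp
    have Q0: "Q t \<ge> 0" for t unfolding Q_def using c R0[of t] B0[of t] by simp
    have "\<exists>\<xi>. \<bar>\<xi>\<bar> \<le> Q t \<and> (\<forall>k. \<bar>real (profile t k) / real n -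
          pois l k * (1 + \<xi> * (real k - l) / l)\<bar> \<le> Q t * l powr (- 3 / 2))" if t: "port n t" for t
    proof -
      define R S where "R = nearint r n t" and "S = farint r t"
      have RS: "R \<ge> 0" "S \<ge> 0" using R0 S0 by (auto simp: R_def S_def)
      obtain \<xi> where \<xi>: "\<bar>\<xi>\<bar> \<le> R / r" and dev: "\<And>k. \<bar>real (profile t k) - (real n - 1 / 2) * (pois l k * (1 + \<xi> * (real k - l) / l))\<bar> \<le>
        real n * (2 * R / r\<^sup>2) * (8 * l powr (- 3 / 2)) + 1 + S + real n * exp (- l * r\<^sup>2 / 8) * (1 + 2 * R / r)"
        using profile_deviation[OF t l_def l0 r] unfolding R_def S_def by blast
      have Qt: "Q t = c * (1 + R + \<Lambda> * S / real n)" by (simp add: Q_def B_def R_def S_def)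
      have Rr: "0 \<le> R / r" using RS r by simp
      show ?thesis
      proof (intro exI[of _ \<xi>] conjI allI)
        have "R / r \<le> c * R"
        proof -
          have "1 / r \<le> c" unfolding c_def using r d by (simp add: add_nonneg_nonneg)
          then show ?thesis using mult_right_mono[of "1 / r" c R] RS by simp
        qed
        also have "\<dots> \<le> Q t" unfolding Qt using c RS \<Lambda>0 by (intro mult_left_mono) auto
        finally show "\<bar>\<xi>\<bar> \<le> Q t" using \<xi> by linarith
        fix k
        define p where "p = pois l k * (1 + \<xi> * (real k - l) / l)"
        have p: "\<bar>p\<bar> \<le> 1 + R / r" using abs_pois_tilt_le[OF l0, of k \<xi>] \<xi> unfolding p_def by linarith
        define e where "e = exp (- l * r\<^sup>2 / 8)"
        define E where "E = real n * (2 * R / r\<^sup>2) * (8 * l powr (- 3 / 2)) + 1 + S + real n * e * (1 + 2 * R / r)"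
        \<comment> \<open>Passing from \<open>n - 1 / 2\<close> to \<open>n\<close> costs
          \<open>p / 2\<close>, which is bounded uniformly in \<open>k\<close> by
          \<open>abs_pois_tilt_le\<close>.\<close>
        have "real (profile t k) / real n - p = ((real (profile t k) - (real n - 1 / 2) * p) - p / 2) / real n"
          using n by (simp add: field_simps)
        then have "\<bar>real (profile t k) / real n - p\<bar> = \<bar>(real (profile t k) - (real n - 1 / 2) * p) - p / 2\<bar> / real n"
          by (simp add: abs_divide)
        also have "\<dots> \<le> (E + (1 + R / r)) / real n"
          using dev[of k] p RS r n unfolding p_def[symmetric] E_def e_def[symmetric]
          by (intro divide_right_mono) auto
        finally have "\<Lambda> * \<bar>real (profile t k) / real n - p\<bar> \<le> \<Lambda> * ((E + (1 + R / r)) / real n)"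
          using \<Lambda>0 by (intro mult_left_mono) auto
        also have "\<dots> = 16 * R / r\<^sup>2 * (\<Lambda> * l powr (- 3 / 2)) + \<Lambda> / real n * (2 + R / r) + \<Lambda> * S / real n
            + (\<Lambda> * e) * (1 + 2 * R / r)"
          unfolding E_def using n by (simp add: field_simps)
        also have "\<dots> \<le> 16 * R / r\<^sup>2 * 1 + 1 * (2 + R / r) + \<Lambda> * S / real n + 2 / d\<^sup>2 * (1 + 2 * R / r)"
          using \<Lambda>(1) \<Lambda>n \<Lambda>e Rr RS r unfolding e_def by (intro add_mono mult_mono) auto
        also have "\<dots> = (2 + 2 / d\<^sup>2) * 1 + (16 / r\<^sup>2 + 1 / r + 2 / d\<^sup>2 * (2 / r)) * R + 1 * (\<Lambda> * S / real n)"
          by (simp add: algebra_simps add_divide_distrib)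
        also have "\<dots> \<le> c * 1 + c * R + c * (\<Lambda> * S / real n)"
        proof -
          have "c = 16 / r\<^sup>2 + 2 + 2 / d\<^sup>2 + 2 / d\<^sup>2 * (2 / r) + 1 / r"
            unfolding c_def by (simp add: distrib_left)
          moreover have "0 \<le> 16 / r\<^sup>2" "0 \<le> 2 / d\<^sup>2" "0 \<le> 2 / d\<^sup>2 * (2 / r)" "0 \<le> 1 / r" using r d by auto
          ultimately have "2 + 2 / d\<^sup>2 \<le> c" "16 / r\<^sup>2 + 1 / r + 2 / d\<^sup>2 * (2 / r) \<le> c" "1 \<le> c" by linarith+
          moreover have "0 \<le> \<Lambda> * S / real n" using \<Lambda>0 RS by simp
          ultimately show ?thesis using RS by (intro add_mono mult_right_mono) auto
        qed
        also have "\<dots> = Q t" unfolding Qt by (simp add: algebra_simps)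
        finally have "\<Lambda> * \<bar>real (profile t k) / real n - p\<bar> * l powr (- 3 / 2) \<le> Q t * l powr (- 3 / 2)"
          by (intro mult_right_mono) auto
        moreover have "\<Lambda> * \<bar>real (profile t k) / real n - p\<bar> * l powr (- 3 / 2) = (\<Lambda> * l powr (- 3 / 2)) * \<bar>real (profile t k) / real n - p\<bar>"
          by (simp only: mult_ac)
        ultimately have "1 * \<bar>real (profile t k) / real n - p\<bar> \<le> Q t * l powr (- 3 / 2)"
          by (simp only: \<Lambda>(1))
        then show "\<bar>real (profile t k) / real n - pois l k * (1 + \<xi> * (real k - l) / l)\<bar> \<le> Q t * l powr (- 3 / 2)"
          by (simp only: p_def mult_1_left)
      qed
    qed
    then obtain \<xi> where \<xi>: "\<And>t. port n t \<Longrightarrow> \<bar>\<xi> t\<bar> \<le> Q t \<and> (\<forall>k. \<bar>real (profile t k) / real n -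
          pois l k * (1 + \<xi> t * (real k - l) / l)\<bar> \<le> Q t * l powr (- 3 / 2))"
      by metis
    have EB: "expect n (\<lambda>t. B t ^ (2 * Suc q)) \<le> K3 ^ Suc q"
    proof -
      have "expect n (\<lambda>t. B t ^ (2 * Suc q)) = expect n (\<lambda>t. ((\<Lambda> / real n)\<^sup>2) ^ Suc q * farint r t ^ (2 * Suc q))"
        unfolding power_mult[symmetric] power_mult_distrib[symmetric] by (simp add: B_def)
      also have "\<dots> = ((\<Lambda> / real n)\<^sup>2) ^ Suc q * expect n (\<lambda>t. farint r t ^ (2 * Suc q))" by (rule integral_mult_right_zero)
      also have "\<dots> \<le> ((\<Lambda> / real n)\<^sup>2) ^ Suc q * (64 / r\<^sup>2 * K2 * real n powr \<theta>) ^ Suc q"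
        using moment_farint[OF n r K2 far[OF n]] by (intro mult_left_mono) auto
      also have "\<dots> = ((\<Lambda> / real n)\<^sup>2 * (64 / r\<^sup>2 * K2 * real n powr \<theta>)) ^ Suc q" by (simp only: power_mult_distrib)
      also have "\<dots> \<le> K3 ^ Suc q"
      proof (rule power_mono)
        have "l \<le> ln (real n)" using l0 by (simp add: l_def)
        also have "\<dots> \<le> real n powr a / a" using n a by (intro ln_powr_bound) auto
        finally have "l ^ 3 \<le> (real n powr a / a) ^ 3" using l0 by (intro power_mono) auto
        also have "\<dots> = real n powr (2 - \<theta>) / a ^ 3"
        proof -
          have "(real n powr a) ^ 3 = real n powr (2 - \<theta>)"
          proof -
            have "a + a + a = 2 - \<theta>" by (simp add: a_def field_simps)
            then show ?thesis by (simp only: power3_eq_cube powr_add[symmetric])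
          qed
          then show ?thesis by (simp add: power_divide)
        qed
        finally have l3: "l ^ 3 \<le> real n powr (2 - \<theta>) / a ^ 3" .
        have "(\<Lambda> / real n)\<^sup>2 * (64 / r\<^sup>2 * K2 * real n powr \<theta>) = l ^ 3 * (64 / r\<^sup>2 * K2 * (real n powr \<theta> / (real n)\<^sup>2))"
          by (simp add: power_divide \<Lambda>(3))
        also have "\<dots> \<le> real n powr (2 - \<theta>) / a ^ 3 * (64 / r\<^sup>2 * K2 * (real n powr \<theta> / (real n)\<^sup>2))"
          using l3 K2 by (intro mult_right_mono) auto
        also have "\<dots> = K3 * (real n powr (2 - \<theta>) * real n powr \<theta> / (real n)\<^sup>2)" by (simp add: K3_def mult_ac)
        also have "real n powr (2 - \<theta>) * real n powr \<theta> = (real n)\<^sup>2"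
          using n by (simp add: powr_numeral flip: powr_add)
        finally show "(\<Lambda> / real n)\<^sup>2 * (64 / r\<^sup>2 * K2 * real n powr \<theta>) \<le> K3" using n by simp
      qed (use K2 in simp)
      finally show ?thesis .
    qed
    have ER: "expect n (\<lambda>t. nearint r n t ^ (2 * Suc q)) \<le> (576 * K1) ^ Suc q"
      by (rule moment_nearint[OF n r K1 near[OF n]])
    have "expect n (\<lambda>t. Q t ^ (2 * Suc q)) \<le> expect n (\<lambda>t. c ^ (2 * Suc q) * (3 ^ (2 * Suc q) *
        (1 + nearint r n t ^ (2 * Suc q) + B t ^ (2 * Suc q))))"
      unfolding Q_def power_mult_distrib using c R0 B0
      by (intro expectation_random_port_mono[OF n] mult_left_mono sum3_power_le) auto
    also have "\<dots> = c ^ (2 * Suc q) * (3 ^ (2 * Suc q) *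
        (1 + expect n (\<lambda>t. nearint r n t ^ (2 * Suc q)) + expect n (\<lambda>t. B t ^ (2 * Suc q))))"
      using n by (simp del: mult_Suc_right)
    also have "\<dots> \<le> K"
      unfolding K_def using c EB ER by (intro mult_left_mono add_mono) auto
    finally have EQ: "expect n (\<lambda>t. Q t ^ (2 * Suc q)) \<le> K" .
    show "\<exists>\<xi> Q. (\<forall>t. 0 \<le> Q t) \<and> (\<forall>t. port n t \<longrightarrow> \<bar>\<xi> t\<bar> \<le> Q t \<and>
      (\<forall>k. \<bar>real (profile t k) / real n -
          pois (ln (real n) / 2) k * (1 + \<xi> t * (real k - ln (real n) / 2) / (ln (real n) / 2))\<bar>
        \<le> Q t * (ln (real n) / 2) powr (- 3 / 2))) \<and>
      expect n (\<lambda>t. Q t ^ (2 * Suc q)) \<le> K"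
      unfolding l_def[symmetric] using Q0 \<xi> EQ by blast
  qed
qed

text \<open>The tilt by \<open>\<xi>\<close> moves the peak of the Poisson weights by \<open>O(\<xi>)\<close>, where they are flat to first
  order; so it changes the maximum only by a relative error of order \<open>(1 + \<xi>\<^sup>2) / l\<close>.\<close>

lemma tilted_pois_width:
  fixes l Q \<xi> :: real and y :: "nat \<Rightarrow> real"
  assumes l: "l \<ge> 1" and \<xi>: "\<bar>\<xi>\<bar> \<le> Q"
    and y: "\<And>k. \<bar>y k - pois l k * (1 + \<xi> * (real k - l) / l)\<bar> \<le> Q * l powr (- 3 / 2)"
  shows "y k \<le> 1 / sqrt (2 * pi * l) + 105 * (1 + Q\<^sup>2) * l powr (- 3 / 2)"
    "y (nat \<lfloor>l\<rfloor>) \<ge> 1 / sqrt (2 * pi * l) - 105 * (1 + Q\<^sup>2) * l powr (- 3 / 2)"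
    "y k \<ge> y (nat \<lfloor>l\<rfloor>) \<Longrightarrow> \<bar>real k - l\<bar> \<le> 40 * (1 + Q) \<or> l \<le> 40 * (1 + Q)"
proof -
  define m where "m = nat \<lfloor>l\<rfloor>"
  define P where "P = pois l m"
  define w where "w = 1 / sqrt (2 * pi * l)"
  define \<epsilon> where "\<epsilon> = l powr (- 3 / 2)"
  have Q: "Q \<ge> 0" using \<xi> by linarith
  have \<epsilon>: "\<epsilon> > 0" using l by (simp add: \<epsilon>_def)
  have "\<epsilon> = 1 / (l * sqrt l)" unfolding \<epsilon>_def by (rule mult_sqrt_eq_powr) (use l in simp)
  then have \<epsilon>': "\<epsilon> = 1 / sqrt l / l" by (simp add: mult.commute)
  \<comment> \<open>Since 1 <= sqrt (2 pi) <= 3, the quantities \<open>w / l\<close> and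
    \<open>\<epsilon>\<close> are interchangeable up to a factor 3.\<close>
  have w: "w > 0" "w / l \<le> \<epsilon>" "\<epsilon> \<le> 3 * (w / l)"
  proof -
    show "w > 0" using l by (simp add: w_def)
    have e: "w = 1 / (sqrt (2 * pi) * sqrt l)" by (simp add: w_def real_sqrt_mult)
    have "1 \<le> sqrt (2 * pi)" using pi_gt3 by simp
    then have "w \<le> 1 / (1 * sqrt l)" unfolding e using l by (intro divide_left_mono mult_right_mono mult_pos_pos) auto
    then show "w / l \<le> \<epsilon>" unfolding \<epsilon>' using l by (intro divide_right_mono) auto
    have "sqrt (2 * pi) \<le> 3" using pi_less_4 by (intro real_le_lsqrt) auto
    then have "1 / (3 * sqrt l) \<le> w" unfolding e using l by (intro divide_left_mono mult_right_mono mult_pos_pos) auto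
    then have "1 / (3 * sqrt l) / l \<le> w / l" using l by (intro divide_right_mono) auto
    then show "\<epsilon> \<le> 3 * (w / l)" unfolding \<epsilon>' by simp
  qed
  have P: "w - 20 * (w / l) \<le> P" "P \<le> w + 20 * (w / l)" "P \<ge> 0"
    using pois_peak[OF l] pois_nonneg[of l m] l unfolding P_def m_def[symmetric] w_def[symmetric] by (auto simp: abs_le_iff)
  have P21: "P / l \<le> 21 * \<epsilon>"
  proof -
    have "w / l \<le> w" using l w by (simp add: field_simps)
    then have "P \<le> 21 * w" using P(2) by linarith
    then have "P / l \<le> 21 * w / l" using l by (intro divide_right_mono) auto
    then show ?thesis using w(2) by simp
  qed
  define G where "G = 1 - 1 / (2 * l) + (real k - l)\<^sup>2 / (8 * l)"
  define x where "x = \<bar>real k - l\<bar>"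
  have x: "x \<ge> 0" "(real k - l)\<^sup>2 = x\<^sup>2" by (auto simp: x_def)
  have G: "pois l k * G \<le> P" unfolding G_def P_def m_def by (rule pois_decay[OF l])
  have pk: "pois l k > 0" using l by (simp add: pois_def)
  have yk: "y k \<le> pois l k * (1 + Q * x / l) + Q * \<epsilon>"
  proof -
    have "\<xi> * (real k - l) \<le> Q * x"
      using \<xi> abs_mult[of \<xi> "real k - l"] mult_right_mono[OF \<xi> x(1)] unfolding x_def by linarith
    then have "\<xi> * (real k - l) / l \<le> Q * x / l" using l by (intro divide_right_mono) auto
    then have "pois l k * (1 + \<xi> * (real k - l) / l) \<le> pois l k * (1 + Q * x / l)"
      using pk by (intro mult_left_mono) auto
    then show ?thesis using y[of k] unfolding \<epsilon>_def by linarith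
  qed
  have ym: "y m \<ge> P - Q * (P / l) - Q * \<epsilon>"
  proof -
    have "\<bar>real m - l\<bar> \<le> 1" unfolding m_def using l by linarith
    then have "\<bar>\<xi>\<bar> * \<bar>real m - l\<bar> \<le> Q * 1" using \<xi> Q by (intro mult_mono) auto
    then have "- Q \<le> \<xi> * (real m - l)" unfolding abs_mult[symmetric] by linarith
    then have "- Q / l \<le> \<xi> * (real m - l) / l" using l by (intro divide_right_mono) auto
    then have "P * (1 + - Q / l) \<le> P * (1 + \<xi> * (real m - l) / l)" using P(3) by (intro mult_left_mono) auto
    then have "P - Q * (P / l) \<le> P * (1 + \<xi> * (real m - l) / l)" by (simp add: algebra_simps)
    then show ?thesis using y[of m] unfolding \<epsilon>_def P_def by linarith
  qed
  have Q2: "Q \<le> 1 + Q\<^sup>2"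
  proof -
    have "0 \<le> (Q - 1 / 2)\<^sup>2" by simp
    also have "\<dots> = Q\<^sup>2 - Q + 1 / 4" by (simp add: power2_eq_square algebra_simps)
    finally show ?thesis by simp
  qed
  show "y k \<le> 1 / sqrt (2 * pi * l) + 105 * (1 + Q\<^sup>2) * l powr (- 3 / 2)"
  proof -
    \<comment> \<open>From 8 Q x <= x^2 + 16 Q^2 the quadratic decay in \<open>G\<close> absorbs the
      tilt, at the price of the factor \<open>1 + h\<close>.\<close>
    define h where "h = 4 * (1 + Q\<^sup>2) / l"
    have h: "h \<ge> 0" using l by (simp add: h_def)
    have G2: "G \<ge> 1 / 2" unfolding G_def using l by (auto simp: field_simps intro!: add_increasing2)
    have "1 + Q * x / l \<le> G + 1 / 2 * h"
    proof -
      have "0 \<le> (x - 4 * Q)\<^sup>2" by simp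
      then have "8 * (Q * x) \<le> x\<^sup>2 + 16 * Q\<^sup>2" by (simp add: power2_eq_square algebra_simps)
      then have "Q * x / l \<le> (x\<^sup>2 / 8 - 1 / 2 + 2 * (1 + Q\<^sup>2)) / l" using l by (intro divide_right_mono) auto
      also have "\<dots> = x\<^sup>2 / (8 * l) - 1 / (2 * l) + 1 / 2 * h"
        by (simp add: h_def add_divide_distrib diff_divide_distrib)
      finally show ?thesis unfolding G_def x(2) by simp
    qed
    also have "\<dots> \<le> G + G * h" using G2 h by (intro add_left_mono mult_right_mono) auto
    finally have "pois l k * (1 + Q * x / l) \<le> pois l k * (G * (1 + h))"
      using pk by (intro mult_left_mono) (auto simp: algebra_simps)
    also have "\<dots> = pois l k * G * (1 + h)" by simp
    also have "\<dots> \<le> P * (1 + h)" using G h by (intro mult_right_mono) auto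
    also have "\<dots> = P + 4 * (1 + Q\<^sup>2) * (P / l)" by (simp add: h_def algebra_simps add_divide_distrib)
    also have "\<dots> \<le> P + 4 * (1 + Q\<^sup>2) * (21 * \<epsilon>)" using P21 by (intro add_left_mono mult_left_mono) auto
    also have "4 * (1 + Q\<^sup>2) * (21 * \<epsilon>) = 84 * ((1 + Q\<^sup>2) * \<epsilon>)" by simp
    finally have "y k \<le> P + 84 * ((1 + Q\<^sup>2) * \<epsilon>) + Q * \<epsilon>" using yk by linarith
    moreover have "Q * \<epsilon> \<le> (1 + Q\<^sup>2) * \<epsilon>" "\<epsilon> \<le> (1 + Q\<^sup>2) * \<epsilon>" using Q2 \<epsilon> by simp_all
    moreover have "P \<le> w + 20 * \<epsilon>" using P(2) w(2) by linarith
    \<comment> \<open>105 = 84 + 1 + 20: the factor \<open>1 + h\<close>, the error of the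
      expansion, and the error of the peak.\<close>
    ultimately have "y k \<le> w + 105 * ((1 + Q\<^sup>2) * \<epsilon>)" by linarith
    then show ?thesis by (simp only: w_def \<epsilon>_def mult.assoc)
  qed
  show "y (nat \<lfloor>l\<rfloor>) \<ge> 1 / sqrt (2 * pi * l) - 105 * (1 + Q\<^sup>2) * l powr (- 3 / 2)"
  proof -
    have "Q * (P / l) \<le> Q * (21 * \<epsilon>)" using P21 Q by (intro mult_left_mono) auto
    then have "Q * (P / l) \<le> 21 * (Q * \<epsilon>)" by (simp only: mult.left_commute)
    moreover have "Q * \<epsilon> \<le> (1 + Q\<^sup>2) * \<epsilon>" "\<epsilon> \<le> (1 + Q\<^sup>2) * \<epsilon>" using Q2 \<epsilon> by simp_all
    moreover have "P \<ge> w - 20 * \<epsilon>" using P(1) w(2) by linarith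
    ultimately have "w - 105 * ((1 + Q\<^sup>2) * \<epsilon>) \<le> y m" using ym \<epsilon> by linarith
    then show ?thesis by (simp only: w_def \<epsilon>_def m_def mult.assoc)
  qed
  show "\<bar>real k - l\<bar> \<le> 40 * (1 + Q) \<or> l \<le> 40 * (1 + Q)" if "y k \<ge> y (nat \<lfloor>l\<rfloor>)"
  \<comment> \<open>If both alternatives fail, \<open>l\<close> is large compared with
    \<open>Q\<close>, so \<open>P\<close> is comparable to \<open>w\<close> and the errors amount to
    at most 13 Q P / l. The decay at distance \<open>x\<close> then gives x^2 / 16 <= Q x + 13 Q +
    1/2, which is impossible for x > 40 (1 + Q).\<close>
  proof (rule ccontr)
    assume "\<not> (\<bar>real k - l\<bar> \<le> 40 * (1 + Q) \<or> l \<le> 40 * (1 + Q))"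
    then have big: "x > 40 * (1 + Q)" "l > 40 * (1 + Q)" by (auto simp: x_def)
    have "w / l \<le> w / 40" using big Q w(1) by (intro divide_left_mono) auto
    then have Pw: "w \<le> 2 * P" using P(1) by linarith
    then have "w / l \<le> 2 * P / l" using l by (intro divide_right_mono) auto
    then have \<epsilon>P: "\<epsilon> \<le> 6 * (P / l)" using w(3) by simp
    have "Q * \<epsilon> \<le> Q * (6 * (P / l))" using \<epsilon>P Q by (intro mult_left_mono) auto
    then have "Q * \<epsilon> \<le> 6 * (Q * (P / l))" by (simp only: mult.left_commute)
    then have ineq: "P - 13 * (Q * (P / l)) \<le> pois l k * (1 + Q * x / l)"
    proof -
      have "e \<le> 6 * r \<Longrightarrow> a \<le> b \<Longrightarrow> b \<le> A + e \<Longrightarrow> P - r - e \<le> a \<Longrightarrow> P - 13 * r \<le> A" for e r a b A :: real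
        by linarith
      from this[OF \<open>Q * \<epsilon> \<le> 6 * (Q * (P / l))\<close> that[folded m_def] yk ym] show ?thesis .
    qed
    define u where "u = 1 - 13 * Q / l"
    have u: "u \<ge> 1 / 2" "u \<le> 1" unfolding u_def using big Q l by (auto simp: field_simps)
    have "pois l k * (G * u) \<le> P * u" using mult_right_mono[OF G, of u] u by (simp add: mult.assoc)
    also have "P * u = P - 13 * (Q * (P / l))" by (simp add: u_def algebra_simps)
    also note ineq
    finally have "G * u \<le> 1 + Q * x / l" using pk by simp
    moreover have "G * u = u * (1 - 1 / (2 * l)) + x\<^sup>2 / (8 * l) * u" unfolding G_def x(2) by (simp add: algebra_simps)
    moreover have "u * (1 - 1 / (2 * l)) \<ge> 1 - 13 * Q / l - 1 / (2 * l)"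
    proof -
      have "u * (1 / (2 * l)) \<le> 1 * (1 / (2 * l))" using u l by (intro mult_right_mono) auto
      moreover have "u * (1 - 1 / (2 * l)) = u - u * (1 / (2 * l))" by (simp only: right_diff_distrib mult_1_right)
      ultimately have "u - 1 * (1 / (2 * l)) \<le> u * (1 - 1 / (2 * l))" by (simp only: diff_left_mono)
      then show ?thesis by (simp only: u_def mult_1_left)
    qed
    moreover have "x\<^sup>2 / (8 * l) * u \<ge> x\<^sup>2 / (8 * l) * (1 / 2)" using u l by (intro mult_left_mono) auto
    ultimately have "x\<^sup>2 / (8 * l) * (1 / 2) \<le> Q * x / l + 13 * Q / l + 1 / (2 * l)" by linarith
    then have "x\<^sup>2 / (8 * l) * (1 / 2) * l \<le> (Q * x / l + 13 * Q / l + 1 / (2 * l)) * l"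
      using l by (intro mult_right_mono) auto
    then have "x\<^sup>2 / 16 \<le> Q * x + 13 * Q + 1 / 2" using l by (simp add: distrib_right)
    moreover have "40 * (1 + Q) * x \<le> x\<^sup>2" using big x(1) by (simp add: power2_eq_square mult_right_mono)
    ultimately have "40 * x + 40 * (Q * x) \<le> 16 * (Q * x) + 208 * Q + 8" by (simp add: algebra_simps)
    moreover have "0 \<le> Q * x" using Q x by simp
    ultimately show False using big(1) Q by (simp add: algebra_simps)
  qed
qed

section \<open>Moments of the width\<close>

text \<open>For n >= 9 this is n / sqrt (2 pi l) with l = ln n / 2, that is, n times the height of
  the Poisson peak.\<close>

definition width_scale :: "nat \<Rightarrow> real" where
  "width_scale n = real n / sqrt (pi * L n)"

lemma L_ge_1: "L n \<ge> 1"
  by (simp add: L_def)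

lemma L_eq_ln: "n \<ge> 9 \<Longrightarrow> L n = ln (real n)"
  using half_ln_ge_1[of n] by (simp add: L_def)

lemma width_scale_pos: "n \<ge> 1 \<Longrightarrow> width_scale n > 0"
  using L_ge_1[of n] by (simp add: width_scale_def)

text \<open>The alternative \<open>L n / 2 \<le> 40 * (1 + Q t)\<close> covers trees whose
  \<open>Q\<close> is too large for the expansion to locate the mode; the moment bound makes them
  rare.\<close>

lemma width_expansion:
  "\<exists>K>0. \<forall>n\<ge>9. \<exists>Q. (\<forall>t. 0 \<le> Q t) \<and> expect n (\<lambda>t. Q t ^ (2 * Suc q)) \<le> K \<and>
    (\<forall>t. port n t \<longrightarrow>
      \<bar>real (width t) - width_scale n\<bar> \<le> 315 * (1 + (Q t)\<^sup>2) * (real n * L n powr (- 3 / 2)) \<and>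
      (\<forall>k. profile t k = width t \<longrightarrow> \<bar>real k - L n / 2\<bar> \<le> 40 * (1 + Q t) \<or> L n / 2 \<le> 40 * (1 + Q t)))"
proof -
  obtain K where K: "K > 0" and ex: "\<And>n. n \<ge> 9 \<Longrightarrow> \<exists>\<xi> Q. (\<forall>t. 0 \<le> Q t) \<and>
    (\<forall>t. port n t \<longrightarrow> \<bar>\<xi> t\<bar> \<le> Q t \<and>
      (\<forall>k. \<bar>real (profile t k) / real n -
          pois (ln (real n) / 2) k * (1 + \<xi> t * (real k - ln (real n) / 2) / (ln (real n) / 2))\<bar>
        \<le> Q t * (ln (real n) / 2) powr (- 3 / 2))) \<and>
    expect n (\<lambda>t. Q t ^ (2 * Suc q)) \<le> K"
    using profile_expansion[of q] by blast
  show ?thesis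
  proof (intro exI[of _ K] conjI K allI impI)
    fix n :: nat assume n: "9 \<le> n"
    define l where "l = ln (real n) / 2"
    have l1: "l \<ge> 1" unfolding l_def by (rule half_ln_ge_1[OF n])
    have Ll: "L n = 2 * l" using L_eq_ln[OF n] by (simp add: l_def)
    obtain \<xi> Q where Q0: "\<And>t. 0 \<le> Q t" and \<xi>: "\<And>t. port n t \<Longrightarrow> \<bar>\<xi> t\<bar> \<le> Q t"
      and dev: "\<And>t k. port n t \<Longrightarrow> \<bar>real (profile t k) / real n - pois l k * (1 + \<xi> t * (real k - l) / l)\<bar> \<le> Q t * l powr (- 3 / 2)"
      and E: "expect n (\<lambda>t. Q t ^ (2 * Suc q)) \<le> K"
      using ex[OF n] unfolding l_def[symmetric] by blast
    have scale: "width_scale n = real n * (1 / sqrt (2 * pi * l))"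
      by (simp add: width_scale_def Ll mult_ac)
    \<comment> \<open>Here l = L n / 2, and 2^(3/2) <= 3 turns the constant 105 into 315.\<close>
    have l3: "l powr (- 3 / 2) \<le> 3 * L n powr (- 3 / 2)"
    proof -
      have "2 powr (3 / 2) \<le> (3 :: real)"
      proof (rule power2_le_imp_le)
        have "(2 powr (3 / 2))\<^sup>2 = (2 powr 3 :: real)" by (simp add: power2_eq_square flip: powr_add)
        also have "\<dots> = 8" by (simp add: powr_numeral)
        finally show "(2 powr (3 / 2))\<^sup>2 \<le> (3::real)\<^sup>2" by simp
      qed simp
      then have "2 powr (3 / 2) * (2 powr (- 3 / 2) * l powr (- 3 / 2)) \<le> 3 * (2 powr (- 3 / 2) * l powr (- 3 / 2))"
        by (intro mult_right_mono) auto
      moreover have "2 powr (3 / 2) * 2 powr (- 3 / 2) = (1 :: real)" by (simp flip: powr_add)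
      moreover have "L n powr (- 3 / 2) = 2 powr (- 3 / 2) * l powr (- 3 / 2)" unfolding Ll using l1 by (simp add: powr_mult)
      ultimately show ?thesis by (simp only: mult.assoc[symmetric] mult_1_left)
    qed
    have main: "\<bar>real (width t) - width_scale n\<bar> \<le> 315 * (1 + (Q t)\<^sup>2) * (real n * L n powr (- 3 / 2)) \<and>
      (\<forall>k. profile t k = width t \<longrightarrow> \<bar>real k - L n / 2\<bar> \<le> 40 * (1 + Q t) \<or> L n / 2 \<le> 40 * (1 + Q t))"
      if t: "port n t" for t
    proof -
      note tw = tilted_pois_width[where y = "\<lambda>k. real (profile t k) / real n", OF l1 \<xi>[OF t] dev[OF t]]
      define e where "e = 105 * (1 + (Q t)\<^sup>2) * l powr (- 3 / 2)"
      obtain k where k: "profile t k = width t" using width_attained by blast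
      have 1: "real (width t) / real n \<le> 1 / sqrt (2 * pi * l) + e" using tw(1)[of k] k by (simp add: e_def)
      have "real (profile t (nat \<lfloor>l\<rfloor>)) / real n \<le> real (width t) / real n"
        using profile_le_width[of t "nat \<lfloor>l\<rfloor>"] by (intro divide_right_mono) auto
      then have 2: "1 / sqrt (2 * pi * l) - e \<le> real (width t) / real n" using tw(2) unfolding e_def by linarith
      have "\<bar>real (width t) / real n - 1 / sqrt (2 * pi * l)\<bar> \<le> e" using 1 2 by linarith
      then have "real n * \<bar>real (width t) / real n - 1 / sqrt (2 * pi * l)\<bar> \<le> real n * e" by (intro mult_left_mono) auto
      moreover have "real n * \<bar>real (width t) / real n - 1 / sqrt (2 * pi * l)\<bar> = \<bar>real (width t) - width_scale n\<bar>"
      proof -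
        have "real n * \<bar>real (width t) / real n - 1 / sqrt (2 * pi * l)\<bar> = \<bar>real n * (real (width t) / real n - 1 / sqrt (2 * pi * l))\<bar>"
          by (simp add: abs_mult)
        also have "real n * (real (width t) / real n - 1 / sqrt (2 * pi * l)) = real (width t) - width_scale n"
          unfolding scale using n by (simp add: right_diff_distrib)
        finally show ?thesis .
      qed
      moreover have "real n * e \<le> 315 * (1 + (Q t)\<^sup>2) * (real n * L n powr (- 3 / 2))"
      proof -
        have "e \<le> 105 * (1 + (Q t)\<^sup>2) * (3 * L n powr (- 3 / 2))"
          unfolding e_def by (rule mult_left_mono[OF l3]) simp
        then have "real n * e \<le> real n * (105 * (1 + (Q t)\<^sup>2) * (3 * L n powr (- 3 / 2)))" by (intro mult_left_mono) auto
        also have "\<dots> = 315 * (1 + (Q t)\<^sup>2) * (real n * L n powr (- 3 / 2))" by simp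
        finally show ?thesis .
      qed
      moreover have "\<bar>real j - L n / 2\<bar> \<le> 40 * (1 + Q t) \<or> L n / 2 \<le> 40 * (1 + Q t)" if j: "profile t j = width t" for j
      proof -
        have "real (profile t (nat \<lfloor>l\<rfloor>)) / real n \<le> real (profile t j) / real n"
          unfolding j using profile_le_width[of t "nat \<lfloor>l\<rfloor>"] by (intro divide_right_mono) auto
        then show ?thesis using tw(3)[of j] by (simp add: Ll)
      qed
      ultimately show ?thesis by (intro conjI) (linarith, blast)
    qed
    show "\<exists>Q. (\<forall>t. 0 \<le> Q t) \<and> expect n (\<lambda>t. Q t ^ (2 * Suc q)) \<le> K \<and>
    (\<forall>t. port n t \<longrightarrow>
      \<bar>real (width t) - width_scale n\<bar> \<le> 315 * (1 + (Q t)\<^sup>2) * (real n * L n powr (- 3 / 2)) \<and>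
      (\<forall>k. profile t k = width t \<longrightarrow> \<bar>real k - L n / 2\<bar> \<le> 40 * (1 + Q t) \<or> L n / 2 \<le> 40 * (1 + Q t)))"
      using Q0 E main by blast
  qed
qed

lemma sum2_power_le:
  fixes a b :: real
  assumes "a \<ge> 0" "b \<ge> 0"
  shows "(a + b) ^ k \<le> 2 ^ k * (a ^ k + b ^ k)"
proof -
  define m where "m = max a b"
  have "(a + b) ^ k \<le> (2 * m) ^ k" using assms by (intro power_mono) (auto simp: m_def)
  also have "\<dots> = 2 ^ k * m ^ k" by (simp add: power_mult_distrib)
  also have "m ^ k \<le> a ^ k + b ^ k" using assms unfolding m_def max_def by auto
  finally show ?thesis by simp
qed

text \<open>The deviation is quadratic in \<open>Q\<close>, so its moment of order
  \<open>Suc q\<close> rests on the moment of \<open>Q\<close> of order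
  \<open>2 * Suc q\<close>.\<close>

lemma width_deviation_moment:
  "\<exists>K>0. \<forall>n\<ge>9. expect n (\<lambda>t. \<bar>real (width t) - width_scale n\<bar> ^ Suc q) \<le> K * (real n * L n powr (- 3 / 2)) ^ Suc q"
proof -
  obtain K where K: "K > 0" and ex: "\<And>n. n \<ge> 9 \<Longrightarrow> \<exists>Q. (\<forall>t. 0 \<le> Q t) \<and> expect n (\<lambda>t. Q t ^ (2 * Suc q)) \<le> K \<and>
    (\<forall>t. port n t \<longrightarrow>
      \<bar>real (width t) - width_scale n\<bar> \<le> 315 * (1 + (Q t)\<^sup>2) * (real n * L n powr (- 3 / 2)) \<and>
      (\<forall>k. profile t k = width t \<longrightarrow> \<bar>real k - L n / 2\<bar> \<le> 40 * (1 + Q t) \<or> L n / 2 \<le> 40 * (1 + Q t)))"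
    using width_expansion[of q] by blast
  show ?thesis
  proof (intro exI[of _ "315 ^ Suc q * (2 ^ Suc q * (1 + K))"] conjI allI impI)
    show "0 < (315::real) ^ Suc q * (2 ^ Suc q * (1 + K))" using K by simp
    fix n :: nat assume n: "9 \<le> n"
    define u where "u = real n * L n powr (- 3 / 2)"
    have u: "u \<ge> 0" by (simp add: u_def)
    obtain Q where Q: "\<And>t. 0 \<le> Q t" "expect n (\<lambda>t. Q t ^ (2 * Suc q)) \<le> K"
      and dev: "\<And>t. port n t \<Longrightarrow> \<bar>real (width t) - width_scale n\<bar> \<le> 315 * (1 + (Q t)\<^sup>2) * u"
      using ex[OF n] unfolding u_def by blast
    have n1: "n \<ge> 1" using n by simp
    have "expect n (\<lambda>t. \<bar>real (width t) - width_scale n\<bar> ^ Suc q) \<le>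
        expect n (\<lambda>t. 315 ^ Suc q * u ^ Suc q * (2 ^ Suc q * (1 + Q t ^ (2 * Suc q))))"
    proof (rule expectation_random_port_mono[OF n1])
      fix t assume t: "port n t"
      have "\<bar>real (width t) - width_scale n\<bar> ^ Suc q \<le> (315 * (1 + (Q t)\<^sup>2) * u) ^ Suc q"
        using dev[OF t] by (intro power_mono) auto
      also have "\<dots> = 315 ^ Suc q * u ^ Suc q * (1 + (Q t)\<^sup>2) ^ Suc q"
        by (simp only: power_mult_distrib mult_ac)
      also have "\<dots> \<le> 315 ^ Suc q * u ^ Suc q * (2 ^ Suc q * (1 ^ Suc q + ((Q t)\<^sup>2) ^ Suc q))"
        using u by (intro mult_left_mono sum2_power_le) auto
      finally show "\<bar>real (width t) - width_scale n\<bar> ^ Suc q \<le> 315 ^ Suc q * u ^ Suc q * (2 ^ Suc q * (1 + Q t ^ (2 * Suc q)))"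
        by (simp only: power_mult power_one)
    qed
    also have "\<dots> = 315 ^ Suc q * u ^ Suc q * (2 ^ Suc q * (1 + expect n (\<lambda>t. Q t ^ (2 * Suc q))))"
      using n1 by (simp del: mult_Suc_right power_Suc)
    also have "\<dots> \<le> 315 ^ Suc q * u ^ Suc q * (2 ^ Suc q * (1 + K))"
      using Q(2) u by (intro mult_left_mono) auto
    finally show "expect n (\<lambda>t. \<bar>real (width t) - width_scale n\<bar> ^ Suc q) \<le> 315 ^ Suc q * (2 ^ Suc q * (1 + K)) * (real n * L n powr (- 3 / 2)) ^ Suc q"
      by (simp only: u_def mult_ac)
  qed
qed

lemma mean_width_deviation:
  "\<exists>K>0. \<forall>n\<ge>9. \<bar>mean_width n - width_scale n\<bar> \<le> K * (real n * L n powr (- 3 / 2))"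
proof -
  obtain K where K: "K > 0" "\<And>n. n \<ge> 9 \<Longrightarrow> expect n (\<lambda>t. \<bar>real (width t) - width_scale n\<bar> ^ Suc 0) \<le> K * (real n * L n powr (- 3 / 2)) ^ Suc 0"
    using width_deviation_moment[of 0] by blast
  show ?thesis
  proof (intro exI[of _ K] conjI K allI impI)
    fix n :: nat assume n: "9 \<le> n"
    then have n1: "n \<ge> 1" by simp
    have "mean_width n - width_scale n = expect n (\<lambda>t. real (width t) - width_scale n)"
      using n1 by (simp add: mean_width_def)
    then have "\<bar>mean_width n - width_scale n\<bar> \<le> expect n (\<lambda>t. \<bar>real (width t) - width_scale n\<bar>)"
      using integral_abs_bound[of "random_port n" "\<lambda>t. real (width t) - width_scale n"] by simp
    then show "\<bar>mean_width n - width_scale n\<bar> \<le> K * (real n * L n powr (- 3 / 2))" using K(2)[OF n] by simp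
  qed
qed

lemma mean_width_asymp:
  "(\<lambda>n. mean_width n / width_scale n - 1) \<in> O(\<lambda>n. 1 / L n)"
proof -
  obtain K where K: "K > 0" "\<And>n. n \<ge> 9 \<Longrightarrow> \<bar>mean_width n - width_scale n\<bar> \<le> K * (real n * L n powr (- 3 / 2))"
    using mean_width_deviation by blast
  show ?thesis
  proof (rule bigoI[of _ "K * sqrt pi"], use eventually_ge_at_top[of 9] in eventually_elim)
    case (elim n)
    have L: "L n > 0" using L_ge_1[of n] by linarith
    have w: "width_scale n > 0" using elim by (intro width_scale_pos) simp
    have "mean_width n / width_scale n - 1 = (mean_width n - width_scale n) / width_scale n"
      using w by (simp add: diff_divide_distrib)
    then have "\<bar>mean_width n / width_scale n - 1\<bar> = \<bar>mean_width n - width_scale n\<bar> / width_scale n"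
      using w by (simp add: abs_divide)
    also have "\<dots> \<le> K * (real n * L n powr (- 3 / 2)) / width_scale n"
      using K(2)[OF elim] w by (intro divide_right_mono) auto
    also have "\<dots> = K * sqrt pi * (L n powr (- 3 / 2) * sqrt (L n))"
      using elim by (simp add: width_scale_def real_sqrt_mult)
    also have "L n powr (- 3 / 2) * sqrt (L n) = 1 / L n"
      unfolding mult_sqrt_eq_powr(2)[OF L] using L by simp
    finally show "norm (mean_width n / width_scale n - 1) \<le> K * sqrt pi * norm (1 / L n)" using L by simp
  qed
qed

lemma powr_le_one_plus_power:
  fixes x s :: real
  assumes "x \<ge> 0" "0 \<le> s" "s \<le> real k"
  shows "x powr s \<le> 1 + x ^ k"
proof (cases "x \<le> 1")
  case True
  have "x powr s \<le> 1 powr s" using True assms by (intro powr_mono2) auto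
  then show ?thesis using assms by (simp add: add_increasing2)
next
  case False
  then have "x powr s \<le> x powr real k" using assms by (intro powr_mono) auto
  also have "\<dots> = x ^ k" using False by (simp add: powr_realpow)
  finally show ?thesis by simp
qed

text \<open>After division by \<open>u\<close>, the order of the deviation, a real exponent is
  reduced to an integer one by x^s <= 1 + x^k. The shift from \<open>width_scale\<close> to the mean
  is itself of order \<open>u\<close>.\<close>

lemma width_central_moment:
  fixes s :: real
  assumes s: "s \<ge> 0"
  shows "(\<lambda>n. expect n (\<lambda>t. \<bar>real (width t) - mean_width n\<bar> powr s)) \<in> O(\<lambda>n. real n powr s * L n powr (- 3 * s / 2))"
proof -
  obtain q where "s \<le> real q" using real_arch_simple by blast
  then have q: "s \<le> real (Suc q)" by simp
  obtain K where K: "K > 0" "\<And>n. n \<ge> 9 \<Longrightarrow> expect n (\<lambda>t. \<bar>real (width t) - width_scale n\<bar> ^ Suc q) \<le> K * (real n * L n powr (- 3 / 2)) ^ Suc q"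
    using width_deviation_moment[of q] by blast
  obtain K1 where K1: "K1 > 0" "\<And>n. n \<ge> 9 \<Longrightarrow> \<bar>mean_width n - width_scale n\<bar> \<le> K1 * (real n * L n powr (- 3 / 2))"
    using mean_width_deviation by blast
  define C where "C = 1 + 2 ^ Suc q * (K + K1 ^ Suc q)"
  show ?thesis
  proof (rule bigoI[of _ C], use eventually_ge_at_top[of 9] in eventually_elim)
    case (elim n)
    then have n1: "n \<ge> 1" by simp
    have L: "L n > 0" using L_ge_1[of n] by linarith
    define u where "u = real n * L n powr (- 3 / 2)"
    have u: "u > 0" using n1 L by (simp add: u_def)
    have "expect n (\<lambda>t. \<bar>real (width t) - mean_width n\<bar> powr s) \<le>
        expect n (\<lambda>t. u powr s * (1 + 2 ^ Suc q * (\<bar>real (width t) - width_scale n\<bar> ^ Suc q / u ^ Suc q + K1 ^ Suc q)))"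
    proof (rule expectation_random_port_mono[OF n1])
      fix t
      define x where "x = \<bar>real (width t) - width_scale n\<bar> / u"
      have x: "x \<ge> 0" using u by (simp add: x_def)
      have "\<bar>real (width t) - mean_width n\<bar> \<le> x * u + K1 * u"
        using K1(2)[OF elim] u unfolding u_def[symmetric] x_def by simp
      then have "\<bar>real (width t) - mean_width n\<bar> powr s \<le> (u * (x + K1)) powr s"
        using s by (intro powr_mono2) (auto simp: algebra_simps)
      also have "\<dots> = u powr s * (x + K1) powr s" by (rule powr_mult)
      also have "\<dots> \<le> u powr s * (1 + (x + K1) ^ Suc q)"
        using x K1(1) s q by (intro mult_left_mono powr_le_one_plus_power) auto
      also have "\<dots> \<le> u powr s * (1 + 2 ^ Suc q * (x ^ Suc q + K1 ^ Suc q))"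
        using x K1(1) by (intro mult_left_mono add_left_mono sum2_power_le) auto
      finally show "\<bar>real (width t) - mean_width n\<bar> powr s \<le>
          u powr s * (1 + 2 ^ Suc q * (\<bar>real (width t) - width_scale n\<bar> ^ Suc q / u ^ Suc q + K1 ^ Suc q))"
        by (simp only: x_def power_divide)
    qed
    also have "\<dots> = u powr s * (1 + 2 ^ Suc q * (expect n (\<lambda>t. \<bar>real (width t) - width_scale n\<bar> ^ Suc q) / u ^ Suc q + K1 ^ Suc q))"
      using n1 by (simp del: power_Suc)
    also have "\<dots> \<le> u powr s * C"
    proof -
      have "expect n (\<lambda>t. \<bar>real (width t) - width_scale n\<bar> ^ Suc q) / u ^ Suc q \<le> K * u ^ Suc q / u ^ Suc q"
        using K(2)[OF elim] u unfolding u_def[symmetric] by (intro divide_right_mono) auto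
      also have "\<dots> = K" using u by simp
      finally show ?thesis unfolding C_def by (intro mult_left_mono add_left_mono add_right_mono) auto
    qed
    also have "u powr s = real n powr s * L n powr (- 3 * s / 2)"
      using n1 L by (simp add: u_def powr_mult powr_powr)
    finally have "expect n (\<lambda>t. \<bar>real (width t) - mean_width n\<bar> powr s) \<le> C * (real n powr s * L n powr (- 3 * s / 2))"
      by (simp add: mult_ac)
    moreover have "0 \<le> expect n (\<lambda>t. \<bar>real (width t) - mean_width n\<bar> powr s)" by (rule Bochner_Integration.integral_nonneg) simp
    ultimately show "norm (expect n (\<lambda>t. \<bar>real (width t) - mean_width n\<bar> powr s)) \<le> C * norm (real n powr s * L n powr (- 3 * s / 2))"
      by simp
  qed
qed

section \<open>The level of the mode\<close>

lemma prob_le_expect: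
  assumes n: "n \<ge> 1" and f: "\<And>t. port n t \<Longrightarrow> 0 \<le> f t" "\<And>t. port n t \<Longrightarrow> t \<in> A \<Longrightarrow> 1 \<le> f t"
  shows "measure_pmf.prob (random_port n) A \<le> expect n f"
proof -
  have "measure_pmf.prob (random_port n) A = expect n (indicat_real A)" by simp
  also have "\<dots> \<le> expect n f"
    by (rule expectation_random_port_mono[OF n]) (use f in \<open>auto simp: indicator_def\<close>)
  finally show ?thesis .
qed

text \<open>A nonempty level \<open>k\<close> forces \<open>gf t 2\<close> to be at least 2^k, while
  its mean is polynomial in \<open>n\<close>; this bounds the height of the tree.\<close>

lemma profile_le_gf: "real (profile t k) * 2 ^ k \<le> gf t 2" "0 \<le> (gf t 2 :: real)"
proof (induction t arbitrary: k)
  case (PTree a ts)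
  have nn: "0 \<le> (\<Sum>t\<leftarrow>ts. gf t (2::real))" by (rule sum_list_nonneg) (use PTree.IH(2) in auto)
  {
    case 1
    show ?case
    proof (cases k)
      case 0
      then show ?thesis using nn by simp
    next
      case (Suc j)
      have "real (\<Sum>t\<leftarrow>ts. profile t j) * 2 ^ j = (\<Sum>t\<leftarrow>ts. real (profile t j) * 2 ^ j)"
        by (induction ts) (auto simp: distrib_right)
      also have "\<dots> \<le> (\<Sum>t\<leftarrow>ts. gf t 2)" by (rule sum_list_mono) (rule PTree.IH(1))
      finally show ?thesis using Suc by simp
    qed
  next
    case 2
    show ?case using nn by simp
  }
qed

lemma expect_gf_2:
  assumes n: "n \<ge> 1"
  shows "expect n (\<lambda>t. gf t 2) \<le> 2 * (real n)\<^sup>2"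
proof -
  have "gf t 2 = (slotgf t 2 + 1) / (3 :: real)" for t by (simp add: slotgf_def)
  then have "expect n (\<lambda>t. gf t 2) = expect n (\<lambda>t. (slotgf t 2 + 1) / 3)" by (simp only:)
  also have "\<dots> = (expect n (\<lambda>t. slotgf t 2) + 1) / 3" using n by simp
  also have "\<dots> = (gmean n 2 + 1) / 3" using expect_slotgf[OF n, of 2] by simp
  also have "\<dots> \<le> (2 * (2 * real n - 1) * sqrt (real n) + 1) / 3"
    using gmean_le[OF n, of 2] by simp
  also have "\<dots> \<le> (2 * (2 * real n - 1) * real n + 1) / 3"
  proof -
    have "sqrt (real n) \<le> real n" using n by (intro real_le_lsqrt) (auto simp: power2_eq_square)
    then show ?thesis using n by (intro divide_right_mono add_right_mono mult_left_mono) auto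
  qed
  also have "\<dots> \<le> 2 * (real n)\<^sup>2"
  proof -
    define x where "x = real n"
    have x: "1 \<le> x" using n by (simp add: x_def)
    then have "1 \<le> x * 2 + x * (x * 2)" using mult_nonneg_nonneg[of x "x * 2"] by linarith
    then show ?thesis unfolding x_def[symmetric] by (simp add: power2_eq_square algebra_simps)
  qed
  finally show ?thesis .
qed

lemma powr_le_const_exp:
  fixes B T :: real
  assumes B: "B > 0" and T: "T > 0"
  shows "T powr B \<le> (6 * B) powr B * exp (T / 6)"
proof -
  have "ln (T / (6 * B)) \<le> T / (6 * B)" using ln_le_minus_one[of "T / (6 * B)"] B T by simp
  then have "ln T - ln (6 * B) \<le> T / (6 * B)" using B T by (subst (asm) ln_div) auto
  then have "B * (ln T - ln (6 * B)) \<le> B * (T / (6 * B))" using B by (intro mult_left_mono) auto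
  then have "B * ln T \<le> B * ln (6 * B) + T / 6" using B by (simp add: algebra_simps)
  then have "exp (B * ln T) \<le> exp (B * ln (6 * B) + T / 6)" by simp
  then show ?thesis using B T by (simp add: powr_def exp_add)
qed

text \<open>For such \<open>T\<close> the mode can only be too deep, at a level of at least
  \<open>T\<close>. A node there forces \<open>gf t 2\<close> to be at least exp (T / 2), whereas
  its mean is at most 2 n^2 <= 2 exp (T / 3) because ln n <= T / 6.\<close>

lemma mode_far_tail:
  fixes kstar :: "ptree \<Rightarrow> nat"
  assumes n: "n \<ge> 1" and kstar: "\<And>t. port n t \<Longrightarrow> profile t (kstar t) = width t"
    and B: "B > 0" and T: "T > 6 * L n"
  shows "measure_pmf.prob (random_port n) {t. \<bar>real (kstar t) - L n / 2\<bar> \<ge> T} \<le> 2 * (6 * B) powr B * T powr (- B)"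
proof -
  have L: "L n \<ge> 1" by (rule L_ge_1)
  have T0: "T > 0" using T L by linarith
  have "measure_pmf.prob (random_port n) {t. \<bar>real (kstar t) - L n / 2\<bar> \<ge> T} \<le> expect n (\<lambda>t. exp (- (T / 2)) * gf t 2)"
  proof (rule prob_le_expect[OF n])
    fix t assume t: "port n t"
    show "0 \<le> exp (- (T / 2)) * gf t 2" using profile_le_gf(2)[of t] by simp
    assume "t \<in> {t. \<bar>real (kstar t) - L n / 2\<bar> \<ge> T}"
    then have "\<bar>real (kstar t) - L n / 2\<bar> \<ge> T" by simp
    then have k: "T \<le> real (kstar t)" using T L by linarith
    have "exp (T / 2) \<le> exp (real (kstar t) * (1 / 2))" using k by simp
    also have "\<dots> = exp (1 / 2) ^ kstar t" by (rule exp_of_nat_mult)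
    also have "\<dots> \<le> 2 ^ kstar t" using exp_half_le2 by (intro power_mono) auto
    also have "\<dots> \<le> real (profile t (kstar t)) * 2 ^ kstar t"
      using kstar[OF t] width_pos[of t] by simp
    also have "\<dots> \<le> gf t 2" by (rule profile_le_gf(1))
    finally have "exp (- (T / 2)) * exp (T / 2) \<le> exp (- (T / 2)) * gf t 2" by (intro mult_left_mono) auto
    then show "1 \<le> exp (- (T / 2)) * gf t 2" by (simp flip: exp_add)
  qed
  also have "\<dots> = exp (- (T / 2)) * expect n (\<lambda>t. gf t 2)" by (rule integral_mult_right_zero)
  also have "\<dots> \<le> exp (- (T / 2)) * (2 * (real n)\<^sup>2)" using expect_gf_2[OF n] by (intro mult_left_mono) auto
  also have "\<dots> \<le> exp (- (T / 2)) * (2 * exp (T / 3))"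
  proof -
    have "ln (real n) \<le> T / 6" using T by (simp add: L_def)
    then have "real n \<le> exp (T / 6)" using n by (simp add: ln_le_cancel_iff[symmetric] del: ln_le_cancel_iff)
    then have "(real n)\<^sup>2 \<le> (exp (T / 6))\<^sup>2" by (intro power_mono) auto
    also have "\<dots> = exp (T / 3)" by (simp add: exp_double[symmetric])
    finally show ?thesis by simp
  qed
  also have "\<dots> = 2 * exp (- (T / 6))"
  proof -
    have "exp (- (T / 2)) * exp (T / 3) = exp (- (T / 6))" by (simp flip: exp_add)
    then show ?thesis by simp
  qed
  also have "\<dots> \<le> 2 * ((6 * B) powr B * T powr (- B))"
  proof -
    have "T powr B * (exp (- (T / 6)) * T powr (- B)) \<le> (6 * B) powr B * exp (T / 6) * (exp (- (T / 6)) * T powr (- B))"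
      using powr_le_const_exp[OF B T0] by (intro mult_right_mono) auto
    moreover have "T powr B * (exp (- (T / 6)) * T powr (- B)) = exp (- (T / 6))"
      using T0 by (simp add: powr_minus)
    moreover have "(6 * B) powr B * exp (T / 6) * (exp (- (T / 6)) * T powr (- B)) = (6 * B) powr B * T powr (- B)"
      by (simp add: exp_minus)
    ultimately show ?thesis by simp
  qed
  finally show ?thesis by simp
qed

text \<open>For T <= 6 L n both alternatives on the mode bound \<open>T\<close> by a multiple of 1 +
  Q, and Markov's inequality applies with an exponent of at least \<open>B\<close>. For larger
  \<open>T\<close> the height bound takes over; together they give a constant uniform in
  \<open>n\<close> and \<open>T\<close>.\<close>

lemma mode_tail:
  fixes kstar :: "ptree \<Rightarrow> nat"
  assumes kstar: "\<And>n t. port n t \<Longrightarrow> profile t (kstar t) = width t" and B: "B > 0"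
  shows "\<exists>T0>1. \<exists>C :: real. \<forall>T>T0. \<forall>n\<ge>1.
    measure_pmf.prob (random_port n) {t. \<bar>real (kstar t) - L n / 2\<bar> \<ge> T} \<le> C * T powr (- B)"
proof -
  obtain q where "B \<le> real q" using real_arch_simple by blast
  then have q: "B \<le> real (2 * Suc q)" by simp
  obtain K where K: "K > 0" and ex: "\<And>n. n \<ge> 9 \<Longrightarrow> \<exists>Q. (\<forall>t. 0 \<le> Q t) \<and> expect n (\<lambda>t. Q t ^ (2 * Suc q)) \<le> K \<and>
    (\<forall>t. port n t \<longrightarrow>
      \<bar>real (width t) - width_scale n\<bar> \<le> 315 * (1 + (Q t)\<^sup>2) * (real n * L n powr (- 3 / 2)) \<and>
      (\<forall>k. profile t k = width t \<longrightarrow> \<bar>real k - L n / 2\<bar> \<le> 40 * (1 + Q t) \<or> L n / 2 \<le> 40 * (1 + Q t)))"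
    using width_expansion[of q] by blast
  define C1 where "C1 = 480 ^ (2 * Suc q) * (2 ^ (2 * Suc q) * (1 + K))"
  define C where "C = max (2 * (6 * B) powr B) C1"
  have near: "measure_pmf.prob (random_port n) {t. \<bar>real (kstar t) - L n / 2\<bar> \<ge> T} \<le> C1 * T powr (- B)"
    if n: "n \<ge> 1" and T: "T > 18" "T \<le> 6 * L n" for n T
  proof -
    have "L n > 3" using T by linarith
    then have ln3: "ln (real n) > 3" by (simp add: L_def)
    have "2 \<le> exp (1::real)" using exp_ge_add_one_self[of 1] by simp
    then have "2 ^ 3 \<le> exp (1::real) ^ 3" by (intro power_mono) auto
    also have "\<dots> = exp 3" using exp_of_nat_mult[of 3 "1::real"] by simp
    also have "\<dots> < exp (ln (real n))" using ln3 by simp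
    also have "\<dots> = real n" using n by simp
    finally have n9: "n \<ge> 9" by simp
    obtain Q where Q: "\<And>t. 0 \<le> Q t" "expect n (\<lambda>t. Q t ^ (2 * Suc q)) \<le> K"
      and dev: "\<And>t k. port n t \<Longrightarrow> profile t k = width t \<Longrightarrow> \<bar>real k - L n / 2\<bar> \<le> 40 * (1 + Q t) \<or> L n / 2 \<le> 40 * (1 + Q t)"
      using ex[OF n9] by blast
    have "measure_pmf.prob (random_port n) {t. \<bar>real (kstar t) - L n / 2\<bar> \<ge> T} \<le>
        expect n (\<lambda>t. (480 / T) ^ (2 * Suc q) * (2 ^ (2 * Suc q) * (1 + Q t ^ (2 * Suc q))))"
    proof (rule prob_le_expect[OF n])
      fix t assume t: "port n t"
      show "0 \<le> (480 / T) ^ (2 * Suc q) * (2 ^ (2 * Suc q) * (1 + Q t ^ (2 * Suc q)))" using T Q(1)[of t] by simp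
      assume "t \<in> {t. \<bar>real (kstar t) - L n / 2\<bar> \<ge> T}"
      then have far: "\<bar>real (kstar t) - L n / 2\<bar> \<ge> T" by simp
      \<comment> \<open>In the second alternative T <= 6 L n <= 12 * 40 (1 + Q), whence 480.\<close>
      have "T \<le> 480 * (1 + Q t)" using dev[OF t kstar[OF t]] far T Q(1)[of t] by linarith
      then have "1 \<le> 480 / T * (1 + Q t)" using T by (simp add: field_simps)
      then have "1 \<le> (480 / T * (1 + Q t)) ^ (2 * Suc q)" by (rule one_le_power)
      also have "\<dots> = (480 / T) ^ (2 * Suc q) * (1 + Q t) ^ (2 * Suc q)" by (rule power_mult_distrib)
      also have "\<dots> \<le> (480 / T) ^ (2 * Suc q) * (2 ^ (2 * Suc q) * (1 ^ (2 * Suc q) + Q t ^ (2 * Suc q)))"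
        using T Q(1) by (intro mult_left_mono sum2_power_le) auto
      finally show "1 \<le> (480 / T) ^ (2 * Suc q) * (2 ^ (2 * Suc q) * (1 + Q t ^ (2 * Suc q)))"
        by (simp only: power_one)
    qed
    also have "\<dots> = (480 / T) ^ (2 * Suc q) * (2 ^ (2 * Suc q) * (1 + expect n (\<lambda>t. Q t ^ (2 * Suc q))))"
      using n by (simp del: mult_Suc_right)
    also have "\<dots> \<le> (480 / T) ^ (2 * Suc q) * (2 ^ (2 * Suc q) * (1 + K))"
      using Q(2) T by (intro mult_left_mono) auto
    also have "\<dots> = C1 * T powr (- real (2 * Suc q))"
    proof -
      have "T powr (- real (2 * Suc q)) = inverse (T ^ (2 * Suc q))"
        unfolding powr_minus using T by (subst powr_realpow) auto
      then show ?thesis unfolding power_divide by (simp only: C1_def divide_inverse mult_ac)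
    qed
    also have "\<dots> \<le> C1 * T powr (- B)"
      using q T K by (intro mult_left_mono powr_mono) (auto simp: C1_def)
    finally show ?thesis .
  qed
  have "measure_pmf.prob (random_port n) {t. \<bar>real (kstar t) - L n / 2\<bar> \<ge> T} \<le> C * T powr (- B)"
    if T: "T > 18" and n: "n \<ge> 1" for T n
  proof (cases "T \<le> 6 * L n")
    case True
    have "C1 * T powr (- B) \<le> C * T powr (- B)" by (intro mult_right_mono) (auto simp: C_def)
    then show ?thesis using near[OF n T True] by linarith
  next
    case False
    have "2 * (6 * B) powr B * T powr (- B) \<le> C * T powr (- B)" by (intro mult_right_mono) (auto simp: C_def)
    moreover have "measure_pmf.prob (random_port n) {t. \<bar>real (kstar t) - L n / 2\<bar> \<ge> T} \<le> 2 * (6 * B) powr B * T powr (- B)"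
      by (rule mode_far_tail[OF n _ B]) (use kstar False in auto)
    ultimately show ?thesis by linarith
  qed
  \<comment> \<open>18 = 6 * 3: in the near range this gives L n > 3, so n > exp 3 >= 8 and the
    expansion, valid from 9 on, applies.\<close>
  then show ?thesis by (intro exI[of _ 18] conjI exI[of _ C]) auto
qed

section \<open>Almost sure convergence\<close>

text \<open>Markov's inequality for the fourth moment. The order 4 makes the bounds summable along
  the checkpoints, where \<open>L\<close> grows like the square root of the index.\<close>

lemma prob_width_deviation:
  "\<exists>K>0. \<forall>n\<ge>9. \<forall>\<epsilon>>0.
    measure_pmf.prob (random_port n) {t. \<bar>real (width t) / width_scale n - 1\<bar> \<ge> \<epsilon>} \<le> K / (\<epsilon> * L n) ^ 4"
proof -
  obtain K where K: "K > 0" "\<And>n. n \<ge> 9 \<Longrightarrow> expect n (\<lambda>t. \<bar>real (width t) - width_scale n\<bar> ^ Suc 3) \<le> K * (real n * L n powr (- 3 / 2)) ^ Suc 3"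
    using width_deviation_moment[of 3] by blast
  show ?thesis
  proof (intro exI[of _ "K * sqrt pi ^ 4"] conjI allI impI)
    show "0 < K * sqrt pi ^ 4" using K(1) by simp
    fix n :: nat and \<epsilon> :: real assume n: "9 \<le> n" and \<epsilon>: "0 < \<epsilon>"
    then have n1: "n \<ge> 1" by simp
    have L: "L n > 0" using L_ge_1[of n] by linarith
    define w where "w = width_scale n"
    have w: "w > 0" using width_scale_pos[OF n1] by (simp add: w_def)
    have "measure_pmf.prob (random_port n) {t. \<bar>real (width t) / w - 1\<bar> \<ge> \<epsilon>} \<le>
        expect n (\<lambda>t. inverse ((\<epsilon> * w) ^ 4) * \<bar>real (width t) - w\<bar> ^ Suc 3)"
    proof (rule prob_le_expect[OF n1])
      fix t
      show "0 \<le> inverse ((\<epsilon> * w) ^ 4) * \<bar>real (width t) - w\<bar> ^ Suc 3" using \<epsilon> w by simp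
      assume "t \<in> {t. \<bar>real (width t) / w - 1\<bar> \<ge> \<epsilon>}"
      then have "\<epsilon> \<le> \<bar>(real (width t) - w) / w\<bar>" using w by (simp add: diff_divide_distrib)
      then have "\<epsilon> * w \<le> \<bar>real (width t) - w\<bar>" using w by (simp add: abs_divide field_simps)
      then have "(\<epsilon> * w) ^ 4 \<le> \<bar>real (width t) - w\<bar> ^ 4" using \<epsilon> w by (intro power_mono) auto
      then have "inverse ((\<epsilon> * w) ^ 4) * (\<epsilon> * w) ^ 4 \<le> inverse ((\<epsilon> * w) ^ 4) * \<bar>real (width t) - w\<bar> ^ 4"
        using \<epsilon> w by (intro mult_left_mono) auto
      then show "1 \<le> inverse ((\<epsilon> * w) ^ 4) * \<bar>real (width t) - w\<bar> ^ Suc 3" using \<epsilon> w by simp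
    qed
    also have "\<dots> = inverse ((\<epsilon> * w) ^ 4) * expect n (\<lambda>t. \<bar>real (width t) - w\<bar> ^ Suc 3)"
      by (rule integral_mult_right_zero)
    also have "\<dots> \<le> inverse ((\<epsilon> * w) ^ 4) * (K * (real n * L n powr (- 3 / 2)) ^ Suc 3)"
      using K(2)[OF n] \<epsilon> w unfolding w_def by (intro mult_left_mono) auto
    also have "\<dots> = K * ((real n * L n powr (- 3 / 2)) / (\<epsilon> * w)) ^ 4"
    proof -
      have "inverse (a ^ 4) * (K * b ^ Suc 3) = K * (b / a) ^ 4" for a b :: real
        unfolding power_divide by (simp add: divide_inverse)
      then show ?thesis .
    qed
    also have "(real n * L n powr (- 3 / 2)) / (\<epsilon> * w) = sqrt pi / (\<epsilon> * L n)"
    proof -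
      have "L n powr (- 3 / 2) * sqrt (L n) = 1 / L n"
        unfolding mult_sqrt_eq_powr(2)[OF L] using L by simp
      moreover have "(real n * L n powr (- 3 / 2)) / (\<epsilon> * w) = sqrt pi / \<epsilon> * (L n powr (- 3 / 2) * sqrt (L n))"
        using n1 by (simp add: w_def width_scale_def real_sqrt_mult)
      ultimately show ?thesis by simp
    qed
    also have "K * (sqrt pi / (\<epsilon> * L n)) ^ 4 = K * sqrt pi ^ 4 / (\<epsilon> * L n) ^ 4" by (simp add: power_divide)
    finally show "measure_pmf.prob (random_port n) {t. \<bar>real (width t) / width_scale n - 1\<bar> \<ge> \<epsilon>} \<le> K * sqrt pi ^ 4 / (\<epsilon> * L n) ^ 4"
      by (simp add: w_def)
  qed
qed

text \<open>Dense enough that consecutive checkpoints have ratio tending to 1, and sparse enough that negative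
  powers of \<open>L (checkpoint j)\<close> are summable.\<close>

definition checkpoint :: "nat \<Rightarrow> nat" where
  "checkpoint j = nat \<lceil>exp (sqrt (real j))\<rceil>"

lemma checkpoint_bounds: "exp (sqrt (real j)) \<le> real (checkpoint j)" "real (checkpoint j) \<le> exp (sqrt (real j)) + 1"
proof -
  have "0 < exp (sqrt (real j))" by simp
  then have "0 \<le> \<lceil>exp (sqrt (real j))\<rceil>" by linarith
  then have "real (checkpoint j) = of_int \<lceil>exp (sqrt (real j))\<rceil>" by (simp add: checkpoint_def)
  then show "exp (sqrt (real j)) \<le> real (checkpoint j)" "real (checkpoint j) \<le> exp (sqrt (real j)) + 1" by linarith+
qed

lemma checkpoint_pos: "checkpoint j \<ge> 1"
proof -
  have "0 < exp (sqrt (real j))" by simp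
  then have "0 < real (checkpoint j)" using checkpoint_bounds(1)[of j] by linarith
  then show ?thesis by simp
qed

lemma L_checkpoint: "sqrt (real j) \<le> L (checkpoint j)"
proof -
  have "ln (exp (sqrt (real j))) \<le> ln (real (checkpoint j))"
    using checkpoint_bounds(1)[of j] checkpoint_pos[of j] by (subst ln_le_cancel_iff) auto
  then show ?thesis by (simp add: L_def)
qed

lemma AE_width_checkpoint:
  assumes "port_process M T"
  shows "AE x in M. (\<lambda>j. real (width (T (checkpoint j) x)) / width_scale (checkpoint j)) \<longlonglongrightarrow> 1"
proof -
  interpret prob_space M using assms by (simp add: port_process_def)
  obtain K where K: "K > 0" "\<And>n \<epsilon>. n \<ge> 9 \<Longrightarrow> \<epsilon> > 0 \<Longrightarrow>
    measure_pmf.prob (random_port n) {t. \<bar>real (width t) / width_scale n - 1\<bar> \<ge> \<epsilon>} \<le> K / (\<epsilon> * L n) ^ 4"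
    using prob_width_deviation by blast
  \<comment> \<open>Tends to 0, and yet (j^(-1/8) j^(1/2))^(-4) = j^(-3/2) is summable.\<close>
  define \<epsilon> where "\<epsilon> j = real j powr (- (1 / 8))" for j
  have sub1: "checkpoint j \<ge> 1" for j by (rule checkpoint_pos)
  define A where "A j = {x \<in> space M. \<bar>real (width (T (checkpoint j) x)) / width_scale (checkpoint j) - 1\<bar> \<ge> \<epsilon> j}" for j
  have meas: "A j \<in> sets M" for j
  proof -
    have "T (checkpoint j) -` {t. \<bar>real (width t) / width_scale (checkpoint j) - 1\<bar> \<ge> \<epsilon> j} \<inter> space M \<in> sets M"
      by (rule measurable_sets[OF process_measurable[OF assms sub1]]) simp
    moreover have "T (checkpoint j) -` {t. \<bar>real (width t) / width_scale (checkpoint j) - 1\<bar> \<ge> \<epsilon> j} \<inter> space M = A j"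
      by (auto simp: A_def)
    ultimately show ?thesis by simp
  qed
  have bound: "prob (A j) \<le> K * real j powr (- (3 / 2))" if j: "j \<ge> 16" for j
  proof -
    have "2 ^ 4 \<le> exp (1::real) ^ 4" using exp_ge_add_one_self[of "1::real"] by (intro power_mono) auto
    also have "\<dots> = exp 4" using exp_of_nat_mult[of 4 "1::real"] by simp
    also have "\<dots> \<le> exp (sqrt (real j))" using j by (simp add: real_le_rsqrt)
    also have "\<dots> \<le> real (checkpoint j)" by (rule checkpoint_bounds)
    finally have "checkpoint j \<ge> 9" by simp
    have e: "\<epsilon> j > 0" using j by (simp add: \<epsilon>_def)
    have "prob (A j) = measure_pmf.prob (random_port (checkpoint j)) {t. \<bar>real (width t) / width_scale (checkpoint j) - 1\<bar> \<ge> \<epsilon> j}"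
      unfolding A_def by (rule prob_process[OF assms sub1])
    also have "\<dots> \<le> K / (\<epsilon> j * L (checkpoint j)) ^ 4" by (rule K(2)[OF \<open>checkpoint j \<ge> 9\<close> e])
    also have "\<dots> \<le> K / (\<epsilon> j * sqrt (real j)) ^ 4"
      using K(1) e L_checkpoint[of j] j
      by (intro divide_left_mono power_mono mult_left_mono mult_pos_pos zero_less_power) (auto intro: less_le_trans[OF _ L_ge_1])
    also have "\<epsilon> j * sqrt (real j) = real j powr (3 / 8)"
    proof -
      have "\<epsilon> j * sqrt (real j) = real j powr (- (1 / 8)) * real j powr (1 / 2)"
        using j by (simp add: \<epsilon>_def powr_half_sqrt)
      also have "\<dots> = real j powr (3 / 8)" by (subst powr_add[symmetric]) simp
      finally show ?thesis .
    qed
    also have "(real j powr (3 / 8)) ^ 4 = real j powr (3 / 2)"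
      by (simp add: eval_nat_numeral flip: powr_add)
    also have "K / real j powr (3 / 2) = K * real j powr (- (3 / 2))" by (simp only: powr_minus divide_inverse)
    finally show ?thesis .
  qed
  have "summable (\<lambda>j. prob (A j))"
  proof (rule summable_comparison_test_ev)
    show "\<forall>\<^sub>F j in sequentially. norm (prob (A j)) \<le> K * real j powr (- (3 / 2))"
      using eventually_ge_at_top[of 16] by eventually_elim (use bound in simp)
    show "summable (\<lambda>j. K * real j powr (- (3 / 2)))"
      by (intro summable_mult) (simp add: summable_real_powr_iff)
  qed
  then have "AE x in M. eventually (\<lambda>j. x \<in> space M - A j) sequentially"
    using meas by (intro borel_cantelli_AE1) (auto simp: emeasure_eq_measure)
  then show ?thesis
  proof eventually_elim
    case (elim x)
    have lim: "\<epsilon> \<longlonglongrightarrow> 0" unfolding \<epsilon>_def by real_asymp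
    have "(\<lambda>j. real (width (T (checkpoint j) x)) / width_scale (checkpoint j) - 1) \<longlonglongrightarrow> 0"
    proof (rule Lim_null_comparison[OF _ lim])
      show "\<forall>\<^sub>F j in sequentially. norm (real (width (T (checkpoint j) x)) / width_scale (checkpoint j) - 1) \<le> \<epsilon> j"
        using elim by eventually_elim (auto simp: A_def)
    qed
    then show ?case by (simp add: LIM_zero_iff)
  qed
qed

text \<open>\<open>j\<close> is the index with sqrt j <= ln n < sqrt (j + 1), so \<open>n\<close>
  lies between two consecutive checkpoints. The bounds are explicit functions of \<open>n\<close>
  alone that tend to 1.\<close>

lemma width_scale_ratio:
  assumes n: "n \<ge> 9" and j: "j = nat \<lfloor>(ln (real n))\<^sup>2\<rfloor>"
  shows "checkpoint j \<le> n" "n \<le> checkpoint (Suc j)"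
    "exp (sqrt ((ln (real n))\<^sup>2 - 1)) / real n \<le> width_scale (checkpoint j) / width_scale n"
    "width_scale (checkpoint (Suc j)) / width_scale n \<le> (exp (sqrt ((ln (real n))\<^sup>2 + 1)) + 1) / real n"
proof -
  have l: "ln (real n) \<ge> 2" using half_ln_ge_1[OF n] by simp
  have j': "real j \<le> (ln (real n))\<^sup>2" "(ln (real n))\<^sup>2 < real (Suc j)" unfolding j by simp_all linarith+
  have "sqrt (real j) \<le> ln (real n)" using j'(1) l by (intro real_le_lsqrt) auto
  then have "exp (sqrt (real j)) \<le> exp (ln (real n))" by simp
  then have "exp (sqrt (real j)) \<le> real n" using n by simp
  then have "\<lceil>exp (sqrt (real j))\<rceil> \<le> int n" by (simp add: ceiling_le_iff)
  then show le: "checkpoint j \<le> n" by (simp only: checkpoint_def nat_le_iff)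
  have "ln (real n) \<le> sqrt (real (Suc j))" using j'(2) by (intro real_le_rsqrt) auto
  then have "exp (ln (real n)) \<le> exp (sqrt (real (Suc j)))" by simp
  also have "\<dots> \<le> real (checkpoint (Suc j))" by (rule checkpoint_bounds)
  finally show ge: "n \<le> checkpoint (Suc j)" using n by simp
  have pos: "checkpoint j \<ge> 1" by (rule checkpoint_pos)
  \<comment> \<open>Monotonicity of \<open>L\<close> puts the quotient under the square root on the
    favourable side of 1 in both estimates.\<close>
  have Lmono: "L a \<le> L b" if "1 \<le> a" "a \<le> b" for a b
    unfolding L_def using that by (intro max.mono) auto
  have Lp: "L m > 0" for m using L_ge_1[of m] by linarith
  have rat: "width_scale m / width_scale n = real m / real n * sqrt (L n / L m)" for m
    using n Lp[of n] Lp[of m] by (simp add: width_scale_def real_sqrt_mult real_sqrt_divide field_simps)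
  have "exp (sqrt ((ln (real n))\<^sup>2 - 1)) \<le> real (checkpoint j)"
    using checkpoint_bounds(1)[of j] j'(2) by (intro order_trans[OF _ checkpoint_bounds(1)]) simp
  then have "exp (sqrt ((ln (real n))\<^sup>2 - 1)) / real n * 1 \<le> real (checkpoint j) / real n * sqrt (L n / L (checkpoint j))"
    using Lmono[OF pos le] Lp[of "checkpoint j"] by (intro mult_mono divide_right_mono) auto
  then show "exp (sqrt ((ln (real n))\<^sup>2 - 1)) / real n \<le> width_scale (checkpoint j) / width_scale n"
    by (simp add: rat)
  have "real (checkpoint (Suc j)) \<le> exp (sqrt ((ln (real n))\<^sup>2 + 1)) + 1"
    using j'(1) by (intro order_trans[OF checkpoint_bounds(2)]) simp
  moreover have "sqrt (L n / L (checkpoint (Suc j))) \<le> 1"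
    using Lmono[OF _ ge] n Lp[of "checkpoint (Suc j)"] by simp
  ultimately have "real (checkpoint (Suc j)) / real n * sqrt (L n / L (checkpoint (Suc j))) \<le>
      (exp (sqrt ((ln (real n))\<^sup>2 + 1)) + 1) / real n * 1"
    using Lp[of n] Lp[of "checkpoint (Suc j)"] by (intro mult_mono divide_right_mono) (auto intro: add_nonneg_nonneg less_imp_le)
  then show "width_scale (checkpoint (Suc j)) / width_scale n \<le> (exp (sqrt ((ln (real n))\<^sup>2 + 1)) + 1) / real n"
    by (simp add: rat)
qed

lemma AE_width_limit:
  assumes "port_process M T"
  shows "AE x in M. (\<lambda>n. real (width (T n x)) / mean_width n) \<longlonglongrightarrow> 1"
  using AE_width_checkpoint[OF assms] AE_width_mono[OF assms]
proof eventually_elim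
  case (elim x)
  have mono: "width (T m x) \<le> width (T n x)" if "1 \<le> m" "m \<le> n" for m n
    using that(2)
  proof (induction n rule: dec_induct)
    case (step n)
    then show ?case using elim(2) that(1) by (meson le_trans)
  qed simp
  define a where "a j = real (width (T (checkpoint j) x)) / width_scale (checkpoint j)" for j
  have a: "a \<longlonglongrightarrow> 1" using elim(1) unfolding a_def .
  define j where "j n = nat \<lfloor>(ln (real n))\<^sup>2\<rfloor>" for n :: nat
  have "filterlim (\<lambda>n::nat. (ln (real n))\<^sup>2) at_top sequentially" by real_asymp
  then have jlim: "filterlim j sequentially sequentially"
    unfolding filterlim_at_top
  proof (intro allI)
    fix Z :: nat
    show "\<forall>\<^sub>F n in sequentially. Z \<le> j n"
      using eventually_compose_filterlim[OF eventually_ge_at_top[of "real Z"] \<open>filterlim (\<lambda>n::nat. (ln (real n))\<^sup>2) at_top sequentially\<close>]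
      by eventually_elim (unfold j_def, linarith)
  qed
  have aj: "(\<lambda>n. a (j n)) \<longlonglongrightarrow> 1" by (rule filterlim_compose[OF a jlim])
  have "(\<lambda>n. a (Suc n)) \<longlonglongrightarrow> 1" using a by (rule LIMSEQ_Suc)
  then have aSj: "(\<lambda>n. a (Suc (j n))) \<longlonglongrightarrow> 1" by (rule filterlim_compose[OF _ jlim])
  have r1: "(\<lambda>n::nat. exp (sqrt ((ln (real n))\<^sup>2 - 1)) / real n) \<longlonglongrightarrow> 1" by real_asymp
  have r2: "(\<lambda>n::nat. (exp (sqrt ((ln (real n))\<^sup>2 + 1)) + 1) / real n) \<longlonglongrightarrow> 1" by real_asymp
  have sub1: "checkpoint i \<ge> 1" for i by (rule checkpoint_pos)
  have lower: "\<forall>\<^sub>F n in sequentially. a (j n) * (exp (sqrt ((ln (real n))\<^sup>2 - 1)) / real n) \<le> real (width (T n x)) / width_scale n"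
    using eventually_ge_at_top[of 9]
  proof eventually_elim
    case (elim n)
    note r = width_scale_ratio[OF elim j_def]
    have w: "width_scale n > 0" "width_scale (checkpoint (j n)) > 0" using elim sub1 by (auto intro: width_scale_pos)
    have "a (j n) * (exp (sqrt ((ln (real n))\<^sup>2 - 1)) / real n) \<le> a (j n) * (width_scale (checkpoint (j n)) / width_scale n)"
      using r(3) w by (intro mult_left_mono) (auto simp: a_def)
    also have "\<dots> = real (width (T (checkpoint (j n)) x)) / width_scale n" using w by (simp add: a_def)
    also have "\<dots> \<le> real (width (T n x)) / width_scale n"
      using mono[OF sub1 r(1)] w by (intro divide_right_mono) auto
    finally show ?case .
  qed
  have upper: "\<forall>\<^sub>F n in sequentially. real (width (T n x)) / width_scale n \<le> a (Suc (j n)) * ((exp (sqrt ((ln (real n))\<^sup>2 + 1)) + 1) / real n)"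
    using eventually_ge_at_top[of 9]
  proof eventually_elim
    case (elim n)
    note r = width_scale_ratio[OF elim j_def]
    have w: "width_scale n > 0" "width_scale (checkpoint (Suc (j n))) > 0" using elim sub1 by (auto intro: width_scale_pos)
    have "real (width (T n x)) / width_scale n \<le> real (width (T (checkpoint (Suc (j n))) x)) / width_scale n"
      using mono[OF _ r(2)] elim w by (intro divide_right_mono) auto
    also have "\<dots> = a (Suc (j n)) * (width_scale (checkpoint (Suc (j n))) / width_scale n)" using w by (simp add: a_def)
    also have "\<dots> \<le> a (Suc (j n)) * ((exp (sqrt ((ln (real n))\<^sup>2 + 1)) + 1) / real n)"
      using r(4) w by (intro mult_left_mono) (auto simp: a_def)
    finally show ?case .
  qed
  have V: "(\<lambda>n. real (width (T n x)) / width_scale n) \<longlonglongrightarrow> 1"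
    using tendsto_sandwich[OF lower upper] tendsto_mult[OF aj r1] tendsto_mult[OF aSj r2] by simp
  \<comment> \<open>So far the width is normalised by \<open>width_scale\<close>; the expansion of
    the mean now replaces this by \<open>mean_width\<close>.\<close>
  have "(\<lambda>n. 1 / L n) \<longlonglongrightarrow> 0"
  proof (rule Lim_transform_eventually)
    show "(\<lambda>n::nat. 1 / ln (real n)) \<longlonglongrightarrow> 0" by real_asymp
    show "\<forall>\<^sub>F n in sequentially. 1 / ln (real n) = 1 / L n"
      using eventually_ge_at_top[of 9] by eventually_elim (simp add: L_eq_ln)
  qed
  then have null: "(\<lambda>n. c * norm (1 / L n)) \<longlonglongrightarrow> 0" for c
    by (intro tendsto_mult_right_zero tendsto_norm_zero)
  obtain c where c: "\<forall>\<^sub>F n in sequentially. norm (mean_width n / width_scale n - 1) \<le> c * norm (1 / L n)"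
    by (rule landau_o.bigE[OF mean_width_asymp]) (rule that)
  have "(\<lambda>n. mean_width n / width_scale n - 1) \<longlonglongrightarrow> 0"
    by (rule Lim_null_comparison[OF c null])
  then have m: "(\<lambda>n. mean_width n / width_scale n) \<longlonglongrightarrow> 1" by (simp add: LIM_zero_iff)
  have "(\<lambda>n. (real (width (T n x)) / width_scale n) / (mean_width n / width_scale n)) \<longlonglongrightarrow> 1 / 1"
    by (intro tendsto_divide V m) simp
  moreover have "\<forall>\<^sub>F n in sequentially. (real (width (T n x)) / width_scale n) / (mean_width n / width_scale n) = real (width (T n x)) / mean_width n"
    using eventually_ge_at_top[of 1]
  proof eventually_elim
    case (elim n)
    then show ?case using width_scale_pos[of n] by simp
  qed
  ultimately have "(\<lambda>n. real (width (T n x)) / mean_width n) \<longlonglongrightarrow> 1 / 1"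
    by (rule Lim_transform_eventually)
  then show ?case by simp
qed

theorem mainTheorem6:
  fixes \<sigma> :: real and kstar :: "ptree \<Rightarrow> nat"
  assumes sigma: "\<sigma>\<^sup>2 = 1 / 2"
    and kstar: "\<And>n t. port n t \<Longrightarrow> profile t (kstar t) = width t"
  shows
    "(\<exists>\<epsilon> :: nat \<Rightarrow> real. \<epsilon> \<in> O(\<lambda>n. 1 / L n) \<and>
        (\<forall>n\<ge>1. mean_width n = real n / sqrt (2 * pi * \<sigma>\<^sup>2 * L n) * (1 + \<epsilon> n))) \<and>
     (\<forall>s\<ge>0. (\<lambda>n. measure_pmf.expectation (random_port n)
                  (\<lambda>t. \<bar>real (width t) - mean_width n\<bar> powr s))
             \<in> O(\<lambda>n. real n powr s * L n powr (- 3 * s / 2))) \<and>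
     (\<forall>B>0. \<exists>T0>1. \<exists>C :: real. \<forall>T>T0. \<forall>n\<ge>1.
        measure_pmf.prob (random_port n) {t. \<bar>real (kstar t) - L n / 2\<bar> \<ge> T} \<le> C * T powr (- B)) \<and>
     (\<forall>(M :: 'a measure) T. port_process M T \<longrightarrow>
        (AE x in M. (\<lambda>n. real (width (T n x)) / mean_width n) \<longlonglongrightarrow> 1))"
proof (intro conjI allI impI)
  show "\<exists>\<epsilon> :: nat \<Rightarrow> real. \<epsilon> \<in> O(\<lambda>n. 1 / L n) \<and>
      (\<forall>n\<ge>1. mean_width n = real n / sqrt (2 * pi * \<sigma>\<^sup>2 * L n) * (1 + \<epsilon> n))"
  proof (intro exI[of _ "\<lambda>n. mean_width n / width_scale n - 1"] conjI mean_width_asymp allI impI)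
    fix n :: nat assume n: "1 \<le> n"
    have "real n / sqrt (2 * pi * \<sigma>\<^sup>2 * L n) = width_scale n" by (simp add: sigma width_scale_def)
    then show "mean_width n = real n / sqrt (2 * pi * \<sigma>\<^sup>2 * L n) * (1 + (mean_width n / width_scale n - 1))"
      using width_scale_pos[OF n] by simp
  qed
next
  fix s :: real assume "0 \<le> s"
  then show "(\<lambda>n. expect n (\<lambda>t. \<bar>real (width t) - mean_width n\<bar> powr s)) \<in> O(\<lambda>n. real n powr s * L n powr (- 3 * s / 2))"
    by (rule width_central_moment)
next
  fix B :: real assume "0 < B"
  with kstar show "\<exists>T0>1. \<exists>C :: real. \<forall>T>T0. \<forall>n\<ge>1.
      measure_pmf.prob (random_port n) {t. \<bar>real (kstar t) - L n / 2\<bar> \<ge> T} \<le> C * T powr (- B)"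
    by (rule mode_tail)
next
  fix M :: "'a measure" and T
  assume "port_process M T"
  then show "AE x in M. (\<lambda>n. real (width (T n x)) / mean_width n) \<longlonglongrightarrow> 1"
    by (rule AE_width_limit)
qed

end
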